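(* Let $G$ and $H$ be topological abelian groups. If $H$ is Čech-complete, then $\mathrm{Ext}(G,H)\cong \mathrm{Ext}(\varrho G,H)$ (isomorphism of abelian groups), where $\varrho G$ denotes the completion of $G$.
   Context: All topological groups are Hausdorff and abelian. $\varrho G$ denotes the completion of the topological abelian group $G$. A topological abelian group $H$ is almost metrizable if there is a non-empty compact subset $K\subseteq H$ that has a countable base of neighbourhoods in $H$; a topological abelian group is Čech-complete if and only if it is almost metrizable and complete. An extension of topological abelian groups is a short exact sequence $E:0\to H\stackrel{\imath}{\to}X\stackrel{\pi}{\to}G\to 0$ of topological abelian groups in which $\imath,\pi$ are continuous homomorphisms that are open onto their images. Two extensions $0\to H\stackrel{\imath}{\to}X\stackrel{\pi}{\to}G\to 0$ and $0\to H\stackrel{\imath'}{\to}X'\stackrel{\pi'}{\to}G\to 0$ are equivalent if there is a continuous homomorphism $T:X\to X'$ with $T\circ\imath=\imath'$ and $\pi'\circ T=\pi$ (such a $T$ is necessarily a topological isomorphism). $\mathrm{Ext}(G,H)$ is the set of equivalence classes of such extensions. It is an abelian group under the Baer sum: $[E_1]+[E_2]$ is the class of the extension obtained from the product extension $0\to H\times H\to X_1\times X_2\to G\times G\to 0$ by pulling back along the diagonal $G\to G\times G$ and then pushing out along the addition map $H\times H\to H$ (pull-backs and push-outs taken in topological abelian groups). The zero element is the class of the trivial extension $0\to H\to H\times G\to G\to 0$. *)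

theory Defs
  imports "HOL-Analysis.Analysis" "HOL-Algebra.Coset"
begin

section \<open>Topological abelian groups\<close>

record 'a top_group = "'a monoid" +
  topo :: "'a topology"

definition top_ab_group :: "'a top_group \<Rightarrow> bool" where
  "top_ab_group G \<longleftrightarrow>
     comm_group G \<and>
     topspace (topo G) = carrier G \<and>
     Hausdorff_space (topo G) \<and>
     continuous_map (prod_topology (topo G) (topo G)) (topo G) (\<lambda>(x, y). x \<otimes>\<^bsub>G\<^esub> y) \<and>
     continuous_map (topo G) (topo G) (m_inv G)"

definition cont_hom :: "'a top_group \<Rightarrow> 'b top_group \<Rightarrow> ('a \<Rightarrow> 'b) set" where
  "cont_hom G H = {f \<in> hom G H. continuous_map (topo G) (topo H) f}"

definition prod_top_group :: "'a top_group \<Rightarrow> 'b top_group \<Rightarrow> ('a \<times> 'b) top_group" where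
  "prod_top_group G H =
     \<lparr>carrier = carrier (G \<times>\<times> H), mult = mult (G \<times>\<times> H), one = one (G \<times>\<times> H),
      topo = prod_topology (topo G) (topo H)\<rparr>"

definition sub_top_group :: "'a top_group \<Rightarrow> 'a set \<Rightarrow> 'a top_group" where
  "sub_top_group G A = G\<lparr>carrier := A, topo := subtopology (topo G) A\<rparr>"

definition quotient_topology :: "'a topology \<Rightarrow> ('a \<Rightarrow> 'b) \<Rightarrow> 'b topology" where
  "quotient_topology T f =
     topology (\<lambda>V. V \<subseteq> f ` topspace T \<and> openin T {x \<in> topspace T. f x \<in> V})"

definition quot_top_group :: "'a top_group \<Rightarrow> 'a set \<Rightarrow> 'a set top_group" where
  "quot_top_group G N =
     \<lparr>carrier = carrier (G Mod N), mult = mult (G Mod N), one = one (G Mod N),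
      topo = quotient_topology (topo G) (\<lambda>x. N #>\<^bsub>G\<^esub> x)\<rparr>"

lemma openin_quotient_topology:
  "openin (quotient_topology T f) V \<longleftrightarrow>
     V \<subseteq> f ` topspace T \<and> openin T {x \<in> topspace T. f x \<in> V}"
proof -
  have "istopology (\<lambda>V. V \<subseteq> f ` topspace T \<and> openin T {x \<in> topspace T. f x \<in> V})"
    unfolding istopology_def
  proof (intro conjI allI impI)
    fix S U
    assume S: "S \<subseteq> f ` topspace T \<and> openin T {x \<in> topspace T. f x \<in> S}"
      and U: "U \<subseteq> f ` topspace T \<and> openin T {x \<in> topspace T. f x \<in> U}"
    have "{x \<in> topspace T. f x \<in> S \<inter> U} =
          {x \<in> topspace T. f x \<in> S} \<inter> {x \<in> topspace T. f x \<in> U}" by auto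
    then show "openin T {x \<in> topspace T. f x \<in> S \<inter> U}" using S U by auto
    show "S \<inter> U \<subseteq> f ` topspace T" using S by auto
  next
    fix K
    assume K: "\<forall>V\<in>K. V \<subseteq> f ` topspace T \<and> openin T {x \<in> topspace T. f x \<in> V}"
    have "{x \<in> topspace T. f x \<in> \<Union>K} = \<Union>((\<lambda>V. {x \<in> topspace T. f x \<in> V}) ` K)" by auto
    then show "openin T {x \<in> topspace T. f x \<in> \<Union>K}" using K by auto
    show "\<Union>K \<subseteq> f ` topspace T" using K by auto
  qed
  then show ?thesis
    unfolding quotient_topology_def by (simp add: topology_inverse')
qed

lemma topspace_quotient_topology [simp]:
  "topspace (quotient_topology T f) = f ` topspace T"
proof -
  have "{x \<in> topspace T. f x \<in> f ` topspace T} = topspace T" by auto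
  then have "openin (quotient_topology T f) (f ` topspace T)"
    by (simp add: openin_quotient_topology)
  then have "f ` topspace T \<subseteq> topspace (quotient_topology T f)"
    by (rule openin_subset)
  moreover have "topspace (quotient_topology T f) \<subseteq> f ` topspace T"
    using openin_topspace[of "quotient_topology T f"] unfolding openin_quotient_topology by blast
  ultimately show ?thesis by blast
qed

lemma quotient_map_quotient_topology:
  "quotient_map T (quotient_topology T f) f"
  unfolding quotient_map_def by (simp add: openin_quotient_topology)

section \<open>Completeness, completions, almost metrizable and Cech-complete groups\<close>

definition cauchy_filter_on :: "'a top_group \<Rightarrow> 'a filter \<Rightarrow> bool" where
  "cauchy_filter_on G F \<longleftrightarrow>
     F \<noteq> bot \<and> F \<le> principal (carrier G) \<and>
     (\<forall>U. openin (topo G) U \<and> \<one>\<^bsub>G\<^esub> \<in> U \<longrightarrow>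
        (\<forall>\<^sub>F (x, y) in F \<times>\<^sub>F F. x \<otimes>\<^bsub>G\<^esub> inv\<^bsub>G\<^esub> y \<in> U))"

definition complete_top_group :: "'a top_group \<Rightarrow> bool" where
  "complete_top_group G \<longleftrightarrow>
     (\<forall>F. cauchy_filter_on G F \<longrightarrow> (\<exists>x. limitin (topo G) (\<lambda>y. y) x F))"

text \<open>A completion of \<open>G\<close> is a complete group together with a dense embedding of \<open>G\<close>; this
  determines it up to a unique topological isomorphism under \<open>G\<close>.\<close>

definition is_completion :: "'a top_group \<Rightarrow> 'b top_group \<Rightarrow> ('a \<Rightarrow> 'b) \<Rightarrow> bool" where
  "is_completion G C j \<longleftrightarrow>
     top_ab_group C \<and> complete_top_group C \<and>
     j \<in> hom G C \<and> embedding_map (topo G) (topo C) j \<and>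
     topo C closure_of (j ` carrier G) = carrier C"

definition almost_metrizable :: "'a top_group \<Rightarrow> bool" where
  "almost_metrizable H \<longleftrightarrow>
     (\<exists>K. K \<noteq> {} \<and> compactin (topo H) K \<and>
        (\<exists>\<B>. countable \<B> \<and>
           (\<forall>B\<in>\<B>. B \<subseteq> carrier H \<and> K \<subseteq> topo H interior_of B) \<and>
           (\<forall>U. openin (topo H) U \<and> K \<subseteq> U \<longrightarrow> (\<exists>B\<in>\<B>. B \<subseteq> U))))"

definition Cech_complete :: "'a top_group \<Rightarrow> bool" where
  "Cech_complete H \<longleftrightarrow> almost_metrizable H \<and> complete_top_group H"

section \<open>Extensions\<close>

record ('h, 'x, 'g) ext_seq =
  mid :: "'x top_group"
  inc :: "'h \<Rightarrow> 'x"
  prj :: "'x \<Rightarrow> 'g"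

definition is_ext :: "'h top_group \<Rightarrow> 'g top_group \<Rightarrow> ('h, 'x, 'g) ext_seq \<Rightarrow> bool" where
  "is_ext H G E \<longleftrightarrow>
     top_ab_group (mid E) \<and>
     inc E \<in> cont_hom H (mid E) \<and> prj E \<in> cont_hom (mid E) G \<and>
     open_map (topo H) (subtopology (topo (mid E)) (inc E ` carrier H)) (inc E) \<and>
     open_map (topo (mid E)) (subtopology (topo G) (prj E ` carrier (mid E))) (prj E) \<and>
     inj_on (inc E) (carrier H) \<and>
     inc E ` carrier H = kernel (mid E) G (prj E) \<and>
     prj E ` carrier (mid E) = carrier G"

definition ext_equiv ::
  "'h top_group \<Rightarrow> ('h, 'x, 'g) ext_seq \<Rightarrow> ('h, 'y, 'g) ext_seq \<Rightarrow> bool" where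
  "ext_equiv H E E' \<longleftrightarrow>
     (\<exists>T \<in> cont_hom (mid E) (mid E').
        (\<forall>h\<in>carrier H. T (inc E h) = inc E' h) \<and>
        (\<forall>x\<in>carrier (mid E). prj E' (T x) = prj E x))"

definition trivial_ext :: "'h top_group \<Rightarrow> 'g top_group \<Rightarrow> ('h, 'h \<times> 'g, 'g) ext_seq" where
  "trivial_ext H G =
     \<lparr>mid = prod_top_group H G, inc = (\<lambda>h. (h, \<one>\<^bsub>G\<^esub>)), prj = snd\<rparr>"

definition prod_ext ::
  "('h, 'x, 'g) ext_seq \<Rightarrow> ('h', 'x', 'g') ext_seq \<Rightarrow> ('h \<times> 'h', 'x \<times> 'x', 'g \<times> 'g') ext_seq" where
  "prod_ext E E' =
     \<lparr>mid = prod_top_group (mid E) (mid E'),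
      inc = map_prod (inc E) (inc E'), prj = map_prod (prj E) (prj E')\<rparr>"

text \<open>Pull-back of an extension of \<open>G\<close> along \<open>t : G' \<rightarrow> G\<close>.\<close>

definition pullback_ext ::
  "'g' top_group \<Rightarrow> ('g' \<Rightarrow> 'g) \<Rightarrow> ('h, 'x, 'g) ext_seq \<Rightarrow> ('h, 'x \<times> 'g', 'g') ext_seq" where
  "pullback_ext G' t E =
     \<lparr>mid = sub_top_group (prod_top_group (mid E) G')
              {(x, g) \<in> carrier (mid E) \<times> carrier G'. prj E x = t g},
      inc = (\<lambda>h. (inc E h, \<one>\<^bsub>G'\<^esub>)), prj = snd\<rparr>"

text \<open>Push-out of an extension by \<open>H\<close> along \<open>a : H \<rightarrow> H'\<close>: the quotient of \<open>H' \<times> X\<close> by the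
  subgroup of all \<open>(a h, - \<iota> h)\<close>. The new projection sends the coset of \<open>(h', x)\<close> to \<open>\<pi> x\<close>.\<close>

definition pushout_ext ::
  "'h top_group \<Rightarrow> 'h' top_group \<Rightarrow> ('h \<Rightarrow> 'h') \<Rightarrow> ('h, 'x, 'g) ext_seq
     \<Rightarrow> ('h', ('h' \<times> 'x) set, 'g) ext_seq" where
  "pushout_ext H H' a E =
     (let P = prod_top_group H' (mid E);
          N = (\<lambda>h. (a h, inv\<^bsub>mid E\<^esub> (inc E h))) ` carrier H
      in \<lparr>mid = quot_top_group P N,
          inc = (\<lambda>h'. N #>\<^bsub>P\<^esub> (h', \<one>\<^bsub>mid E\<^esub>)),
          prj = (\<lambda>c. the_elem ((\<lambda>z. prj E (snd z)) ` c))\<rparr>)"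

definition baer_sum ::
  "'h top_group \<Rightarrow> 'g top_group \<Rightarrow> ('h, 'x, 'g) ext_seq \<Rightarrow> ('h, 'y, 'g) ext_seq
     \<Rightarrow> ('h, ('h \<times> (('x \<times> 'y) \<times> 'g)) set, 'g) ext_seq" where
  "baer_sum H G E\<^sub>1 E\<^sub>2 =
     pushout_ext (prod_top_group H H) H (\<lambda>(h, k). h \<otimes>\<^bsub>H\<^esub> k)
       (pullback_ext G (\<lambda>g. (g, g)) (prod_ext E\<^sub>1 E\<^sub>2))"

section \<open>The group of extensions\<close>

text \<open>The middle group of an extension may be an arbitrary group, so the equivalence classes
  cannot be formed over all types at once. They are formed over the middle groups whose carrier is
  a subset of the type \<open>'h \<times> 'g\<close>; nothing is lost by this, see \<open>ext_has_small_representative\<close>.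
  An extension with another middle type, such as a Baer sum, is identified with the class
  \<open>ext_class\<close> of the representatives of this form that are equivalent to it.\<close>

type_synonym ('h, 'g) small_ext = "('h, 'h \<times> 'g, 'g) ext_seq"

definition ext_class ::
  "'h top_group \<Rightarrow> 'g top_group \<Rightarrow> ('h, 'x, 'g) ext_seq \<Rightarrow> ('h, 'g) small_ext set" where
  "ext_class H G E = {E'. is_ext H G E' \<and> ext_equiv H E E'}"

definition Ext :: "'g top_group \<Rightarrow> 'h top_group \<Rightarrow> ('h, 'g) small_ext set monoid" where
  "Ext G H =
     \<lparr>carrier = {E. is_ext H G E} //
                  {(E, E'). is_ext H G E \<and> is_ext H G E' \<and> ext_equiv H E E'},
      mult = (\<lambda>A B. \<Union>E\<^sub>1\<in>A. \<Union>E\<^sub>2\<in>B. ext_class H G (baer_sum H G E\<^sub>1 E\<^sub>2)),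
      one = ext_class H G (trivial_ext H G)\<rparr>"

definition transport :: "('x \<Rightarrow> 'y) \<Rightarrow> 'x top_group \<Rightarrow> 'y top_group" where
  "transport f X =
     \<lparr>carrier = f ` carrier X,
      mult = (\<lambda>a b. f (inv_into (carrier X) f a \<otimes>\<^bsub>X\<^esub> inv_into (carrier X) f b)),
      one = f \<one>\<^bsub>X\<^esub>,
      topo = pullback_topology (f ` carrier X) (inv_into (carrier X) f) (topo X)\<rparr>"

lemma transport_top_ab_group:
  assumes X: "top_ab_group X" and f: "inj_on f (carrier X)"
  shows "top_ab_group (transport f X)"
    and "f \<in> cont_hom X (transport f X)"
    and "inv_into (carrier X) f \<in> cont_hom (transport f X) X"
    and "homeomorphic_maps (topo X) (topo (transport f X)) f (inv_into (carrier X) f)"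
proof -
  define g where "g = inv_into (carrier X) f"
  define Y where "Y = transport f X"
  interpret X: comm_group X using X by (simp add: top_ab_group_def)
  have ts: "topspace (topo X) = carrier X" using X by (simp add: top_ab_group_def)
  have gf [simp]: "g (f x) = x" if "x \<in> carrier X" for x
    using f that by (simp add: g_def)
  have gY: "g y \<in> carrier X" and fg: "f (g y) = y" if "y \<in> carrier Y" for y
    using that f by (auto simp: Y_def transport_def g_def)
  have cY: "carrier Y = f ` carrier X" and mY: "mult Y = (\<lambda>a b. f (g a \<otimes>\<^bsub>X\<^esub> g b))"
    and oY: "one Y = f \<one>\<^bsub>X\<^esub>" and tY: "topo Y = pullback_topology (carrier Y) g (topo X)"
    by (auto simp: Y_def transport_def g_def)
  have tsY: "topspace (topo Y) = carrier Y"
    unfolding tY topspace_pullback_topology ts using gY by auto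
  have comm: "comm_group Y"
  proof (rule comm_groupI)
    fix y assume "y \<in> carrier Y"
    then obtain x where x: "x \<in> carrier X" "y = f x" by (auto simp: cY)
    then have "f (inv\<^bsub>X\<^esub> x) \<in> carrier Y" "f (inv\<^bsub>X\<^esub> x) \<otimes>\<^bsub>Y\<^esub> y = \<one>\<^bsub>Y\<^esub>"
      by (simp_all add: cY mY oY)
    then show "\<exists>z\<in>carrier Y. z \<otimes>\<^bsub>Y\<^esub> y = \<one>\<^bsub>Y\<^esub>" by blast
  qed (auto simp: cY mY oY X.m_ac)
  interpret Y: comm_group Y by (rule comm)
  have cont_g: "continuous_map (topo Y) (topo X) g"
    unfolding tY using continuous_map_pullback[of "topo X" "topo X" id "carrier Y" g]
    by (simp add: o_def)
  have cont_f: "continuous_map (topo X) (topo Y) f"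
    unfolding tY
  proof (rule continuous_map_pullback')
    show "continuous_map (topo X) (topo X) (g \<circ> f)"
      by (rule continuous_map_eq[of _ _ id]) (simp_all add: ts)
    show "topspace (topo X) \<subseteq> f -` carrier Y"
      by (auto simp: ts cY)
  qed
  have hm: "homeomorphic_maps (topo X) (topo Y) f g"
    unfolding homeomorphic_maps_def using cont_f cont_g fg by (auto simp: ts tsY)
  have homf: "f \<in> hom X Y"
    by (rule homI) (auto simp: cY mY)
  have homg: "g \<in> hom Y X"
    by (rule homI) (auto simp: cY mY)
  have inv: "f (inv\<^bsub>X\<^esub> (g y)) = inv\<^bsub>Y\<^esub> y" if "y \<in> carrier Y" for y
  proof (rule Y.inv_equality[symmetric])
    show "f (inv\<^bsub>X\<^esub> (g y)) \<otimes>\<^bsub>Y\<^esub> y = \<one>\<^bsub>Y\<^esub>" using gY[OF that] by (simp add: mY oY)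
  qed (use gY[OF that] that in \<open>auto simp: cY\<close>)
  have "Hausdorff_space (topo Y)"
    using X hm homeomorphic_Hausdorff_space[of "topo X" "topo Y"]
    by (auto simp: top_ab_group_def homeomorphic_space_def)
  moreover have "continuous_map (prod_topology (topo Y) (topo Y)) (topo Y) (\<lambda>(x, y). x \<otimes>\<^bsub>Y\<^esub> y)"
  proof -
    have 1: "continuous_map (prod_topology (topo Y) (topo Y)) (prod_topology (topo X) (topo X))
            (\<lambda>(x, y). (g x, g y))"
      using cont_g by (simp add: continuous_map_prod_top)
    have 2: "continuous_map (prod_topology (topo X) (topo X)) (topo X) (\<lambda>(x, y). x \<otimes>\<^bsub>X\<^esub> y)"
      using X by (simp add: top_ab_group_def)
    show ?thesis
      using continuous_map_compose[OF continuous_map_compose[OF 1 2] cont_f]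
      by (simp add: mY o_def case_prod_unfold)
  qed
  moreover have "continuous_map (topo Y) (topo Y) (m_inv Y)"
  proof (rule continuous_map_eq)
    have 2: "continuous_map (topo X) (topo X) (m_inv X)"
      using X by (simp add: top_ab_group_def)
    show "continuous_map (topo Y) (topo Y) (\<lambda>y. f (inv\<^bsub>X\<^esub> (g y)))"
      using continuous_map_compose[OF continuous_map_compose[OF cont_g 2] cont_f]
      by (simp add: o_def)
  qed (simp add: tsY inv)
  ultimately show "top_ab_group (transport f X)"
    using comm tsY by (simp add: top_ab_group_def Y_def[symmetric])
  show "f \<in> cont_hom X (transport f X)"
    using homf cont_f by (simp add: cont_hom_def Y_def)
  show "inv_into (carrier X) f \<in> cont_hom (transport f X) X"
    using homg cont_g by (simp add: cont_hom_def Y_def g_def)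
  show "homeomorphic_maps (topo X) (topo (transport f X)) f (inv_into (carrier X) f)"
    using hm by (simp add: Y_def g_def)
qed

lemma ext_has_small_representative:
  fixes E :: "('h, 'x, 'g) ext_seq"
  assumes H: "top_ab_group H" and G: "top_ab_group G" and E: "is_ext H G E"
  shows "\<exists>E' :: ('h, 'g) small_ext. is_ext H G E' \<and> ext_equiv H E E' \<and> ext_equiv H E' E"
proof -
  define X where "X = mid E"
  have X: "top_ab_group X" using E by (simp add: is_ext_def X_def)
  interpret X: comm_group X using X by (simp add: top_ab_group_def)
  interpret G: comm_group G using G by (simp add: top_ab_group_def)
  have ts: "topspace (topo X) = carrier X" using X by (simp add: top_ab_group_def)
  have pj: "prj E \<in> hom X G" and ic: "inc E \<in> hom H X"
    and ker: "inc E ` carrier H = kernel X G (prj E)"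
    and ct: "continuous_map (topo X) (topo G) (prj E)" "continuous_map (topo H) (topo X) (inc E)"
    and op: "open_map (topo H) (subtopology (topo X) (inc E ` carrier H)) (inc E)"
            "open_map (topo X) (subtopology (topo G) (prj E ` carrier X)) (prj E)"
    and inj: "inj_on (inc E) (carrier H)"
    and sur: "prj E ` carrier X = carrier G"
    using E by (auto simp: is_ext_def cont_hom_def X_def)
  have tsH: "topspace (topo H) = carrier H" using H by (simp add: top_ab_group_def)
  interpret pj: group_hom X G "prj E"
    using pj by (intro group_hom.intro group_hom_axioms.intro X.is_group G.is_group)
  define s where "s = inv_into (carrier X) (prj E)"
  have s: "s (prj E x) \<in> carrier X" "prj E (s (prj E x)) = prj E x" if "x \<in> carrier X" for x
    using that by (auto simp: s_def inv_into_into f_inv_into_f)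
  define d where "d = (\<lambda>x. x \<otimes>\<^bsub>X\<^esub> inv\<^bsub>X\<^esub> s (prj E x))"
  have dker: "d x \<in> inc E ` carrier H" if "x \<in> carrier X" for x
    unfolding ker kernel_def d_def using s[OF that] that by simp
  define f :: "'x \<Rightarrow> 'h \<times> 'g" where
    "f = (\<lambda>x. (inv_into (carrier H) (inc E) (d x), prj E x))"
  have f: "inj_on f (carrier X)"
  proof (rule inj_onI)
    fix x y assume xy: "x \<in> carrier X" "y \<in> carrier X" "f x = f y"
    then have p: "prj E x = prj E y"
      and i: "inv_into (carrier H) (inc E) (d x) = inv_into (carrier H) (inc E) (d y)"
      by (auto simp: f_def)
    have "d x = d y" using i dker xy by (metis inv_into_injective)
    then show "x = y" using p xy s(1)[OF xy(1)] by (simp add: d_def)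
  qed
  define g where "g = inv_into (carrier X) f"
  define Y where "Y = transport f X"
  note tr = transport_top_ab_group[OF X f, folded g_def Y_def]
  have gf [simp]: "g (f x) = x" if "x \<in> carrier X" for x
    using f that by (simp add: g_def)
  have cY: "carrier Y = f ` carrier X" by (simp add: Y_def transport_def)
  have hf: "homeomorphic_map (topo X) (topo Y) f" and hg: "homeomorphic_map (topo Y) (topo X) g"
    using tr(4) homeomorphic_maps_map by blast+
  define E' :: "('h, 'g) small_ext" where "E' = \<lparr>mid = Y, inc = f \<circ> inc E, prj = prj E \<circ> g\<rparr>"
  have icH: "inc E h \<in> carrier X" if "h \<in> carrier H" for h using ic that by (auto simp: hom_def)
  have gsub: "g ` carrier Y = carrier X" unfolding cY image_image by simp
  have "is_ext H G E'"
    unfolding is_ext_def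
  proof (intro conjI)
    show "top_ab_group (mid E')" using tr(1) by (simp add: E'_def)
    show "inc E' \<in> cont_hom H (mid E')"
      using tr(2) ic ct(2) by (auto simp: E'_def cont_hom_def intro: hom_compose continuous_map_compose)
    show "prj E' \<in> cont_hom (mid E') G"
      using tr(3) pj ct(1) by (auto simp: E'_def cont_hom_def intro: hom_compose continuous_map_compose)
    have "homeomorphic_map (subtopology (topo X) (inc E ` carrier H))
             (subtopology (topo Y) (f ` (inc E ` carrier H))) f"
      by (rule homeomorphic_map_subtopologies_alt[OF hf]) (use f icH in \<open>auto simp: ts inj_on_def\<close>)
    then have "open_map (subtopology (topo X) (inc E ` carrier H))
             (subtopology (topo Y) (f ` (inc E ` carrier H))) f"
      by (rule homeomorphic_imp_open_map)
    then show "open_map (topo H) (subtopology (topo (mid E')) (inc E' ` carrier H)) (inc E')"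
      using open_map_compose[OF op(1)] by (simp add: E'_def image_comp)
    have im: "(prj E \<circ> g) ` carrier Y = prj E ` carrier X"
      using gsub by (metis image_comp)
    show "open_map (topo (mid E')) (subtopology (topo G) (prj E' ` carrier (mid E'))) (prj E')"
      using open_map_compose[OF homeomorphic_imp_open_map[OF hg] op(2)] im by (simp add: E'_def)
    have "inj_on f (inc E ` carrier H)"
      using f by (rule inj_on_subset) (use icH in auto)
    then show "inj_on (inc E') (carrier H)"
      using comp_inj_on[OF inj] by (simp add: E'_def)
    have "(f \<circ> inc E) ` carrier H = f ` kernel X G (prj E)"
      using ker by (metis image_comp)
    also have "\<dots> = kernel Y G (prj E \<circ> g)"
      by (auto simp: kernel_def cY)
    finally show "inc E' ` carrier H = kernel (mid E') G (prj E')"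
      by (simp add: E'_def)
    show "prj E' ` carrier (mid E') = carrier G"
      using im sur by (simp add: E'_def)
  qed
  moreover have "ext_equiv H E E'"
    unfolding ext_equiv_def using tr(2) by (intro bexI[of _ f]) (auto simp: E'_def X_def[symmetric])
  moreover have "ext_equiv H E' E"
    unfolding ext_equiv_def using tr(3) icH
    by (intro bexI[of _ g]) (auto simp: E'_def X_def[symmetric])
  ultimately show ?thesis by blast
qed

end

theory Submission
  imports Defs
begin

text \<open>
  Let \<open>j : G \<rightarrow> C\<close> be the completion of \<open>G\<close>. The isomorphism is inverse to the pull-back of extensions along
  \<open>j\<close>, and the proof consists in showing that the pull-back is additive, injective and surjective on
  equivalence classes (\<open>Ext_iso_of_pullback\<close>).

  Additivity is formal. An extension is a Baer sum of two others if and only if it receives a morphism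
  from their fibre product that lies over the multiplication of \<open>H\<close> (\<open>baer_sum_equiv_iff\<close>), and such
  morphisms can be pulled back (\<open>baer_sum_pullback\<close>).

  Injectivity uses that completeness is a three-space property (\<open>mid_complete\<close>): as \<open>H\<close> and \<open>C\<close> are
  complete, so is the middle group of each extension of \<open>C\<close> by \<open>H\<close>. Since the pull-back sits densely in that
  group, an equivalence of pull-backs extends by continuity (\<open>ext_equiv_of_pullback_equiv\<close>).

  For surjectivity, let \<open>0 \<rightarrow> H \<rightarrow> X \<rightarrow> G \<rightarrow> 0\<close> be an extension and \<open>Y\<close> the completion of \<open>X\<close>. The map \<open>X \<rightarrow> G \<rightarrow> C\<close>
  extends to \<open>p : Y \<rightarrow> C\<close>, and \<open>0 \<rightarrow> H \<rightarrow> Y \<rightarrow> C \<rightarrow> 0\<close> is an extension that pulls back to the given one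
  (\<open>extension_over_completion\<close>). The kernel of \<open>p\<close> is \<open>H\<close> because \<open>H\<close> is complete. That \<open>p\<close> is onto and open
  amounts to lifting Cauchy filters from the quotient \<open>G\<close> to \<open>X\<close>, and this is where \<open>H\<close> has to be almost
  metrizable (\<open>lift_cauchy_filter\<close>). For metrizable \<open>H\<close> one lifts successively better approximations along
  a sequence of neighbourhoods whose traces on \<open>H\<close> form a base. For almost metrizable \<open>H\<close> the traces shrink only to a
  compact set; then the constructed filter is precompact at every scale, and an ultrafilter refining
  it is Cauchy.

  The completion of \<open>X\<close> is constructed from Cauchy filters \<open>F\<close> that absorb the neighbourhood filter of the
  identity; on these the group operation is the elementwise product of filters.
\<close>

section \<open>Topological groups, locally at the identity\<close>

text \<open>Open neighbourhoods of the identity. By translation they determine the whole topology, so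
  continuity, openness and embedding conditions on homomorphisms are stated with them throughout.\<close>
definition nb :: "'a top_group \<Rightarrow> 'a set \<Rightarrow> bool" where
  "nb X U \<longleftrightarrow> openin (topo X) U \<and> \<one>\<^bsub>X\<^esub> \<in> U"

context comm_group
begin

lemma mult_swap:
  "a \<in> carrier G \<Longrightarrow> b \<in> carrier G \<Longrightarrow> c \<in> carrier G \<Longrightarrow> d \<in> carrier G \<Longrightarrow>
    (a \<otimes> b) \<otimes> (c \<otimes> d) = (a \<otimes> c) \<otimes> (b \<otimes> d)"
  by (simp add: m_ac)

lemma mult_inv_cancel:
  "a \<in> carrier G \<Longrightarrow> y \<in> carrier G \<Longrightarrow> a \<otimes> (inv a \<otimes> y) = y"
  "a \<in> carrier G \<Longrightarrow> y \<in> carrier G \<Longrightarrow> inv a \<otimes> (a \<otimes> y) = y"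
  by (simp_all add: m_assoc[symmetric])

lemma div_translate:
  "a \<in> carrier G \<Longrightarrow> b \<in> carrier G \<Longrightarrow> y \<in> carrier G \<Longrightarrow> (inv a \<otimes> y) \<otimes> inv (inv b \<otimes> y) = inv a \<otimes> b"
  using mult_swap[of "inv a" y b "inv y"] by (simp add: inv_mult)

lemma mult_telescope:
  "a \<in> carrier G \<Longrightarrow> b \<in> carrier G \<Longrightarrow> c \<in> carrier G \<Longrightarrow> (a \<otimes> inv b) \<otimes> (b \<otimes> c) = a \<otimes> c"
  by (simp add: m_assoc mult_inv_cancel)

lemma div_mult_div:
  "a \<in> carrier G \<Longrightarrow> b \<in> carrier G \<Longrightarrow> c \<in> carrier G \<Longrightarrow> d \<in> carrier G \<Longrightarrow>
    (a \<otimes> b) \<otimes> inv (c \<otimes> d) = (a \<otimes> inv c) \<otimes> (b \<otimes> inv d)"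
  by (simp add: inv_mult mult_swap)

lemma div_eq_one: "a \<in> carrier G \<Longrightarrow> b \<in> carrier G \<Longrightarrow> a \<otimes> inv b = \<one> \<longleftrightarrow> a = b"
  by (metis inv_closed inv_equality inv_inv r_inv)

end

locale topological_ab_group =
  fixes X :: "'a top_group" (structure)
  assumes top_ab_group: "top_ab_group X"

sublocale topological_ab_group \<subseteq> comm_group X
  using top_ab_group by (simp add: top_ab_group_def)

context topological_ab_group
begin

lemma topspace_eq [simp]: "topspace (topo X) = carrier X"
  using top_ab_group by (simp add: top_ab_group_def)

lemma Hausdorff: "Hausdorff_space (topo X)"
  using top_ab_group by (simp add: top_ab_group_def)

lemma openin_carrier: "openin (topo X) U \<Longrightarrow> U \<subseteq> carrier X"
  using openin_subset[of "topo X" U] by simp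

lemma nb_carrier: "nb X U \<Longrightarrow> U \<subseteq> carrier X"
  using openin_carrier by (auto simp: nb_def)

lemma nb_one: "nb X U \<Longrightarrow> \<one> \<in> U"
  by (simp add: nb_def)

lemma nb_UNIV: "nb X (carrier X)"
  using openin_topspace[of "topo X"] by (simp add: nb_def)

lemma nb_Int: "nb X U \<Longrightarrow> nb X V \<Longrightarrow> nb X (U \<inter> V)"
  by (auto simp: nb_def)

lemma open_translate:
  assumes "openin (topo X) S" and a: "a \<in> carrier X"
  shows "openin (topo X) {x \<in> carrier X. a \<otimes> x \<in> S}"
proof -
  have 1: "continuous_map (prod_topology (topo X) (topo X)) (topo X) (\<lambda>(x, y). x \<otimes> y)"
    using top_ab_group by (simp add: top_ab_group_def)
  have 2: "continuous_map (topo X) (prod_topology (topo X) (topo X)) (\<lambda>x. (a, x))"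
    using a by (simp add: continuous_map_paired)
  have "continuous_map (topo X) (topo X) (\<lambda>x. a \<otimes> x)"
    using continuous_map_compose[OF 2 1] by (simp add: o_def)
  from openin_continuous_map_preimage[OF this assms(1)] show ?thesis by simp
qed

lemma nb_translate:
  "openin (topo X) S \<Longrightarrow> a \<in> S \<Longrightarrow> nb X {x \<in> carrier X. a \<otimes> x \<in> S}"
  using open_translate[of S a] openin_carrier[of S] by (auto simp: nb_def)

lemma openin_locally:
  "openin (topo X) S \<longleftrightarrow> S \<subseteq> carrier X \<and> (\<forall>x\<in>S. \<exists>U. nb X U \<and> (\<forall>u\<in>U. x \<otimes> u \<in> S))"
proof
  assume "openin (topo X) S"
  then show "S \<subseteq> carrier X \<and> (\<forall>x\<in>S. \<exists>U. nb X U \<and> (\<forall>u\<in>U. x \<otimes> u \<in> S))"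
    using nb_translate[of S] openin_carrier[of S] by blast
next
  assume *: "S \<subseteq> carrier X \<and> (\<forall>x\<in>S. \<exists>U. nb X U \<and> (\<forall>u\<in>U. x \<otimes> u \<in> S))"
  show "openin (topo X) S"
  proof (subst openin_subopen, intro ballI)
    fix x assume x: "x \<in> S"
    then obtain U where U: "nb X U" "\<And>u. u \<in> U \<Longrightarrow> x \<otimes> u \<in> S" using * by blast
    have xc: "x \<in> carrier X" using x * by blast
    have "openin (topo X) {y \<in> carrier X. inv x \<otimes> y \<in> U}"
      using U xc by (intro open_translate) (auto simp: nb_def)
    moreover have "x \<in> {y \<in> carrier X. inv x \<otimes> y \<in> U}" using xc U by (auto simp: nb_def)
    moreover have "{y \<in> carrier X. inv x \<otimes> y \<in> U} \<subseteq> S"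
    proof
      fix y assume "y \<in> {y \<in> carrier X. inv x \<otimes> y \<in> U}"
      then have "y \<in> carrier X" "x \<otimes> (inv x \<otimes> y) \<in> S" using U by auto
      then show "y \<in> S" using xc by (simp add: m_assoc[symmetric])
    qed
    ultimately show "\<exists>T. openin (topo X) T \<and> x \<in> T \<and> T \<subseteq> S" by blast
  qed
qed

lemma nb_at:
  assumes "nb X U" "a \<in> carrier X"
  shows "openin (topo X) {y \<in> carrier X. inv a \<otimes> y \<in> U}" "a \<in> {y \<in> carrier X. inv a \<otimes> y \<in> U}"
  using assms by (auto simp: nb_def intro: open_translate)

lemma nb_mult:
  assumes "nb X W"
  shows "\<exists>V. nb X V \<and> V \<subseteq> W \<and> (\<forall>x\<in>V. \<forall>y\<in>V. x \<otimes> y \<in> W)"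
proof -
  have c: "continuous_map (prod_topology (topo X) (topo X)) (topo X) (\<lambda>(x, y). x \<otimes> y)"
    using top_ab_group by (simp add: top_ab_group_def)
  have "openin (prod_topology (topo X) (topo X))
          {p \<in> topspace (prod_topology (topo X) (topo X)). (case p of (x, y) \<Rightarrow> x \<otimes> y) \<in> W}"
    using assms by (intro openin_continuous_map_preimage[OF c]) (simp add: nb_def)
  from openin_prod_topology_alt[THEN iffD1, OF this, rule_format, of \<one> \<one>]
  obtain A B where AB: "openin (topo X) A" "openin (topo X) B" "\<one> \<in> A" "\<one> \<in> B"
    "A \<times> B \<subseteq> {p \<in> topspace (prod_topology (topo X) (topo X)). (case p of (x, y) \<Rightarrow> x \<otimes> y) \<in> W}"
    using nb_one[OF assms] by auto
  then have "nb X (A \<inter> B \<inter> W)" using assms by (auto simp: nb_def)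
  moreover have "x \<otimes> y \<in> W" if "x \<in> A \<inter> B \<inter> W" "y \<in> A \<inter> B \<inter> W" for x y
    using subsetD[OF AB(5), of "(x, y)"] that by simp
  ultimately show ?thesis by blast
qed

lemma nb_inv:
  assumes "nb X W"
  shows "nb X {x \<in> carrier X. inv x \<in> W}"
proof -
  have c: "continuous_map (topo X) (topo X) (m_inv X)"
    using top_ab_group by (simp add: top_ab_group_def)
  show ?thesis
    using openin_continuous_map_preimage[OF c, of W] assms by (simp add: nb_def)
qed

lemma nb_sym:
  assumes "nb X W"
  shows "\<exists>V. nb X V \<and> V \<subseteq> W \<and> (\<forall>x\<in>V. inv x \<in> V) \<and> (\<forall>x\<in>V. \<forall>y\<in>V. x \<otimes> y \<in> W)"
proof -
  obtain A where A: "nb X A" "A \<subseteq> W" "\<forall>x\<in>A. \<forall>y\<in>A. x \<otimes> y \<in> W" using nb_mult[OF assms] by blast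
  let ?V = "A \<inter> {x \<in> carrier X. inv x \<in> A}"
  have "nb X ?V" using nb_Int[OF A(1) nb_inv[OF A(1)]] .
  moreover have "?V \<subseteq> W" "\<forall>x\<in>?V. inv x \<in> ?V" "\<forall>x\<in>?V. \<forall>y\<in>?V. x \<otimes> y \<in> W"
    using A nb_carrier[OF A(1)] by auto
  ultimately show ?thesis by blast
qed

text \<open>Products of four factors cover all estimates that follow: shorter ones arise by inserting the
  identity.\<close>
lemma nb_sym4:
  assumes "nb X U"
  shows "\<exists>V. nb X V \<and> V \<subseteq> U \<and> (\<forall>x\<in>V. inv x \<in> V) \<and> (\<forall>x\<in>V. \<forall>y\<in>V. \<forall>z\<in>V. \<forall>w\<in>V. (x \<otimes> y) \<otimes> (z \<otimes> w) \<in> U)"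
proof -
  obtain A where A: "nb X A" "A \<subseteq> U" "\<forall>x\<in>A. \<forall>y\<in>A. x \<otimes> y \<in> U" using nb_sym[OF assms] by blast
  obtain V where V: "nb X V" "V \<subseteq> A" "\<forall>x\<in>V. inv x \<in> V" "\<forall>x\<in>V. \<forall>y\<in>V. x \<otimes> y \<in> A" using nb_sym[OF A(1)] by blast
  show ?thesis using A V by (intro exI[of _ V]) blast
qed

lemma eq_oneI:
  assumes "x \<in> carrier X" "\<And>U. nb X U \<Longrightarrow> x \<in> U"
  shows "x = \<one>"
proof (rule ccontr)
  assume "x \<noteq> \<one>"
  then obtain U V where "openin (topo X) U" "openin (topo X) V" "\<one> \<in> U" "x \<in> V" "disjnt U V"
    using Hausdorff assms(1) unfolding Hausdorff_space_def by (metis one_closed topspace_eq)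
  then show False using assms(2)[of U] by (auto simp: nb_def disjnt_iff)
qed

lemma closedin_locally:
  assumes "S \<subseteq> carrier X"
    and "\<And>x. x \<in> carrier X \<Longrightarrow> (\<And>U. nb X U \<Longrightarrow> \<exists>u\<in>U. x \<otimes> u \<in> S) \<Longrightarrow> x \<in> S"
  shows "closedin (topo X) S"
  unfolding closedin_def topspace_eq
proof
  show "openin (topo X) (carrier X - S)"
    unfolding openin_locally
  proof (intro conjI ballI)
    fix x assume x: "x \<in> carrier X - S"
    then obtain U where "nb X U" "\<forall>u\<in>U. x \<otimes> u \<notin> S" using assms(2)[of x] by blast
    then show "\<exists>U. nb X U \<and> (\<forall>u\<in>U. x \<otimes> u \<in> carrier X - S)"
      using x nb_carrier[of U] by blast
  qed auto
qed (use assms in auto)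

end

text \<open>Joint continuity of the group operations follows from continuity of \<open>(x, y) \<mapsto> x y\<^sup>-\<^sup>1\<close> at the
  identity, because translations are continuous; and two points \<open>a\<close>, \<open>b\<close> are separated by translates of
  a neighbourhood \<open>V\<close> such that \<open>V V\<^sup>-\<^sup>1\<close> misses \<open>a\<^sup>-\<^sup>1 b\<close>.\<close>
lemma top_ab_groupI:
  fixes X :: "'a top_group" (structure)
  assumes cg: "comm_group X" and ts: "topspace (topo X) = carrier X"
    and trans: "\<And>S a. openin (topo X) S \<Longrightarrow> a \<in> carrier X \<Longrightarrow> openin (topo X) {x \<in> carrier X. a \<otimes> x \<in> S}"
    and div: "\<And>U. nb X U \<Longrightarrow> \<exists>V. nb X V \<and> (\<forall>x\<in>V. \<forall>y\<in>V. x \<otimes> inv y \<in> U)"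
    and sep: "\<And>x. x \<in> carrier X \<Longrightarrow> (\<And>U. nb X U \<Longrightarrow> x \<in> U) \<Longrightarrow> x = \<one>"
  shows "top_ab_group X"
proof -
  interpret comm_group X by (rule cg)
  have sub: "U \<subseteq> carrier X" if "openin (topo X) U" for U using openin_subset[OF that] ts by simp
  have nbt: "nb X {x \<in> carrier X. a \<otimes> x \<in> S}" if "openin (topo X) S" "a \<in> S" for a S
    using trans[OF that(1), of a] sub[OF that(1)] that by (auto simp: nb_def)
  have at: "openin (topo X) {y \<in> carrier X. inv a \<otimes> y \<in> U}" "a \<in> {y \<in> carrier X. inv a \<otimes> y \<in> U}"
    if "nb X U" "a \<in> carrier X" for U a
    using that by (auto simp: nb_def intro: trans)
  have inv_nb: "\<exists>V. nb X V \<and> (\<forall>y\<in>V. inv y \<in> U)" if U: "nb X U" for U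
  proof -
    obtain V where V: "nb X V" "\<forall>x\<in>V. \<forall>y\<in>V. x \<otimes> inv y \<in> U" using div[OF U] by blast
    have "inv y \<in> U" if "y \<in> V" for y
    proof -
      have "\<one> \<in> V" "y \<in> carrier X" using V(1) sub that by (auto simp: nb_def)
      then show ?thesis using V(2) that by force
    qed
    then show ?thesis using V(1) by blast
  qed
  have "continuous_map (prod_topology (topo X) (topo X)) (topo X) (\<lambda>(x, y). x \<otimes> y)"
    unfolding continuous_map_def
  proof (intro conjI allI impI)
    fix W assume W: "openin (topo X) W"
    show "openin (prod_topology (topo X) (topo X))
       {p \<in> topspace (prod_topology (topo X) (topo X)). (case p of (x, y) \<Rightarrow> x \<otimes> y) \<in> W}"
      unfolding openin_prod_topology_alt
    proof (intro allI impI)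
      fix a b assume "(a, b) \<in> {p \<in> topspace (prod_topology (topo X) (topo X)). (case p of (x, y) \<Rightarrow> x \<otimes> y) \<in> W}"
      then have ab: "a \<in> carrier X" "b \<in> carrier X" "a \<otimes> b \<in> W" by (auto simp: ts)
      obtain V where V: "nb X V" "\<forall>x\<in>V. \<forall>y\<in>V. x \<otimes> inv y \<in> {x \<in> carrier X. (a \<otimes> b) \<otimes> x \<in> W}"
        using div[OF nbt[OF W ab(3)]] by blast
      obtain V' where V': "nb X V'" "\<forall>y\<in>V'. inv y \<in> V" using inv_nb[OF V(1)] by blast
      let ?A = "{y \<in> carrier X. inv a \<otimes> y \<in> V}" and ?B = "{y \<in> carrier X. inv b \<otimes> y \<in> V'}"
      have "x \<otimes> y \<in> W" if x: "x \<in> ?A" and y: "y \<in> ?B" for x y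
      proof -
        have "inv (inv b \<otimes> y) \<in> V" using V'(2) y by blast
        then have "(inv a \<otimes> x) \<otimes> inv (inv (inv b \<otimes> y)) \<in> {x \<in> carrier X. (a \<otimes> b) \<otimes> x \<in> W}"
          using V(2) x by blast
        moreover have "(a \<otimes> b) \<otimes> ((inv a \<otimes> x) \<otimes> inv (inv (inv b \<otimes> y))) = (a \<otimes> (inv a \<otimes> x)) \<otimes> (b \<otimes> (inv b \<otimes> y))"
          using ab x y mult_swap[of a b "inv a \<otimes> x" "inv b \<otimes> y"] by simp
        ultimately show ?thesis using ab x y by (simp add: mult_inv_cancel)
      qed
      then have "?A \<times> ?B \<subseteq> {p \<in> topspace (prod_topology (topo X) (topo X)). (case p of (x, y) \<Rightarrow> x \<otimes> y) \<in> W}"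
        by (auto simp: ts)
      then show "\<exists>U V. openin (topo X) U \<and> openin (topo X) V \<and> a \<in> U \<and> b \<in> V \<and>
        U \<times> V \<subseteq> {p \<in> topspace (prod_topology (topo X) (topo X)). (case p of (x, y) \<Rightarrow> x \<otimes> y) \<in> W}"
        using at[OF V(1) ab(1)] at[OF V'(1) ab(2)] by blast
    qed
  qed (auto simp: ts)
  moreover have "continuous_map (topo X) (topo X) (m_inv X)"
    unfolding continuous_map_def
  proof (intro conjI allI impI)
    fix W assume W: "openin (topo X) W"
    show "openin (topo X) {x \<in> topspace (topo X). inv x \<in> W}"
    proof (subst openin_subopen, intro ballI)
      fix a assume "a \<in> {x \<in> topspace (topo X). inv x \<in> W}"
      then have a: "a \<in> carrier X" "inv a \<in> W" by (auto simp: ts)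
      obtain V where V: "nb X V" "\<forall>y\<in>V. inv y \<in> {x \<in> carrier X. inv a \<otimes> x \<in> W}"
        using inv_nb[OF nbt[OF W a(2)]] by blast
      have "inv y \<in> W" if y: "y \<in> carrier X" "inv a \<otimes> y \<in> V" for y
      proof -
        have "inv a \<otimes> inv (inv a \<otimes> y) \<in> W" using V(2) y by blast
        moreover have "inv a \<otimes> inv (inv a \<otimes> y) = inv y"
          using a y by (simp add: inv_mult m_assoc[symmetric])
        ultimately show ?thesis by simp
      qed
      then have "{y \<in> carrier X. inv a \<otimes> y \<in> V} \<subseteq> {x \<in> topspace (topo X). inv x \<in> W}"
        by (auto simp: ts)
      then show "\<exists>T. openin (topo X) T \<and> a \<in> T \<and> T \<subseteq> {x \<in> topspace (topo X). inv x \<in> W}"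
        using at[OF V(1) a(1)] by blast
    qed
  qed (auto simp: ts)
  moreover have "Hausdorff_space (topo X)"
    unfolding Hausdorff_space_def ts
  proof (intro allI impI)
    fix a b assume ab: "a \<in> carrier X \<and> b \<in> carrier X \<and> a \<noteq> b"
    have "inv a \<otimes> b \<noteq> \<one>"
      using ab by (metis inv_closed inv_equality inv_inv l_inv m_comm r_inv)
    then obtain U where U: "nb X U" "inv a \<otimes> b \<notin> U" using sep[of "inv a \<otimes> b"] ab by auto
    obtain V where V: "nb X V" "\<forall>x\<in>V. \<forall>y\<in>V. x \<otimes> inv y \<in> U" using div[OF U(1)] by blast
    have "disjnt {y \<in> carrier X. inv a \<otimes> y \<in> V} {y \<in> carrier X. inv b \<otimes> y \<in> V}"
      unfolding disjnt_iff
    proof (intro allI notI)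
      fix y assume y: "y \<in> {y \<in> carrier X. inv a \<otimes> y \<in> V} \<and> y \<in> {y \<in> carrier X. inv b \<otimes> y \<in> V}"
      then have "(inv a \<otimes> y) \<otimes> inv (inv b \<otimes> y) \<in> U" using V(2) by blast
      then show False using U(2) y ab by (simp add: div_translate)
    qed
    then show "\<exists>U V. openin (topo X) U \<and> openin (topo X) V \<and> a \<in> U \<and> b \<in> V \<and> disjnt U V"
      using at[OF V(1)] ab by blast
  qed
  ultimately show ?thesis using cg ts by (simp add: top_ab_group_def)
qed

lemma hom_continuousI:
  assumes X: "top_ab_group X" and Y: "top_ab_group Y" and f: "f \<in> hom X Y"
    and loc: "\<And>U. nb Y U \<Longrightarrow> \<exists>V. nb X V \<and> (\<forall>x\<in>V. f x \<in> U)"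
  shows "f \<in> cont_hom X Y"
proof -
  interpret X: topological_ab_group X by unfold_locales (rule X)
  interpret Y: topological_ab_group Y by unfold_locales (rule Y)
  have fc: "f x \<in> carrier Y" if "x \<in> carrier X" for x using f that by (auto simp: hom_def)
  have "openin (topo X) {x \<in> carrier X. f x \<in> W}" if W: "openin (topo Y) W" for W
    unfolding X.openin_locally
  proof (intro conjI ballI)
    fix x assume x: "x \<in> {x \<in> carrier X. f x \<in> W}"
    then obtain V where V: "nb X V" "\<forall>v\<in>V. f v \<in> {y \<in> carrier Y. f x \<otimes>\<^bsub>Y\<^esub> y \<in> W}"
      using loc[OF Y.nb_translate[OF W, of "f x"]] by blast
    have "x \<otimes>\<^bsub>X\<^esub> v \<in> {x \<in> carrier X. f x \<in> W}" if "v \<in> V" for v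
      using V that x f X.nb_carrier[OF V(1)] by (auto simp: hom_def)
    then show "\<exists>U. nb X U \<and> (\<forall>u\<in>U. x \<otimes>\<^bsub>X\<^esub> u \<in> {x \<in> carrier X. f x \<in> W})" using V(1) by blast
  qed auto
  then show ?thesis
    unfolding cont_hom_def continuous_map_def using f fc by auto
qed

lemma cont_homD:
  assumes X: "top_ab_group X" and Y: "top_ab_group Y" and f: "f \<in> cont_hom X Y"
  shows "\<And>x. x \<in> carrier X \<Longrightarrow> f x \<in> carrier Y"
    and "\<And>x y. x \<in> carrier X \<Longrightarrow> y \<in> carrier X \<Longrightarrow> f (x \<otimes>\<^bsub>X\<^esub> y) = f x \<otimes>\<^bsub>Y\<^esub> f y"
    and "f \<one>\<^bsub>X\<^esub> = \<one>\<^bsub>Y\<^esub>"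
    and "\<And>x. x \<in> carrier X \<Longrightarrow> f (inv\<^bsub>X\<^esub> x) = inv\<^bsub>Y\<^esub> f x"
    and "\<And>U. nb Y U \<Longrightarrow> nb X {x \<in> carrier X. f x \<in> U}"
proof -
  interpret X: topological_ab_group X by unfold_locales (rule X)
  interpret Y: topological_ab_group Y by unfold_locales (rule Y)
  have h: "f \<in> hom X Y" and c: "continuous_map (topo X) (topo Y) f" using f by (auto simp: cont_hom_def)
  interpret group_hom X Y f by unfold_locales (rule h)
  show "f \<one>\<^bsub>X\<^esub> = \<one>\<^bsub>Y\<^esub>" by simp
  show "\<And>x. x \<in> carrier X \<Longrightarrow> f x \<in> carrier Y"
    and "\<And>x y. x \<in> carrier X \<Longrightarrow> y \<in> carrier X \<Longrightarrow> f (x \<otimes>\<^bsub>X\<^esub> y) = f x \<otimes>\<^bsub>Y\<^esub> f y"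
    and "\<And>x. x \<in> carrier X \<Longrightarrow> f (inv\<^bsub>X\<^esub> x) = inv\<^bsub>Y\<^esub> f x" by auto
  show "nb X {x \<in> carrier X. f x \<in> U}" if "nb Y U" for U
    using that openin_continuous_map_preimage[OF c, of U] by (auto simp: nb_def)
qed

lemma cont_hom_compose:
  "f \<in> cont_hom X Y \<Longrightarrow> g \<in> cont_hom Y Z \<Longrightarrow> g \<circ> f \<in> cont_hom X Z"
  by (auto simp: cont_hom_def intro: hom_compose continuous_map_compose)

lemma cont_hom_cong:
  assumes "top_ab_group X" "f \<in> cont_hom X Y" "\<And>x. x \<in> carrier X \<Longrightarrow> f x = g x"
  shows "g \<in> cont_hom X Y"
proof -
  interpret X: topological_ab_group X by unfold_locales (rule assms)
  have "g x \<in> carrier Y" if "x \<in> carrier X" for x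
    using assms(2) assms(3)[OF that, symmetric] that by (auto simp: cont_hom_def hom_def)
  then have "g \<in> hom X Y" using assms by (auto simp: cont_hom_def hom_def)
  moreover have "continuous_map (topo X) (topo Y) g"
    by (rule continuous_map_eq[of _ _ f]) (use assms in \<open>auto simp: cont_hom_def\<close>)
  ultimately show ?thesis by (simp add: cont_hom_def)
qed

lemma hom_open_onto_imageI:
  assumes X: "top_ab_group X" and Y: "top_ab_group Y" and f: "f \<in> hom X Y"
    and loc: "\<And>U. nb X U \<Longrightarrow> \<exists>V. nb Y V \<and> V \<inter> f ` carrier X \<subseteq> f ` U"
  shows "open_map (topo X) (subtopology (topo Y) (f ` carrier X)) f"
  unfolding open_map_def
proof (intro allI impI)
  fix S assume S: "openin (topo X) S"
  interpret X: topological_ab_group X by unfold_locales (rule X)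
  interpret Y: topological_ab_group Y by unfold_locales (rule Y)
  interpret group_hom X Y f by unfold_locales (rule f)
  note Sc = X.openin_carrier[OF S]
  show "openin (subtopology (topo Y) (f ` carrier X)) (f ` S)"
  proof (subst openin_subopen, intro ballI)
    fix y assume "y \<in> f ` S"
    then obtain x where x: "x \<in> S" "y = f x" by blast
    then have xc: "x \<in> carrier X" using Sc by blast
    obtain V where V: "nb Y V" "V \<inter> f ` carrier X \<subseteq> f ` {u \<in> carrier X. x \<otimes>\<^bsub>X\<^esub> u \<in> S}"
      using loc[OF X.nb_translate[OF S x(1)]] by blast
    let ?T = "{z \<in> carrier Y. inv\<^bsub>Y\<^esub> f x \<otimes>\<^bsub>Y\<^esub> z \<in> V} \<inter> f ` carrier X"
    have "?T \<subseteq> f ` S"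
    proof
      fix z assume z: "z \<in> ?T"
      then obtain a where a: "a \<in> carrier X" "z = f a" by blast
      have "f (inv\<^bsub>X\<^esub> x \<otimes>\<^bsub>X\<^esub> a) \<in> f ` carrier X" using a xc by blast
      then have "f (inv\<^bsub>X\<^esub> x \<otimes>\<^bsub>X\<^esub> a) \<in> V \<inter> f ` carrier X" using z a xc by auto
      then obtain u where u: "u \<in> carrier X" "x \<otimes>\<^bsub>X\<^esub> u \<in> S" "f (inv\<^bsub>X\<^esub> x \<otimes>\<^bsub>X\<^esub> a) = f u"
        using V(2) by blast
      have "f (x \<otimes>\<^bsub>X\<^esub> u) = z" using u xc a by (simp add: u(3)[symmetric] Y.m_assoc[symmetric])
      then show "z \<in> f ` S" using u by blast
    qed
    moreover have "openin (subtopology (topo Y) (f ` carrier X)) ?T"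
      using Y.nb_at[OF V(1), of "f x"] xc by (intro openin_subtopology_Int) auto
    moreover have "y \<in> ?T" using x xc Y.nb_one[OF V(1)] by auto
    ultimately show "\<exists>T. openin (subtopology (topo Y) (f ` carrier X)) T \<and> y \<in> T \<and> T \<subseteq> f ` S" by blast
  qed
qed

lemma hom_open_onto_imageD:
  assumes X: "top_ab_group X" and Y: "top_ab_group Y" and f: "f \<in> hom X Y"
    and op: "open_map (topo X) (subtopology (topo Y) (f ` carrier X)) f" and U: "nb X U"
  shows "\<exists>V. nb Y V \<and> V \<inter> f ` carrier X \<subseteq> f ` U"
proof -
  interpret X: topological_ab_group X by unfold_locales (rule X)
  interpret Y: topological_ab_group Y by unfold_locales (rule Y)
  interpret group_hom X Y f by unfold_locales (rule f)
  have "openin (subtopology (topo Y) (f ` carrier X)) (f ` U)"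
    using op U by (auto simp: open_map_def nb_def)
  then obtain T where T: "openin (topo Y) T" "f ` U = T \<inter> f ` carrier X"
    by (auto simp: openin_subtopology)
  have "f \<one>\<^bsub>X\<^esub> \<in> f ` U" using U unfolding nb_def by blast
  then show ?thesis using T by (auto simp: nb_def)
qed

section \<open>Products, subgroups and quotients\<close>

lemma comm_group_cong:
  assumes "comm_group A" "carrier B = carrier A" "mult B = mult A" "one B = one A"
  shows "comm_group B"
proof -
  interpret A: comm_group A by (rule assms)
  show ?thesis
    by (rule comm_groupI) (auto simp: assms A.m_ac A.l_inv_ex)
qed

lemma prod_top_group_simps [simp]:
  "carrier (prod_top_group X Y) = carrier X \<times> carrier Y"
  "(x, y) \<otimes>\<^bsub>prod_top_group X Y\<^esub> (x', y') = (x \<otimes>\<^bsub>X\<^esub> x', y \<otimes>\<^bsub>Y\<^esub> y')"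
  "\<one>\<^bsub>prod_top_group X Y\<^esub> = (\<one>\<^bsub>X\<^esub>, \<one>\<^bsub>Y\<^esub>)"
  "topo (prod_top_group X Y) = prod_topology (topo X) (topo Y)"
  by (auto simp: prod_top_group_def DirProd_def)

lemma prod_top_group_mult:
  "p \<otimes>\<^bsub>prod_top_group X Y\<^esub> q = (fst p \<otimes>\<^bsub>X\<^esub> fst q, snd p \<otimes>\<^bsub>Y\<^esub> snd q)"
  by (cases p; cases q) simp

lemma nb_prodD:
  assumes "nb (prod_top_group X Y) W"
  obtains U V where "nb X U" "nb Y V" "\<And>u v. u \<in> U \<Longrightarrow> v \<in> V \<Longrightarrow> (u, v) \<in> W"
proof -
  have "openin (prod_topology (topo X) (topo Y)) W" "(\<one>\<^bsub>X\<^esub>, \<one>\<^bsub>Y\<^esub>) \<in> W" using assms by (auto simp: nb_def)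
  from openin_prod_topology_alt[THEN iffD1, OF this(1), rule_format, OF this(2)] that show ?thesis
    by (auto simp: nb_def)
qed

lemma nb_prodI: "nb X U \<Longrightarrow> nb Y V \<Longrightarrow> nb (prod_top_group X Y) (U \<times> V)"
  by (simp add: nb_def openin_prod_Times_iff)

lemma prod_top_ab_group:
  assumes X: "top_ab_group X" and Y: "top_ab_group Y"
  shows "top_ab_group (prod_top_group X Y)"
    and "\<And>x y. x \<in> carrier X \<Longrightarrow> y \<in> carrier Y \<Longrightarrow>
      inv\<^bsub>prod_top_group X Y\<^esub> (x, y) = (inv\<^bsub>X\<^esub> x, inv\<^bsub>Y\<^esub> y)"
proof -
  interpret X: topological_ab_group X by unfold_locales (rule X)
  interpret Y: topological_ab_group Y by unfold_locales (rule Y)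
  let ?P = "prod_top_group X Y"
  have cg: "comm_group ?P"
  proof (rule comm_groupI)
    show "\<exists>z\<in>carrier ?P. z \<otimes>\<^bsub>?P\<^esub> p = \<one>\<^bsub>?P\<^esub>" if "p \<in> carrier ?P" for p
      using that by (intro bexI[of _ "(inv\<^bsub>X\<^esub> fst p, inv\<^bsub>Y\<^esub> snd p)"]) auto
  qed (auto simp: X.m_ac Y.m_ac)
  interpret P: comm_group ?P by (rule cg)
  show inv: "inv\<^bsub>?P\<^esub> (x, y) = (inv\<^bsub>X\<^esub> x, inv\<^bsub>Y\<^esub> y)" if "x \<in> carrier X" "y \<in> carrier Y" for x y
    using that by (intro P.inv_equality) auto
  show "top_ab_group ?P"
  proof (rule top_ab_groupI[OF cg])
    show "topspace (topo ?P) = carrier ?P" by simp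
    show "openin (topo ?P) {p \<in> carrier ?P. a \<otimes>\<^bsub>?P\<^esub> p \<in> S}"
      if S: "openin (topo ?P) S" and a: "a \<in> carrier ?P" for S a
      unfolding prod_top_group_simps openin_prod_topology_alt
    proof (intro allI impI)
      fix x y assume "(x, y) \<in> {p \<in> carrier X \<times> carrier Y. a \<otimes>\<^bsub>?P\<^esub> p \<in> S}"
      then have xy: "x \<in> carrier X" "y \<in> carrier Y" "(fst a \<otimes>\<^bsub>X\<^esub> x, snd a \<otimes>\<^bsub>Y\<^esub> y) \<in> S"
        using a by (auto simp: prod_top_group_mult)
      obtain U V where UV: "openin (topo X) U" "openin (topo Y) V" "fst a \<otimes>\<^bsub>X\<^esub> x \<in> U" "snd a \<otimes>\<^bsub>Y\<^esub> y \<in> V" "U \<times> V \<subseteq> S"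
        using openin_prod_topology_alt[THEN iffD1, OF S[simplified], rule_format, OF xy(3)] by auto
      have "openin (topo X) {x \<in> carrier X. fst a \<otimes>\<^bsub>X\<^esub> x \<in> U}" "openin (topo Y) {y \<in> carrier Y. snd a \<otimes>\<^bsub>Y\<^esub> y \<in> V}"
        using a UV by (auto intro!: X.open_translate Y.open_translate)
      moreover have "{x \<in> carrier X. fst a \<otimes>\<^bsub>X\<^esub> x \<in> U} \<times> {y \<in> carrier Y. snd a \<otimes>\<^bsub>Y\<^esub> y \<in> V}
          \<subseteq> {p \<in> carrier X \<times> carrier Y. a \<otimes>\<^bsub>?P\<^esub> p \<in> S}"
        using UV(5) a by (cases a) auto
      ultimately show "\<exists>U V. openin (topo X) U \<and> openin (topo Y) V \<and> x \<in> U \<and> y \<in> V \<and>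
          U \<times> V \<subseteq> {p \<in> carrier X \<times> carrier Y. a \<otimes>\<^bsub>?P\<^esub> p \<in> S}"
        using UV xy by blast
    qed
    show "\<exists>V. nb ?P V \<and> (\<forall>p\<in>V. \<forall>q\<in>V. p \<otimes>\<^bsub>?P\<^esub> inv\<^bsub>?P\<^esub> q \<in> W)" if W: "nb ?P W" for W
    proof -
      obtain U V where UV: "nb X U" "nb Y V" "\<And>u v. u \<in> U \<Longrightarrow> v \<in> V \<Longrightarrow> (u, v) \<in> W"
        using nb_prodD[OF W] by blast
      obtain U' where U': "nb X U'" "\<And>x. x \<in> U' \<Longrightarrow> inv\<^bsub>X\<^esub> x \<in> U'" "\<And>x y. x \<in> U' \<Longrightarrow> y \<in> U' \<Longrightarrow> x \<otimes>\<^bsub>X\<^esub> y \<in> U"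
        using X.nb_sym[OF UV(1)] by blast
      obtain V' where V': "nb Y V'" "\<And>x. x \<in> V' \<Longrightarrow> inv\<^bsub>Y\<^esub> x \<in> V'" "\<And>x y. x \<in> V' \<Longrightarrow> y \<in> V' \<Longrightarrow> x \<otimes>\<^bsub>Y\<^esub> y \<in> V"
        using Y.nb_sym[OF UV(2)] by blast
      have "p \<otimes>\<^bsub>?P\<^esub> inv\<^bsub>?P\<^esub> q \<in> W" if "p \<in> U' \<times> V'" "q \<in> U' \<times> V'" for p q
        using that X.nb_carrier[OF U'(1)] Y.nb_carrier[OF V'(1)] U' V'
        by (cases p; cases q) (auto simp: inv subset_iff intro!: UV(3))
      then show ?thesis using nb_prodI[OF U'(1) V'(1)] by blast
    qed
    show "p = \<one>\<^bsub>?P\<^esub>" if p: "p \<in> carrier ?P" and all: "\<And>U. nb ?P U \<Longrightarrow> p \<in> U" for p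
    proof -
      have "fst p = \<one>\<^bsub>X\<^esub>"
        by (rule X.eq_oneI) (use p all[OF nb_prodI[OF _ Y.nb_UNIV]] in auto)
      moreover have "snd p = \<one>\<^bsub>Y\<^esub>"
        by (rule Y.eq_oneI) (use p all[OF nb_prodI[OF X.nb_UNIV]] in auto)
      ultimately show ?thesis by (cases p) auto
    qed
  qed
qed

lemma sub_top_group_simps [simp]:
  "carrier (sub_top_group X A) = A" "mult (sub_top_group X A) = mult X"
  "one (sub_top_group X A) = one X" "topo (sub_top_group X A) = subtopology (topo X) A"
  by (auto simp: sub_top_group_def)

lemma nb_sub_iff:
  assumes "\<one>\<^bsub>X\<^esub> \<in> A"
  shows "nb (sub_top_group X A) W \<longleftrightarrow> (\<exists>U. nb X U \<and> W = U \<inter> A)"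
  using assms by (auto simp: nb_def openin_subtopology)

lemma sub_top_ab_group:
  assumes X: "top_ab_group X" and A: "subgroup A X"
  shows "top_ab_group (sub_top_group X A)"
proof -
  interpret X: topological_ab_group X by unfold_locales (rule X)
  interpret A: subgroup A X by (rule A)
  let ?A = "sub_top_group X A"
  have cg: "comm_group ?A"
  proof (rule comm_groupI)
    show "\<exists>y\<in>carrier ?A. y \<otimes>\<^bsub>?A\<^esub> x = \<one>\<^bsub>?A\<^esub>" if "x \<in> carrier ?A" for x
      using that A.subset by (intro bexI[of _ "inv\<^bsub>X\<^esub> x"]) auto
  qed (use A.subset in \<open>auto simp: X.m_ac subset_iff\<close>)
  interpret S: comm_group ?A by (rule cg)
  have inv: "inv\<^bsub>?A\<^esub> x = inv\<^bsub>X\<^esub> x" if "x \<in> A" for x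
    using that by (intro S.inv_equality) auto
  have sub: "A \<subseteq> carrier X" by (rule A.subset)
  show ?thesis
  proof (rule top_ab_groupI[OF cg])
    show "topspace (topo ?A) = carrier ?A" using sub by auto
    show "openin (topo ?A) {p \<in> carrier ?A. a \<otimes>\<^bsub>?A\<^esub> p \<in> S}"
      if S: "openin (topo ?A) S" and a: "a \<in> carrier ?A" for S a
    proof -
      obtain T where T: "openin (topo X) T" "S = T \<inter> A" using S by (auto simp: openin_subtopology)
      have "openin (topo X) {p \<in> carrier X. a \<otimes>\<^bsub>X\<^esub> p \<in> T}" using a sub T by (intro X.open_translate) auto
      moreover have "{p \<in> carrier ?A. a \<otimes>\<^bsub>?A\<^esub> p \<in> S} = {p \<in> carrier X. a \<otimes>\<^bsub>X\<^esub> p \<in> T} \<inter> A"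
        using T a sub by auto
      ultimately show ?thesis by (auto simp: openin_subtopology)
    qed
    show "\<exists>V. nb ?A V \<and> (\<forall>p\<in>V. \<forall>q\<in>V. p \<otimes>\<^bsub>?A\<^esub> inv\<^bsub>?A\<^esub> q \<in> W)" if W: "nb ?A W" for W
    proof -
      obtain U where U: "nb X U" "W = U \<inter> A" using W by (auto simp: nb_sub_iff)
      obtain V where V: "nb X V" "\<And>x. x \<in> V \<Longrightarrow> inv\<^bsub>X\<^esub> x \<in> V" "\<And>x y. x \<in> V \<Longrightarrow> y \<in> V \<Longrightarrow> x \<otimes>\<^bsub>X\<^esub> y \<in> U"
        using X.nb_sym[OF U(1)] by blast
      show ?thesis
        by (rule exI[of _ "V \<inter> A"]) (use V in \<open>auto simp: nb_sub_iff inv U(2)\<close>)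
    qed
    show "p = \<one>\<^bsub>?A\<^esub>" if p: "p \<in> carrier ?A" and all: "\<And>U. nb ?A U \<Longrightarrow> p \<in> U" for p
    proof -
      have "p \<in> U" if "nb X U" for U
        using all[of "U \<inter> A"] that by (auto simp: nb_sub_iff)
      moreover have "p \<in> carrier X" using p sub by auto
      ultimately show ?thesis using X.eq_oneI by simp
    qed
  qed
qed

lemma quot_top_group_simps [simp]:
  "carrier (quot_top_group X N) = (\<lambda>x. N #>\<^bsub>X\<^esub> x) ` carrier X"
  "one (quot_top_group X N) = N" "mult (quot_top_group X N) = set_mult X"
  "topo (quot_top_group X N) = quotient_topology (topo X) (\<lambda>x. N #>\<^bsub>X\<^esub> x)"
  by (simp_all add: quot_top_group_def carrier_FactGroup)

text \<open>The projection is open since the preimage of the image of \<open>U\<close> is the union of the translates of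
  \<open>U\<close> by elements of \<open>N\<close>. Closedness of \<open>N\<close> is what makes the quotient Hausdorff.\<close>
lemma quot_top_ab_group:
  assumes X: "top_ab_group X" and N: "subgroup N X" and cl: "closedin (topo X) N"
  defines "Q \<equiv> \<lambda>x. N #>\<^bsub>X\<^esub> x"
  shows "top_ab_group (quot_top_group X N)"
    and "Q \<in> cont_hom X (quot_top_group X N)"
    and "\<And>U. nb X U \<Longrightarrow> nb (quot_top_group X N) (Q ` U)"
    and "\<And>x y. x \<in> carrier X \<Longrightarrow> y \<in> carrier X \<Longrightarrow> Q x = Q y \<longleftrightarrow> x \<otimes>\<^bsub>X\<^esub> inv\<^bsub>X\<^esub> y \<in> N"
proof -
  interpret X: topological_ab_group X by unfold_locales (rule X)
  interpret N: subgroup N X by (rule N)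
  interpret N: normal N X using X.subgroup_imp_normal[OF N] .
  let ?Y = "quot_top_group X N"
  have cg: "comm_group ?Y"
    by (rule comm_group_cong[OF X.abelian_FactGroup[OF N]]) (auto simp: carrier_FactGroup)
  interpret Y: comm_group ?Y by (rule cg)
  have Qm: "Q (x \<otimes>\<^bsub>X\<^esub> y) = Q x \<otimes>\<^bsub>?Y\<^esub> Q y" if "x \<in> carrier X" "y \<in> carrier X" for x y
    using that by (simp add: Q_def N.rcos_sum)
  have homQ: "Q \<in> hom X ?Y" by (rule homI) (auto simp: Q_def N.rcos_sum)
  interpret Q: group_hom X ?Y Q by unfold_locales (rule homQ)
  show Qeq: "Q x = Q y \<longleftrightarrow> x \<otimes>\<^bsub>X\<^esub> inv\<^bsub>X\<^esub> y \<in> N" if "x \<in> carrier X" "y \<in> carrier X" for x y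
  proof
    assume "Q x = Q y"
    then have "x \<in> N #>\<^bsub>X\<^esub> y" using X.rcos_self[OF that(1) N] by (simp add: Q_def)
    then obtain n where "n \<in> N" "x = n \<otimes>\<^bsub>X\<^esub> y" by (auto simp: r_coset_def)
    then show "x \<otimes>\<^bsub>X\<^esub> inv\<^bsub>X\<^esub> y \<in> N" using that N.subset by (auto simp: X.m_assoc)
  next
    assume n: "x \<otimes>\<^bsub>X\<^esub> inv\<^bsub>X\<^esub> y \<in> N"
    have "x = (x \<otimes>\<^bsub>X\<^esub> inv\<^bsub>X\<^esub> y) \<otimes>\<^bsub>X\<^esub> y" using that by (simp add: X.m_assoc)
    then have "x \<in> N #>\<^bsub>X\<^esub> y" using n by (force simp: r_coset_def)
    then show "Q x = Q y" unfolding Q_def using X.repr_independence[OF _ that(2) N] by simp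
  qed
  have op: "openin (topo ?Y) S \<longleftrightarrow> S \<subseteq> Q ` carrier X \<and> openin (topo X) {x \<in> carrier X. Q x \<in> S}" for S
    by (simp add: openin_quotient_topology Q_def)
  have nbY: "nb ?Y W \<Longrightarrow> nb X {x \<in> carrier X. Q x \<in> W}" for W
    using Q.hom_one op[of W] by (auto simp: nb_def simp del: Q.hom_one)
  show nbQ: "nb ?Y (Q ` U)" if U: "nb X U" for U
    unfolding nb_def op
  proof (intro conjI)
    note Uc = X.nb_carrier[OF U]
    show "Q ` U \<subseteq> Q ` carrier X" using Uc by auto
    show "openin (topo X) {x \<in> carrier X. Q x \<in> Q ` U}"
      unfolding X.openin_locally
    proof (intro conjI ballI)
      fix x assume "x \<in> {x \<in> carrier X. Q x \<in> Q ` U}"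
      then obtain u where u: "x \<in> carrier X" "u \<in> U" "Q x = Q u" by blast
      have uc: "u \<in> carrier X" using u Uc by auto
      have nv: "nb X {v \<in> carrier X. u \<otimes>\<^bsub>X\<^esub> v \<in> U}" using U u by (intro X.nb_translate) (auto simp: nb_def)
      have "Q (x \<otimes>\<^bsub>X\<^esub> v) \<in> Q ` U" if "v \<in> carrier X" "u \<otimes>\<^bsub>X\<^esub> v \<in> U" for v
      proof -
        have "Q (x \<otimes>\<^bsub>X\<^esub> v) = Q (u \<otimes>\<^bsub>X\<^esub> v)" using u uc that by (simp only: Qm)
        then show ?thesis using that by simp
      qed
      then show "\<exists>V. nb X V \<and> (\<forall>v\<in>V. x \<otimes>\<^bsub>X\<^esub> v \<in> {x \<in> carrier X. Q x \<in> Q ` U})"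
        using nv u(1) by blast
    qed auto
    show "\<one>\<^bsub>?Y\<^esub> \<in> Q ` U" using Q.hom_one X.nb_one[OF U] by (metis imageI)
  qed
  show top: "top_ab_group ?Y"
  proof (rule top_ab_groupI[OF cg])
    show "topspace (topo ?Y) = carrier ?Y" by simp
    show "openin (topo ?Y) {p \<in> carrier ?Y. a \<otimes>\<^bsub>?Y\<^esub> p \<in> S}"
      if S: "openin (topo ?Y) S" and a: "a \<in> carrier ?Y" for S a
    proof -
      obtain b where b: "b \<in> carrier X" "a = Q b" using a by (auto simp: Q_def)
      have "openin (topo X) {x \<in> carrier X. b \<otimes>\<^bsub>X\<^esub> x \<in> {x \<in> carrier X. Q x \<in> S}}"
        using S b(1) op[of S] by (intro X.open_translate) auto
      moreover have "{x \<in> carrier X. b \<otimes>\<^bsub>X\<^esub> x \<in> {x \<in> carrier X. Q x \<in> S}}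
        = {x \<in> carrier X. Q x \<in> {p \<in> carrier ?Y. a \<otimes>\<^bsub>?Y\<^esub> p \<in> S}}"
        using b Qm Q.hom_closed by auto
      ultimately show ?thesis unfolding op by (auto simp: Q_def)
    qed
    show "\<exists>V. nb ?Y V \<and> (\<forall>p\<in>V. \<forall>q\<in>V. p \<otimes>\<^bsub>?Y\<^esub> inv\<^bsub>?Y\<^esub> q \<in> W)" if W: "nb ?Y W" for W
    proof -
      obtain V where V: "nb X V" "V \<subseteq> {x \<in> carrier X. Q x \<in> W}" "\<And>x. x \<in> V \<Longrightarrow> inv\<^bsub>X\<^esub> x \<in> V"
        "\<And>x y. x \<in> V \<Longrightarrow> y \<in> V \<Longrightarrow> x \<otimes>\<^bsub>X\<^esub> y \<in> {x \<in> carrier X. Q x \<in> W}"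
        using X.nb_sym[OF nbY[OF W]] by blast
      have "Q x \<otimes>\<^bsub>?Y\<^esub> inv\<^bsub>?Y\<^esub> Q y \<in> W" if "x \<in> V" "y \<in> V" for x y
      proof -
        have c: "x \<in> carrier X" "y \<in> carrier X" using that X.nb_carrier[OF V(1)] by auto
        then have "Q x \<otimes>\<^bsub>?Y\<^esub> inv\<^bsub>?Y\<^esub> Q y = Q (x \<otimes>\<^bsub>X\<^esub> inv\<^bsub>X\<^esub> y)"
          by (simp only: Qm Q.hom_inv X.inv_closed)
        then show ?thesis using V(4)[OF that(1) V(3)[OF that(2)]] by simp
      qed
      then show ?thesis using nbQ[OF V(1)] by blast
    qed
    show "p = \<one>\<^bsub>?Y\<^esub>" if p: "p \<in> carrier ?Y" and all: "\<And>U. nb ?Y U \<Longrightarrow> p \<in> U" for p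
    proof -
      obtain x where x: "x \<in> carrier X" "p = Q x" using p by (auto simp: Q_def)
      have "x \<in> N"
      proof (rule ccontr)
        assume xN: "x \<notin> N"
        have "openin (topo X) (carrier X - N)" using cl by (simp add: closedin_def)
        then have "nb X {u \<in> carrier X. inv\<^bsub>X\<^esub> u \<in> {v \<in> carrier X. x \<otimes>\<^bsub>X\<^esub> v \<in> carrier X - N}}"
          using x xN by (intro X.nb_inv X.nb_translate) auto
        from all[OF nbQ[OF this]] obtain u where
          u: "u \<in> carrier X" "x \<otimes>\<^bsub>X\<^esub> inv\<^bsub>X\<^esub> u \<notin> N" "Q x = Q u" using x by auto
        then show False using Qeq[OF x(1) u(1)] by simp
      qed
      then have "Q x = Q \<one>\<^bsub>X\<^esub>" using x by (simp add: Qeq del: Q.hom_one)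
      then show ?thesis using x Q.hom_one by simp
    qed
  qed
  show "Q \<in> cont_hom X ?Y"
  proof (rule hom_continuousI[OF X top homQ])
    show "\<exists>V. nb X V \<and> (\<forall>x\<in>V. Q x \<in> U)" if "nb ?Y U" for U
      using nbY[OF that] by blast
  qed
qed

lemma quot_top_group_factor:
  assumes X: "top_ab_group X" and N: "subgroup N X" and cl: "closedin (topo X) N"
    and Z: "top_ab_group Z" and g: "g \<in> cont_hom X Z" and gN: "\<And>n. n \<in> N \<Longrightarrow> g n = \<one>\<^bsub>Z\<^esub>"
  obtains f where "f \<in> cont_hom (quot_top_group X N) Z"
    "\<And>x. x \<in> carrier X \<Longrightarrow> f (N #>\<^bsub>X\<^esub> x) = g x"
proof -
  interpret X: topological_ab_group X by unfold_locales (rule X)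
  interpret Z: topological_ab_group Z by unfold_locales (rule Z)
  define Q where "Q = (\<lambda>x. N #>\<^bsub>X\<^esub> x)"
  note q = quot_top_ab_group[OF X N cl, folded Q_def]
  note qh = cont_homD[OF X q(1,2)] and gh = cont_homD[OF X Z g]
  define f where "f = (\<lambda>c. g (inv_into (carrier X) Q c))"
  have fQ: "f (Q x) = g x" if x: "x \<in> carrier X" for x
  proof -
    define y where "y = inv_into (carrier X) Q (Q x)"
    have y: "y \<in> carrier X" "Q y = Q x"
      unfolding y_def using inv_into_into[of "Q x" Q "carrier X"] f_inv_into_f[of "Q x" Q "carrier X"] x by blast+
    then have "g (y \<otimes>\<^bsub>X\<^esub> inv\<^bsub>X\<^esub> x) = \<one>\<^bsub>Z\<^esub>" using q(4)[OF y(1) x] gN by blast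
    then have "g y \<otimes>\<^bsub>Z\<^esub> inv\<^bsub>Z\<^esub> g x = \<one>\<^bsub>Z\<^esub>" using gh x y by simp
    then have "g y = g x" using gh(1) x y by (metis Z.inv_closed Z.inv_equality Z.inv_inv)
    then show ?thesis by (simp add: f_def y_def)
  qed
  have hom: "f \<in> hom (quot_top_group X N) Z"
  proof (rule homI)
    fix c d assume "c \<in> carrier (quot_top_group X N)" "d \<in> carrier (quot_top_group X N)"
    then obtain x y where xy: "x \<in> carrier X" "y \<in> carrier X" "c = Q x" "d = Q y" by (auto simp: Q_def)
    have "c \<otimes>\<^bsub>quot_top_group X N\<^esub> d = Q (x \<otimes>\<^bsub>X\<^esub> y)" using qh(2)[OF xy(1,2)] xy by simp
    then show "f (c \<otimes>\<^bsub>quot_top_group X N\<^esub> d) = f c \<otimes>\<^bsub>Z\<^esub> f d" using xy fQ gh(2) by simp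
  qed (use fQ gh(1) in \<open>auto simp: Q_def\<close>)
  have "f \<in> cont_hom (quot_top_group X N) Z"
  proof (rule hom_continuousI[OF q(1) Z hom])
    fix U assume U: "nb Z U"
    show "\<exists>V. nb (quot_top_group X N) V \<and> (\<forall>x\<in>V. f x \<in> U)"
      using q(3)[OF gh(5)[OF U]] fQ by (intro exI[of _ "Q ` {x \<in> carrier X. g x \<in> U}"]) auto
  qed
  then show ?thesis using that fQ by (auto simp: Q_def)
qed

section \<open>Extensions and their morphisms\<close>

text \<open>The definition of an extension read off at the identity. Injectivity of the
  inclusion follows from \<open>emb\<close>, which puts every element of its kernel into all neighbourhoods of the
  identity of the Hausdorff group \<open>H\<close>.\<close>
lemma is_extI:
  assumes H: "top_ab_group H" and G: "top_ab_group G" and X: "top_ab_group (mid E)"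
    and i: "inc E \<in> cont_hom H (mid E)" and p: "prj E \<in> cont_hom (mid E) G"
    and emb: "\<And>U. nb H U \<Longrightarrow> \<exists>V. nb (mid E) V \<and> (\<forall>h\<in>carrier H. inc E h \<in> V \<longrightarrow> h \<in> U)"
    and op: "\<And>U. nb (mid E) U \<Longrightarrow> \<exists>V. nb G V \<and> V \<subseteq> prj E ` U"
    and pi: "\<And>h. h \<in> carrier H \<Longrightarrow> prj E (inc E h) = \<one>\<^bsub>G\<^esub>"
    and ker: "\<And>x. x \<in> carrier (mid E) \<Longrightarrow> prj E x = \<one>\<^bsub>G\<^esub> \<Longrightarrow> x \<in> inc E ` carrier H"
    and sur: "\<And>y. y \<in> carrier G \<Longrightarrow> y \<in> prj E ` carrier (mid E)"
  shows "is_ext H G E"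
proof -
  interpret H: topological_ab_group H by unfold_locales (rule H)
  interpret G: topological_ab_group G by unfold_locales (rule G)
  interpret X: topological_ab_group "mid E" by unfold_locales (rule X)
  note ih = cont_homD[OF H X i] and ph = cont_homD[OF X G p]
  have im: "prj E ` carrier (mid E) = carrier G" using sur ph(1) by blast
  have inj: "inj_on (inc E) (carrier H)"
  proof (rule inj_onI)
    fix h k assume hk: "h \<in> carrier H" "k \<in> carrier H" "inc E h = inc E k"
    have "h \<otimes>\<^bsub>H\<^esub> inv\<^bsub>H\<^esub> k \<in> U" if U: "nb H U" for U
    proof -
      obtain V where V: "nb (mid E) V" "\<forall>h\<in>carrier H. inc E h \<in> V \<longrightarrow> h \<in> U" using emb[OF U] by blast
      have "inc E (h \<otimes>\<^bsub>H\<^esub> inv\<^bsub>H\<^esub> k) = \<one>\<^bsub>mid E\<^esub>" using hk ih(1,2,4) by simp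
      then show ?thesis using V X.nb_one[OF V(1)] hk by simp
    qed
    then have "h \<otimes>\<^bsub>H\<^esub> inv\<^bsub>H\<^esub> k = \<one>\<^bsub>H\<^esub>" using hk H.eq_oneI by simp
    then show "h = k" using hk by (metis H.inv_closed H.inv_equality H.inv_inv)
  qed
  have "open_map (topo H) (subtopology (topo (mid E)) (inc E ` carrier H)) (inc E)"
  proof (rule hom_open_onto_imageI[OF H X])
    show "inc E \<in> hom H (mid E)" using i by (simp add: cont_hom_def)
    show "\<exists>V. nb (mid E) V \<and> V \<inter> inc E ` carrier H \<subseteq> inc E ` U" if "nb H U" for U
      using emb[OF that] by blast
  qed
  moreover have "open_map (topo (mid E)) (subtopology (topo G) (prj E ` carrier (mid E))) (prj E)"
  proof (rule hom_open_onto_imageI[OF X G])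
    show "prj E \<in> hom (mid E) G" using p by (simp add: cont_hom_def)
    show "\<exists>V. nb G V \<and> V \<inter> prj E ` carrier (mid E) \<subseteq> prj E ` U" if "nb (mid E) U" for U
      using op[OF that] by blast
  qed
  moreover have "inc E ` carrier H = kernel (mid E) G (prj E)"
    using ker pi ih(1) by (auto simp: kernel_def)
  ultimately show ?thesis
    unfolding is_ext_def using X i p inj im by blast
qed

locale extension = H: topological_ab_group H + G: topological_ab_group G
  for H :: "'h top_group" and G :: "'g top_group" +
  fixes E :: "('h, 'x, 'g) ext_seq"
  assumes ext: "is_ext H G E"

sublocale extension \<subseteq> X: topological_ab_group "mid E"
  using ext by unfold_locales (simp add: is_ext_def)

context extension
begin

lemma inc_cont: "inc E \<in> cont_hom H (mid E)" and prj_cont: "prj E \<in> cont_hom (mid E) G"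
  using ext by (auto simp: is_ext_def)

lemmas inc_simps [simp] = cont_homD(1-4)[OF H.top_ab_group X.top_ab_group inc_cont]
lemmas prj_simps [simp] = cont_homD(1-4)[OF X.top_ab_group G.top_ab_group prj_cont]
lemmas nb_inc = cont_homD(5)[OF H.top_ab_group X.top_ab_group inc_cont]
lemmas nb_prj = cont_homD(5)[OF X.top_ab_group G.top_ab_group prj_cont]

lemma inc_inj: "inj_on (inc E) (carrier H)"
  using ext unfolding is_ext_def by blast

lemma inc_eq_iff: "h \<in> carrier H \<Longrightarrow> k \<in> carrier H \<Longrightarrow> inc E h = inc E k \<longleftrightarrow> h = k"
  using inc_inj by (auto simp: inj_on_def)

lemma kernel: "inc E ` carrier H = {x \<in> carrier (mid E). prj E x = \<one>\<^bsub>G\<^esub>}"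
  using ext by (auto simp: is_ext_def kernel_def)

lemma prj_inc [simp]: "h \<in> carrier H \<Longrightarrow> prj E (inc E h) = \<one>\<^bsub>G\<^esub>"
  using kernel by auto

lemma prj_surj: "prj E ` carrier (mid E) = carrier G"
  using ext by (auto simp: is_ext_def)

lemma prj_eqD:
  assumes "x \<in> carrier (mid E)" "y \<in> carrier (mid E)" "prj E x = prj E y"
  obtains h where "h \<in> carrier H" "x \<otimes>\<^bsub>mid E\<^esub> inv\<^bsub>mid E\<^esub> y = inc E h"
proof -
  have "x \<otimes>\<^bsub>mid E\<^esub> inv\<^bsub>mid E\<^esub> y \<in> inc E ` carrier H" using assms by (simp add: kernel)
  then show ?thesis using that by blast
qed

lemma inc_embedding:
  assumes "nb H U"
  shows "\<exists>V. nb (mid E) V \<and> (\<forall>h\<in>carrier H. inc E h \<in> V \<longrightarrow> h \<in> U)"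
proof -
  have "open_map (topo H) (subtopology (topo (mid E)) (inc E ` carrier H)) (inc E)"
    using ext unfolding is_ext_def by blast
  then obtain V where V: "nb (mid E) V" "V \<inter> inc E ` carrier H \<subseteq> inc E ` U"
    using hom_open_onto_imageD[OF H.top_ab_group X.top_ab_group _ _ assms, of "inc E"] inc_cont
    by (auto simp: cont_hom_def)
  have "h \<in> U" if h: "h \<in> carrier H" "inc E h \<in> V" for h
  proof -
    obtain u where "u \<in> U" "inc E h = inc E u" using V(2) h by blast
    then show ?thesis using inc_eq_iff h H.nb_carrier[OF assms] by auto
  qed
  then show ?thesis using V(1) by blast
qed

lemma prj_open: "nb (mid E) U \<Longrightarrow> nb G (prj E ` U)"
proof -
  assume U: "nb (mid E) U"
  have "open_map (topo (mid E)) (topo G) (prj E)"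
    using ext prj_surj G.topspace_eq by (metis is_ext_def subtopology_topspace)
  then show ?thesis using U prj_simps(3) unfolding nb_def open_map_def by (metis imageI)
qed

lemma inc_closedin: "closedin (topo (mid E)) (inc E ` carrier H)"
proof (rule X.closedin_locally)
  fix x assume x: "x \<in> carrier (mid E)"
    and near: "\<And>U. nb (mid E) U \<Longrightarrow> \<exists>u\<in>U. x \<otimes>\<^bsub>mid E\<^esub> u \<in> inc E ` carrier H"
  have "inv\<^bsub>G\<^esub> prj E x = \<one>\<^bsub>G\<^esub>"
  proof (rule G.eq_oneI)
    fix W assume W: "nb G W"
    obtain u h where u: "u \<in> carrier (mid E)" "prj E u \<in> W" "h \<in> carrier H" "x \<otimes>\<^bsub>mid E\<^esub> u = inc E h"
      using near[OF nb_prj[OF W]] by blast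
    have "prj E x \<otimes>\<^bsub>G\<^esub> prj E u = \<one>\<^bsub>G\<^esub>" using u x by (metis prj_inc prj_simps(2))
    then have "inv\<^bsub>G\<^esub> prj E x = prj E u" using u x by (intro G.inv_equality) (auto simp: G.m_comm)
    then show "inv\<^bsub>G\<^esub> prj E x \<in> W" using u by simp
  qed (use x in simp)
  then have "prj E x = \<one>\<^bsub>G\<^esub>" using x by (metis G.inv_inv G.inv_one prj_simps(1))
  then show "x \<in> inc E ` carrier H" using x by (simp add: kernel)
qed auto

end

text \<open>Homomorphisms of the middle groups lying over \<open>a\<close> on the left and \<open>t\<close> on the right. Equivalence is
  the case of two identity maps. Pull-backs and push-outs have universal properties with respect to
  such morphisms, so that equivalences between composite constructions, for instance between the
  pull-back of a Baer sum and the Baer sum of pull-backs, result from composing morphisms.\<close>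
definition ext_morphism ::
  "'h top_group \<Rightarrow> ('h \<Rightarrow> 'h') \<Rightarrow> ('g \<Rightarrow> 'g') \<Rightarrow> ('h, 'x, 'g) ext_seq \<Rightarrow> ('h', 'y, 'g') ext_seq \<Rightarrow> bool"
  where
  "ext_morphism H a t E E' \<longleftrightarrow>
     (\<exists>T\<in>cont_hom (mid E) (mid E').
        (\<forall>h\<in>carrier H. T (inc E h) = inc E' (a h)) \<and>
        (\<forall>x\<in>carrier (mid E). prj E' (T x) = t (prj E x)))"

lemma ext_equiv_morphism: "ext_equiv H E E' \<longleftrightarrow> ext_morphism H (\<lambda>h. h) (\<lambda>g. g) E E'"
  by (simp add: ext_equiv_def ext_morphism_def)

lemma ext_morphism_compose:
  assumes "ext_morphism H a t E E'" "ext_morphism H' a' t' E' E''"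
    and "\<And>h. h \<in> carrier H \<Longrightarrow> a h \<in> carrier H'"
  shows "ext_morphism H (\<lambda>h. a' (a h)) (\<lambda>g. t' (t g)) E E''"
proof -
  obtain T where T: "T \<in> cont_hom (mid E) (mid E')" "\<forall>h\<in>carrier H. T (inc E h) = inc E' (a h)"
    "\<forall>x\<in>carrier (mid E). prj E' (T x) = t (prj E x)"
    using assms(1) by (auto simp: ext_morphism_def)
  obtain S where S: "S \<in> cont_hom (mid E') (mid E'')" "\<forall>h\<in>carrier H'. S (inc E' h) = inc E'' (a' h)"
    "\<forall>x\<in>carrier (mid E'). prj E'' (S x) = t' (prj E' x)"
    using assms(2) by (auto simp: ext_morphism_def)
  have "T x \<in> carrier (mid E')" if "x \<in> carrier (mid E)" for x
    using T(1) that by (auto simp: cont_hom_def hom_def)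
  then show ?thesis
    unfolding ext_morphism_def
    by (intro bexI[of _ "S \<circ> T"]) (use T S assms(3) in \<open>auto intro: cont_hom_compose\<close>)
qed

lemma ext_equiv_refl: "is_ext H G E \<Longrightarrow> ext_equiv H E E"
  unfolding ext_equiv_def
  by (rule bexI[of _ "\<lambda>x. x"]) (auto simp: cont_hom_def hom_def)

lemma ext_equiv_trans: "ext_equiv H E E' \<Longrightarrow> ext_equiv H E' E'' \<Longrightarrow> ext_equiv H E E''"
  unfolding ext_equiv_morphism using ext_morphism_compose[of H "\<lambda>h. h" "\<lambda>g. g" E E' H "\<lambda>h. h" "\<lambda>g. g" E''] by simp

text \<open>The topological short five lemma. Bijectivity of \<open>T\<close> is a diagram chase; the content is that the
  inverse is continuous. Given \<open>y\<close> near the identity of the target, openness of the projection of \<open>E\<close>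
  provides \<open>x\<close> near the identity with the same projection as \<open>y\<close>. Then \<open>y\<close> and \<open>T x\<close> differ by an element of
  \<open>H\<close> which is small in \<open>mid E'\<close>, hence small in \<open>H\<close> and in \<open>mid E\<close>, so \<open>y\<close> is the image of a small
  element.\<close>
lemma ext_equiv_sym:
  assumes H: "top_ab_group H" and G: "top_ab_group G" and E: "is_ext H G E" and E': "is_ext H G E'"
    and eq: "ext_equiv H E E'"
  shows "ext_equiv H E' E"
proof -
  interpret E: extension H G E by unfold_locales (rule H G E)+
  interpret E': extension H G E' by unfold_locales (rule E')
  obtain T where T: "T \<in> cont_hom (mid E) (mid E')" "\<And>h. h \<in> carrier H \<Longrightarrow> T (inc E h) = inc E' h"
    "\<And>x. x \<in> carrier (mid E) \<Longrightarrow> prj E' (T x) = prj E x"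
    using eq by (auto simp: ext_equiv_def)
  note Th [simp] = cont_homD(1-4)[OF E.X.top_ab_group E'.X.top_ab_group T(1)]
  have inj: "inj_on T (carrier (mid E))"
  proof (rule inj_onI)
    fix x y assume xy: "x \<in> carrier (mid E)" "y \<in> carrier (mid E)" "T x = T y"
    then have "prj E x = prj E y" using T(3) by metis
    then obtain h where h: "h \<in> carrier H" "x \<otimes>\<^bsub>mid E\<^esub> inv\<^bsub>mid E\<^esub> y = inc E h"
      using E.prj_eqD xy(1,2) by blast
    have "inc E' h = T (x \<otimes>\<^bsub>mid E\<^esub> inv\<^bsub>mid E\<^esub> y)" using h T(2) by simp
    also have "\<dots> = \<one>\<^bsub>mid E'\<^esub>" using xy by simp
    finally have "h = \<one>\<^bsub>H\<^esub>" using h by (metis E'.inc_eq_iff E'.inc_simps(3) E.H.one_closed)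
    then have "x \<otimes>\<^bsub>mid E\<^esub> inv\<^bsub>mid E\<^esub> y = \<one>\<^bsub>mid E\<^esub>" using h by simp
    then show "x = y" using xy by (metis E.X.inv_closed E.X.inv_equality E.X.inv_inv)
  qed
  have fill: "\<exists>h\<in>carrier H. y = T (x \<otimes>\<^bsub>mid E\<^esub> inc E h) \<and> inc E' h = y \<otimes>\<^bsub>mid E'\<^esub> inv\<^bsub>mid E'\<^esub> T x"
    if xy: "x \<in> carrier (mid E)" "y \<in> carrier (mid E')" "prj E x = prj E' y" for x y
  proof -
    obtain h where h: "h \<in> carrier H" "y \<otimes>\<^bsub>mid E'\<^esub> inv\<^bsub>mid E'\<^esub> T x = inc E' h"
      using E'.prj_eqD[of y "T x"] xy T(3) by auto
    have "T (x \<otimes>\<^bsub>mid E\<^esub> inc E h) = T x \<otimes>\<^bsub>mid E'\<^esub> (inv\<^bsub>mid E'\<^esub> T x \<otimes>\<^bsub>mid E'\<^esub> y)"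
      using h T(2) xy by (simp add: h(2)[symmetric] E'.X.m_comm)
    also have "\<dots> = y" using xy by (simp add: E'.X.mult_inv_cancel)
    finally show ?thesis using h by auto
  qed
  have sur: "\<exists>x\<in>carrier (mid E). T x = y" if y: "y \<in> carrier (mid E')" for y
  proof -
    obtain x where x: "x \<in> carrier (mid E)" "prj E x = prj E' y"
      using E.prj_surj E'.prj_simps(1)[OF y] by (metis imageE)
    then obtain h where "h \<in> carrier H" "y = T (x \<otimes>\<^bsub>mid E\<^esub> inc E h)" using fill[OF x(1) y] by auto
    then show ?thesis using x by (intro bexI[of _ "x \<otimes>\<^bsub>mid E\<^esub> inc E h"]) auto
  qed
  have near: "\<exists>V. nb (mid E') V \<and> V \<subseteq> T ` U" if U: "nb (mid E) U" for U
  proof -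
    obtain V where V: "nb (mid E) V" "\<And>x y. x \<in> V \<Longrightarrow> y \<in> V \<Longrightarrow> x \<otimes>\<^bsub>mid E\<^esub> y \<in> U"
      using E.X.nb_sym[OF U] by blast
    obtain W where W: "nb (mid E') W" "\<And>h. h \<in> carrier H \<Longrightarrow> inc E' h \<in> W \<Longrightarrow> h \<in> {h \<in> carrier H. inc E h \<in> V}"
      using E'.inc_embedding[OF E.nb_inc[OF V(1)]] by blast
    obtain W0 where W0: "nb (mid E') W0" "\<And>x. x \<in> W0 \<Longrightarrow> inv\<^bsub>mid E'\<^esub> x \<in> W0"
      "\<And>x y. x \<in> W0 \<Longrightarrow> y \<in> W0 \<Longrightarrow> x \<otimes>\<^bsub>mid E'\<^esub> y \<in> W" using E'.X.nb_sym[OF W(1)] by blast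
    define A where "A = V \<inter> {x \<in> carrier (mid E). T x \<in> W0}"
    have A: "nb (mid E) A"
      unfolding A_def by (intro E.X.nb_Int V(1) cont_homD(5)[OF E.X.top_ab_group E'.X.top_ab_group T(1)] W0(1))
    let ?B = "W0 \<inter> {y \<in> carrier (mid E'). prj E' y \<in> prj E ` A}"
    have "?B \<subseteq> T ` U"
    proof
      fix y assume y: "y \<in> ?B"
      then obtain x where x: "x \<in> A" "prj E x = prj E' y" by auto
      then have xc: "x \<in> carrier (mid E)" "T x \<in> W0" "x \<in> V" by (auto simp: A_def)
      obtain h where h: "h \<in> carrier H" "y = T (x \<otimes>\<^bsub>mid E\<^esub> inc E h)" "inc E' h = y \<otimes>\<^bsub>mid E'\<^esub> inv\<^bsub>mid E'\<^esub> T x"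
        using fill[OF xc(1) _ x(2)] y by auto
      have "inc E' h \<in> W" unfolding h(3) using y xc W0 by auto
      then have "inc E h \<in> V" using W(2) h(1) by auto
      then show "y \<in> T ` U" using h(2) V(2) xc(3) by auto
    qed
    moreover have "nb (mid E') ?B"
      by (intro E'.X.nb_Int W0(1) E'.nb_prj E.prj_open A)
    ultimately show ?thesis by blast
  qed
  define S where "S = inv_into (carrier (mid E)) T"
  have TS: "S y \<in> carrier (mid E)" "T (S y) = y" if "y \<in> carrier (mid E')" for y
  proof -
    have "y \<in> T ` carrier (mid E)" using sur[OF that] by blast
    then show "S y \<in> carrier (mid E)" "T (S y) = y"
      unfolding S_def by (auto intro: inv_into_into f_inv_into_f)
  qed
  have ST: "S (T x) = x" if "x \<in> carrier (mid E)" for x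
    using inj that by (simp add: S_def)
  have homS: "S \<in> hom (mid E') (mid E)"
  proof (rule homI)
    fix y z assume yz: "y \<in> carrier (mid E')" "z \<in> carrier (mid E')"
    have "y \<otimes>\<^bsub>mid E'\<^esub> z = T (S y \<otimes>\<^bsub>mid E\<^esub> S z)" using TS yz by simp
    then show "S (y \<otimes>\<^bsub>mid E'\<^esub> z) = S y \<otimes>\<^bsub>mid E\<^esub> S z"
      using TS(1)[OF yz(1)] TS(1)[OF yz(2)] ST[of "S y \<otimes>\<^bsub>mid E\<^esub> S z"] by (simp del: Th)
  qed (use TS in auto)
  have "S \<in> cont_hom (mid E') (mid E)"
  proof (rule hom_continuousI[OF E'.X.top_ab_group E.X.top_ab_group homS])
    fix U assume U: "nb (mid E) U"
    obtain V where V: "nb (mid E') V" "V \<subseteq> T ` U" using near[OF U] by blast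
    have "S y \<in> U" if y: "y \<in> V" for y
    proof -
      obtain u where "u \<in> U" "y = T u" using V(2) y by blast
      then show ?thesis using ST E.X.nb_carrier[OF U] by auto
    qed
    then show "\<exists>V. nb (mid E') V \<and> (\<forall>x\<in>V. S x \<in> U)" using V(1) by blast
  qed
  moreover have "S (inc E' h) = inc E h" if "h \<in> carrier H" for h
    using ST[of "inc E h"] T(2) that by simp
  moreover have "prj E (S y) = prj E' y" if "y \<in> carrier (mid E')" for y
    using T(3)[of "S y"] TS that by simp
  ultimately show ?thesis unfolding ext_equiv_def by blast
qed

section \<open>Products, pull-backs and push-outs of extensions\<close>

lemma cont_hom_fst: "fst \<in> cont_hom (prod_top_group X Y) X"
  by (auto simp: cont_hom_def hom_def continuous_map_fst)

lemma cont_hom_snd: "snd \<in> cont_hom (prod_top_group X Y) Y"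
  by (auto simp: cont_hom_def hom_def continuous_map_snd)

lemma cont_hom_Pair:
  "f \<in> cont_hom Z X \<Longrightarrow> g \<in> cont_hom Z Y \<Longrightarrow> (\<lambda>z. (f z, g z)) \<in> cont_hom Z (prod_top_group X Y)"
  by (auto simp: cont_hom_def hom_def continuous_map_paired)

lemma cont_hom_one: "top_ab_group Z \<Longrightarrow> top_ab_group X \<Longrightarrow> (\<lambda>_. \<one>\<^bsub>X\<^esub>) \<in> cont_hom Z X"
proof -
  assume Z: "top_ab_group Z" and X: "top_ab_group X"
  interpret X: topological_ab_group X by unfold_locales (rule X)
  show ?thesis by (auto simp: cont_hom_def hom_def)
qed

lemma cont_hom_ident: "(\<lambda>x. x) \<in> cont_hom X X"
  by (auto simp: cont_hom_def hom_def)

lemma cont_hom_mult: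
  assumes "top_ab_group Y" "f \<in> cont_hom Z Y" "g \<in> cont_hom Z Y"
  shows "(\<lambda>z. f z \<otimes>\<^bsub>Y\<^esub> g z) \<in> cont_hom Z Y"
proof -
  interpret Y: topological_ab_group Y by unfold_locales (rule assms)
  have "(\<lambda>(x, y). x \<otimes>\<^bsub>Y\<^esub> y) \<in> cont_hom (prod_top_group Y Y) Y"
    using Y.top_ab_group by (auto simp: cont_hom_def hom_def top_ab_group_def intro: Y.mult_swap)
  from cont_hom_compose[OF cont_hom_Pair[OF assms(2,3)] this] show ?thesis by (simp add: o_def)
qed

lemma cont_hom_into_sub:
  "f \<in> cont_hom Z X \<Longrightarrow> (\<And>z. z \<in> carrier Z \<Longrightarrow> f z \<in> A) \<Longrightarrow> topspace (topo Z) = carrier Z \<Longrightarrow>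
    f \<in> cont_hom Z (sub_top_group X A)"
  by (auto simp: cont_hom_def hom_def continuous_map_in_subtopology)

lemma cont_hom_from_sub:
  "f \<in> cont_hom X Z \<Longrightarrow> A \<subseteq> carrier X \<Longrightarrow> f \<in> cont_hom (sub_top_group X A) Z"
  by (auto simp: cont_hom_def hom_def subset_iff intro: continuous_map_from_subtopology)

lemma prod_is_ext:
  assumes "top_ab_group H" "top_ab_group G" "is_ext H G E"
    and "top_ab_group H'" "top_ab_group G'" "is_ext H' G' E'"
  shows "is_ext (prod_top_group H H') (prod_top_group G G') (prod_ext E E')"
proof -
  interpret E: extension H G E by unfold_locales (rule assms)+
  interpret E': extension H' G' E' by unfold_locales (rule assms)+
  have mp: "map_prod f f' = (\<lambda>z. ((f \<circ> fst) z, (f' \<circ> snd) z))"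
    for f :: "'u \<Rightarrow> 'v" and f' :: "'u' \<Rightarrow> 'v'" by auto
  have m: "mid (prod_ext E E') = prod_top_group (mid E) (mid E')"
    "inc (prod_ext E E') = map_prod (inc E) (inc E')" "prj (prod_ext E E') = map_prod (prj E) (prj E')"
    by (auto simp: prod_ext_def)
  show ?thesis
  proof (rule is_extI, unfold m)
    show "top_ab_group (prod_top_group H H')" "top_ab_group (prod_top_group G G')"
      "top_ab_group (prod_top_group (mid E) (mid E'))"
      by (intro prod_top_ab_group assms E.X.top_ab_group E'.X.top_ab_group)+
    show "map_prod (inc E) (inc E') \<in> cont_hom (prod_top_group H H') (prod_top_group (mid E) (mid E'))"
      unfolding mp by (intro cont_hom_Pair cont_hom_compose[OF cont_hom_fst E.inc_cont] cont_hom_compose[OF cont_hom_snd E'.inc_cont])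
    show "map_prod (prj E) (prj E') \<in> cont_hom (prod_top_group (mid E) (mid E')) (prod_top_group G G')"
      unfolding mp by (intro cont_hom_Pair cont_hom_compose[OF cont_hom_fst E.prj_cont] cont_hom_compose[OF cont_hom_snd E'.prj_cont])
    show "\<exists>V. nb (prod_top_group (mid E) (mid E')) V \<and>
        (\<forall>h\<in>carrier (prod_top_group H H'). map_prod (inc E) (inc E') h \<in> V \<longrightarrow> h \<in> U)"
      if "nb (prod_top_group H H') U" for U
    proof -
      obtain A B where AB: "nb H A" "nb H' B" "\<And>u v. u \<in> A \<Longrightarrow> v \<in> B \<Longrightarrow> (u, v) \<in> U"
        using nb_prodD[OF \<open>nb (prod_top_group H H') U\<close>] by blast
      obtain V where V: "nb (mid E) V" "\<forall>h\<in>carrier H. inc E h \<in> V \<longrightarrow> h \<in> A" using E.inc_embedding[OF AB(1)] by blast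
      obtain V' where V': "nb (mid E') V'" "\<forall>h\<in>carrier H'. inc E' h \<in> V' \<longrightarrow> h \<in> B" using E'.inc_embedding[OF AB(2)] by blast
      show ?thesis
        by (rule exI[of _ "V \<times> V'"]) (use nb_prodI[OF V(1) V'(1)] V(2) V'(2) AB(3) in auto)
    qed
    show "\<exists>V. nb (prod_top_group G G') V \<and> V \<subseteq> map_prod (prj E) (prj E') ` U"
      if "nb (prod_top_group (mid E) (mid E')) U" for U
    proof -
      obtain A B where AB: "nb (mid E) A" "nb (mid E') B" "\<And>u v. u \<in> A \<Longrightarrow> v \<in> B \<Longrightarrow> (u, v) \<in> U"
        using nb_prodD[OF \<open>nb (prod_top_group (mid E) (mid E')) U\<close>] by blast
      have "prj E ` A \<times> prj E' ` B \<subseteq> map_prod (prj E) (prj E') ` U"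
        using AB(3) by (force simp: map_prod_def)
      then show ?thesis using nb_prodI[OF E.prj_open[OF AB(1)] E'.prj_open[OF AB(2)]] by blast
    qed
    show "x \<in> map_prod (inc E) (inc E') ` carrier (prod_top_group H H')"
      if "x \<in> carrier (prod_top_group (mid E) (mid E'))" "map_prod (prj E) (prj E') x = \<one>\<^bsub>prod_top_group G G'\<^esub>" for x
    proof -
      have "fst x \<in> inc E ` carrier H" "snd x \<in> inc E' ` carrier H'"
        using that E.kernel E'.kernel by (auto simp: map_prod_def split: prod.splits)
      then show ?thesis by (cases x) auto
    qed
    show "y \<in> map_prod (prj E) (prj E') ` carrier (prod_top_group (mid E) (mid E'))"
      if "y \<in> carrier (prod_top_group G G')" for y
    proof -
      have "fst y \<in> prj E ` carrier (mid E)" "snd y \<in> prj E' ` carrier (mid E')"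
        using that E.prj_surj E'.prj_surj by auto
      then show ?thesis by (cases y) auto
    qed
  qed auto
qed

lemma prod_ext_morphism:
  assumes "ext_morphism H a t E F" "ext_morphism H' a' t' E' F'"
  shows "ext_morphism (prod_top_group H H') (map_prod a a') (map_prod t t') (prod_ext E E') (prod_ext F F')"
proof -
  obtain T where T: "T \<in> cont_hom (mid E) (mid F)" "\<forall>h\<in>carrier H. T (inc E h) = inc F (a h)"
    "\<forall>x\<in>carrier (mid E). prj F (T x) = t (prj E x)"
    using assms(1) by (auto simp: ext_morphism_def)
  obtain S where S: "S \<in> cont_hom (mid E') (mid F')" "\<forall>h\<in>carrier H'. S (inc E' h) = inc F' (a' h)"
    "\<forall>x\<in>carrier (mid E'). prj F' (S x) = t' (prj E' x)"
    using assms(2) by (auto simp: ext_morphism_def)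
  have "(\<lambda>z. ((T \<circ> fst) z, (S \<circ> snd) z)) \<in> cont_hom (prod_top_group (mid E) (mid E')) (prod_top_group (mid F) (mid F'))"
    by (intro cont_hom_Pair cont_hom_compose[OF cont_hom_fst T(1)] cont_hom_compose[OF cont_hom_snd S(1)])
  then show ?thesis
    unfolding ext_morphism_def prod_ext_def
    by (intro bexI[of _ "\<lambda>z. ((T \<circ> fst) z, (S \<circ> snd) z)"]) (use T S in auto)
qed

lemma pullback_is_ext:
  assumes H: "top_ab_group H" and G: "top_ab_group G" and E: "is_ext H G E"
    and G': "top_ab_group G'" and t: "t \<in> cont_hom G' G"
  shows "is_ext H G' (pullback_ext G' t E)"
proof -
  interpret E: extension H G E by unfold_locales (rule H G E)+
  interpret G': topological_ab_group G' by unfold_locales (rule G')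
  note th [simp] = cont_homD(1-4)[OF G' G t]
  define P where "P = prod_top_group (mid E) G'"
  define A where "A = {(x, g) \<in> carrier (mid E) \<times> carrier G'. prj E x = t g}"
  note P = prod_top_ab_group[OF E.X.top_ab_group G', folded P_def]
  interpret P: topological_ab_group P by unfold_locales (rule P(1))
  have Ps: "carrier P = carrier (mid E) \<times> carrier G'" "\<one>\<^bsub>P\<^esub> = (\<one>\<^bsub>mid E\<^esub>, \<one>\<^bsub>G'\<^esub>)"
    "(x, y) \<otimes>\<^bsub>P\<^esub> (x', y') = (x \<otimes>\<^bsub>mid E\<^esub> x', y \<otimes>\<^bsub>G'\<^esub> y')" for x y x' y' by (auto simp: P_def)
  have AP: "A \<subseteq> carrier P" by (auto simp: A_def Ps)
  have oneA: "(\<one>\<^bsub>mid E\<^esub>, \<one>\<^bsub>G'\<^esub>) \<in> A" by (auto simp: A_def)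
  have A: "subgroup A P"
  proof (rule P.subgroupI)
    show "A \<noteq> {}" using oneA by auto
  qed (auto simp: A_def Ps P(2))
  have SA: "top_ab_group (sub_top_group P A)" by (rule sub_top_ab_group[OF P(1) A])
  have m: "mid (pullback_ext G' t E) = sub_top_group P A"
    "inc (pullback_ext G' t E) = (\<lambda>h. (inc E h, \<one>\<^bsub>G'\<^esub>))" "prj (pullback_ext G' t E) = snd"
    by (auto simp: pullback_ext_def P_def A_def)
  show ?thesis
  proof (rule is_extI[OF H G'], unfold m)
    show "top_ab_group (sub_top_group P A)" by (rule SA)
    show "(\<lambda>h. (inc E h, \<one>\<^bsub>G'\<^esub>)) \<in> cont_hom H (sub_top_group P A)"
    proof (rule cont_hom_into_sub)
      show "(\<lambda>h. (inc E h, \<one>\<^bsub>G'\<^esub>)) \<in> cont_hom H P"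
        unfolding P_def by (rule cont_hom_Pair[OF E.inc_cont cont_hom_one[OF H G']])
    qed (auto simp: A_def)
    show "snd \<in> cont_hom (sub_top_group P A) G'"
      by (rule cont_hom_from_sub) (auto simp: P_def A_def cont_hom_snd)
    show "\<exists>V. nb (sub_top_group P A) V \<and> (\<forall>h\<in>carrier H. (inc E h, \<one>\<^bsub>G'\<^esub>) \<in> V \<longrightarrow> h \<in> U)"
      if "nb H U" for U
    proof -
      obtain V where V: "nb (mid E) V" "\<forall>h\<in>carrier H. inc E h \<in> V \<longrightarrow> h \<in> U"
        using E.inc_embedding[OF \<open>nb H U\<close>] by blast
      have "nb P (V \<times> carrier G')" unfolding P_def by (intro nb_prodI V(1) G'.nb_UNIV)
      then show ?thesis
        using V(2) oneA by (intro exI[of _ "(V \<times> carrier G') \<inter> A"]) (auto simp: nb_sub_iff Ps)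
    qed
    show "\<exists>V. nb G' V \<and> V \<subseteq> snd ` W" if W: "nb (sub_top_group P A) W" for W
    proof -
      obtain W' where W': "nb P W'" "W = W' \<inter> A" using W oneA by (auto simp: nb_sub_iff Ps)
      obtain U V where UV: "nb (mid E) U" "nb G' V" "\<And>u v. u \<in> U \<Longrightarrow> v \<in> V \<Longrightarrow> (u, v) \<in> W'"
        using nb_prodD W'(1) unfolding P_def by blast
      have "V \<inter> {g \<in> carrier G'. t g \<in> prj E ` U} \<subseteq> snd ` W"
      proof
        fix g assume g: "g \<in> V \<inter> {g \<in> carrier G'. t g \<in> prj E ` U}"
        then obtain u where u: "u \<in> U" "t g = prj E u" by blast
        then have "(u, g) \<in> W" using g UV(3) E.X.nb_carrier[OF UV(1)] by (auto simp: W'(2) A_def)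
        then show "g \<in> snd ` W" by force
      qed
      moreover have "nb G' (V \<inter> {g \<in> carrier G'. t g \<in> prj E ` U})"
        by (intro G'.nb_Int UV cont_homD(5)[OF G' G t] E.prj_open)
      ultimately show ?thesis by blast
    qed
    show "x \<in> (\<lambda>h. (inc E h, \<one>\<^bsub>G'\<^esub>)) ` carrier H"
      if "x \<in> carrier (sub_top_group P A)" "snd x = \<one>\<^bsub>G'\<^esub>" for x
    proof -
      have "fst x \<in> inc E ` carrier H" using that by (auto simp: E.kernel A_def)
      then show ?thesis using that by (cases x) auto
    qed
    show "y \<in> snd ` carrier (sub_top_group P A)" if "y \<in> carrier G'" for y
    proof -
      have "t y \<in> prj E ` carrier (mid E)" using that by (simp add: E.prj_surj)
      then obtain x where "x \<in> carrier (mid E)" "prj E x = t y" by force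
      then have "(x, y) \<in> carrier (sub_top_group P A)" using that by (simp add: A_def)
      then show ?thesis by force
    qed
  qed auto
qed

lemma pullback_morphism:
  "ext_morphism H (\<lambda>h. h) t (pullback_ext G' t E) E"
  unfolding ext_morphism_def
proof (intro bexI conjI)
  show "fst \<in> cont_hom (mid (pullback_ext G' t E)) (mid E)"
    unfolding pullback_ext_def by simp (rule cont_hom_from_sub[OF cont_hom_fst], auto)
qed (auto simp: pullback_ext_def)

lemma pullback_universal:
  assumes "ext_morphism H a (\<lambda>g. t (s g)) E' E" and E': "is_ext H G E'" and H: "top_ab_group H" and G: "top_ab_group G"
    and s: "s \<in> cont_hom G G'" and G': "top_ab_group G'"
  shows "ext_morphism H a s E' (pullback_ext G' t E)"
proof -
  interpret E': extension H G E' by unfold_locales (rule H G E')+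
  obtain T where T: "T \<in> cont_hom (mid E') (mid E)" "\<forall>h\<in>carrier H. T (inc E' h) = inc E (a h)"
    "\<forall>x\<in>carrier (mid E'). prj E (T x) = t (s (prj E' x))"
    using assms(1) by (auto simp: ext_morphism_def)
  have sc: "s g \<in> carrier G'" if "g \<in> carrier G" for g using s that by (auto simp: cont_hom_def hom_def)
  have Tc: "T x \<in> carrier (mid E)" if "x \<in> carrier (mid E')" for x
    using T(1) that by (auto simp: cont_hom_def hom_def)
  have s1: "s \<one>\<^bsub>G\<^esub> = \<one>\<^bsub>G'\<^esub>" using cont_homD(3)[OF G G' s] .
  have "(\<lambda>x. (T x, (s \<circ> prj E') x)) \<in> cont_hom (mid E') (mid (pullback_ext G' t E))"
    unfolding pullback_ext_def ext_seq.simps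
    by (intro cont_hom_into_sub cont_hom_Pair T cont_hom_compose[OF E'.prj_cont s])
      (use T(3) Tc sc in auto)
  then show ?thesis
    unfolding ext_morphism_def
    by (intro bexI[of _ "\<lambda>x. (T x, (s \<circ> prj E') x)"]) (use T s1 in \<open>auto simp: pullback_ext_def\<close>)
qed

text \<open>The push-out along \<open>a\<close> is the quotient of \<open>P = H' \<times> X\<close> by the subgroup \<open>N\<close> of all \<open>(a h, \<iota> h\<^sup>-\<^sup>1)\<close>. In it
  \<open>(k, \<iota> h)\<close> and \<open>(k a(h), 1)\<close> become equal, so that the kernel of the new projection is the image of \<open>H'\<close>.\<close>
locale pushout = E: extension H G E + H': topological_ab_group H'
  for H :: "'h top_group" and G :: "'g top_group" and E :: "('h, 'x, 'g) ext_seq"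
    and H' :: "'k top_group" +
  fixes a :: "'h \<Rightarrow> 'k"
  assumes a: "a \<in> cont_hom H H'"
begin

definition "P = prod_top_group H' (mid E)"
definition "N = (\<lambda>h. (a h, inv\<^bsub>mid E\<^esub> (inc E h))) ` carrier H"
definition "Q = (\<lambda>z. N #>\<^bsub>P\<^esub> z)"

lemmas a_simps [simp] = cont_homD(1-4)[OF E.H.top_ab_group H'.top_ab_group a]

lemma P_simps [simp]:
  "carrier P = carrier H' \<times> carrier (mid E)" "\<one>\<^bsub>P\<^esub> = (\<one>\<^bsub>H'\<^esub>, \<one>\<^bsub>mid E\<^esub>)"
  "(k, x) \<otimes>\<^bsub>P\<^esub> (k', x') = (k \<otimes>\<^bsub>H'\<^esub> k', x \<otimes>\<^bsub>mid E\<^esub> x')"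
  by (auto simp: P_def)

lemmas P = prod_top_ab_group[OF H'.top_ab_group E.X.top_ab_group, folded P_def]

sublocale P: topological_ab_group P by unfold_locales (rule P(1))

lemma N_subgroup: "subgroup N P"
proof (rule P.subgroupI)
  show "N \<subseteq> carrier P" by (auto simp: N_def)
  show "N \<noteq> {}" using E.H.one_closed by (auto simp: N_def)
  show "inv\<^bsub>P\<^esub> z \<in> N" if "z \<in> N" for z
  proof -
    obtain h where h: "h \<in> carrier H" "z = (a h, inv\<^bsub>mid E\<^esub> (inc E h))" using \<open>z \<in> N\<close> by (auto simp: N_def)
    then have "inv\<^bsub>P\<^esub> z = (a (inv\<^bsub>H\<^esub> h), inv\<^bsub>mid E\<^esub> (inc E (inv\<^bsub>H\<^esub> h)))" by (simp add: P(2))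
    then show ?thesis using h unfolding N_def by blast
  qed
  show "z \<otimes>\<^bsub>P\<^esub> w \<in> N" if "z \<in> N" "w \<in> N" for z w
  proof -
    obtain h where h: "h \<in> carrier H" "z = (a h, inv\<^bsub>mid E\<^esub> (inc E h))" using \<open>z \<in> N\<close> by (auto simp: N_def)
    obtain k where k: "k \<in> carrier H" "w = (a k, inv\<^bsub>mid E\<^esub> (inc E k))" using \<open>w \<in> N\<close> by (auto simp: N_def)
    have "z \<otimes>\<^bsub>P\<^esub> w = (a (h \<otimes>\<^bsub>H\<^esub> k), inv\<^bsub>mid E\<^esub> (inc E (h \<otimes>\<^bsub>H\<^esub> k)))"
      using h k by (simp add: E.X.inv_mult)
    then show ?thesis using h k unfolding N_def by blast
  qed
qed

text \<open>The subgroup \<open>N\<close> is the graph of a continuous map from the closed subgroup \<open>\<iota> H\<close> into the Hausdorff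
  group \<open>H'\<close>, hence closed.\<close>
lemma N_closed: "closedin (topo P) N"
proof (rule P.closedin_locally)
  show "N \<subseteq> carrier P" by (auto simp: N_def)
  fix z assume z: "z \<in> carrier P" and near: "\<And>W. nb P W \<Longrightarrow> \<exists>w\<in>W. z \<otimes>\<^bsub>P\<^esub> w \<in> N"
  obtain k x where kx: "z = (k, x)" "k \<in> carrier H'" "x \<in> carrier (mid E)" using z by auto
  have near2: "\<exists>u\<in>U. \<exists>v\<in>V. \<exists>h\<in>carrier H. k \<otimes>\<^bsub>H'\<^esub> u = a h \<and> x \<otimes>\<^bsub>mid E\<^esub> v = inv\<^bsub>mid E\<^esub> inc E h"
    if "nb H' U" "nb (mid E) V" for U V
    using near[of "U \<times> V"] nb_prodI[OF that] by (auto simp: kx N_def P_def)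
  have "x \<in> inc E ` carrier H"
  proof (rule ccontr)
    assume "x \<notin> inc E ` carrier H"
    then have "x \<in> carrier (mid E) - inc E ` carrier H" using kx by blast
    moreover have "openin (topo (mid E)) (carrier (mid E) - inc E ` carrier H)"
      using E.inc_closedin by (simp add: closedin_def)
    ultimately have "nb (mid E) {v \<in> carrier (mid E). x \<otimes>\<^bsub>mid E\<^esub> v \<in> carrier (mid E) - inc E ` carrier H}"
      by (intro E.X.nb_translate)
    from near2[OF H'.nb_UNIV this] obtain v h where "h \<in> carrier H" "x \<otimes>\<^bsub>mid E\<^esub> v \<notin> inc E ` carrier H"
      "x \<otimes>\<^bsub>mid E\<^esub> v = inv\<^bsub>mid E\<^esub> inc E h" by blast
    then show False by (metis E.H.inv_closed E.inc_simps(4) imageI)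
  qed
  then obtain h' where h': "h' \<in> carrier H" "x = inc E h'" by blast
  define h where "h = inv\<^bsub>H\<^esub> h'"
  have h: "h \<in> carrier H" "x = inv\<^bsub>mid E\<^esub> inc E h" using h' by (auto simp: h_def)
  have "k \<otimes>\<^bsub>H'\<^esub> inv\<^bsub>H'\<^esub> a h = \<one>\<^bsub>H'\<^esub>"
  proof (rule H'.eq_oneI)
    fix U assume U: "nb H' U"
    obtain V where V: "nb H' V" "\<forall>x\<in>V. inv\<^bsub>H'\<^esub> x \<in> V" "\<forall>x\<in>V. \<forall>y\<in>V. x \<otimes>\<^bsub>H'\<^esub> y \<in> U"
      using H'.nb_sym[OF U] by blast
    obtain V' where V': "nb (mid E) V'" "\<forall>h\<in>carrier H. inc E h \<in> V' \<longrightarrow> h \<in> {h \<in> carrier H. a h \<in> V}"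
      using E.inc_embedding[OF cont_homD(5)[OF E.H.top_ab_group H'.top_ab_group a V(1)]] by blast
    obtain u v g where uvg: "u \<in> V" "v \<in> V'" "g \<in> carrier H" "k \<otimes>\<^bsub>H'\<^esub> u = a g" "x \<otimes>\<^bsub>mid E\<^esub> v = inv\<^bsub>mid E\<^esub> inc E g"
      using near2[OF V(1) V'(1)] by blast
    have uc: "u \<in> carrier H'" "v \<in> carrier (mid E)"
      using uvg H'.nb_carrier[OF V(1)] E.X.nb_carrier[OF V'(1)] by auto
    have "v = inv\<^bsub>mid E\<^esub> x \<otimes>\<^bsub>mid E\<^esub> (x \<otimes>\<^bsub>mid E\<^esub> v)" using kx uc by (simp add: E.X.mult_inv_cancel)
    also have "\<dots> = inc E (h \<otimes>\<^bsub>H\<^esub> inv\<^bsub>H\<^esub> g)" using uvg h by simp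
    finally have "inc E (h \<otimes>\<^bsub>H\<^esub> inv\<^bsub>H\<^esub> g) \<in> V'" using uvg(2) by (simp only:)
    moreover have "h \<otimes>\<^bsub>H\<^esub> inv\<^bsub>H\<^esub> g \<in> carrier H" using h uvg by simp
    ultimately have "a (h \<otimes>\<^bsub>H\<^esub> inv\<^bsub>H\<^esub> g) \<in> V" using V'(2) by blast
    then have "inv\<^bsub>H'\<^esub> a (h \<otimes>\<^bsub>H\<^esub> inv\<^bsub>H\<^esub> g) \<in> V" using V(2) by blast
    then have "inv\<^bsub>H'\<^esub> a (h \<otimes>\<^bsub>H\<^esub> inv\<^bsub>H\<^esub> g) \<otimes>\<^bsub>H'\<^esub> inv\<^bsub>H'\<^esub> u \<in> U" using V uvg(1) by blast
    moreover have "k = a g \<otimes>\<^bsub>H'\<^esub> inv\<^bsub>H'\<^esub> u"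
      using uvg(4) kx uc uvg(3) by (metis H'.inv_solve_right a_simps(1))
    then have "inv\<^bsub>H'\<^esub> a (h \<otimes>\<^bsub>H\<^esub> inv\<^bsub>H\<^esub> g) \<otimes>\<^bsub>H'\<^esub> inv\<^bsub>H'\<^esub> u = k \<otimes>\<^bsub>H'\<^esub> inv\<^bsub>H'\<^esub> a h"
      using h uvg uc by (simp add: H'.inv_mult H'.m_ac)
    ultimately show "k \<otimes>\<^bsub>H'\<^esub> inv\<^bsub>H'\<^esub> a h \<in> U" by simp
  qed (use kx h in simp)
  then have "k = a h" using kx h by (metis H'.inv_closed H'.inv_equality H'.inv_inv a_simps(1))
  then show "z \<in> N" using kx h by (auto simp: N_def)
qed

lemmas quot = quot_top_ab_group[OF P(1) N_subgroup N_closed, folded Q_def]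

abbreviation "Y \<equiv> quot_top_group P N"

sublocale Y: topological_ab_group Y by unfold_locales (rule quot(1))

lemmas Q_simps = cont_homD(1-4)[OF P(1) quot(1,2)]

lemma N_mem_iff:
  assumes h: "h \<in> carrier H"
  shows "(k, inc E h) \<in> N \<longleftrightarrow> k = a (inv\<^bsub>H\<^esub> h)"
proof
  assume "(k, inc E h) \<in> N"
  then obtain g where g: "g \<in> carrier H" "k = a g" "inc E h = inv\<^bsub>mid E\<^esub> inc E g" by (auto simp: N_def)
  then have "inc E h = inc E (inv\<^bsub>H\<^esub> g)" by simp
  then have "h = inv\<^bsub>H\<^esub> g" using E.inc_eq_iff[OF h E.H.inv_closed[OF g(1)]] by blast
  then show "k = a (inv\<^bsub>H\<^esub> h)" using g by simp
next
  assume "k = a (inv\<^bsub>H\<^esub> h)"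
  then have "(k, inc E h) = (a (inv\<^bsub>H\<^esub> h), inv\<^bsub>mid E\<^esub> inc E (inv\<^bsub>H\<^esub> h))" using h by simp
  then show "(k, inc E h) \<in> N" using h E.H.inv_closed unfolding N_def by blast
qed

lemma Q_inc: "h \<in> carrier H \<Longrightarrow> k \<in> carrier H' \<Longrightarrow> Q (k, inc E h) = Q (k \<otimes>\<^bsub>H'\<^esub> a h, \<one>\<^bsub>mid E\<^esub>)"
  by (subst quot(4)) (auto simp: P(2) N_mem_iff H'.inv_mult H'.m_assoc[symmetric])

lemma carrier_Y: "carrier Y = Q ` carrier P"
  by (simp add: Q_def)

lemma pushout_simps:
  "mid (pushout_ext H H' a E) = Y" "inc (pushout_ext H H' a E) = (\<lambda>k. Q (k, \<one>\<^bsub>mid E\<^esub>))"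
  by (simp_all add: pushout_ext_def Let_def P_def N_def Q_def)

lemma prj_Q: "z \<in> carrier P \<Longrightarrow> prj (pushout_ext H H' a E) (Q z) = prj E (snd z)"
proof -
  assume z: "z \<in> carrier P"
  have "(\<lambda>z. prj E (snd z)) ` (Q z) = {prj E (snd z)}"
  proof
    show "(\<lambda>z. prj E (snd z)) ` (Q z) \<subseteq> {prj E (snd z)}"
      using z by (auto simp: Q_def r_coset_def N_def)
    have "z \<in> Q z" unfolding Q_def by (rule P.rcos_self[OF z N_subgroup])
    then show "{prj E (snd z)} \<subseteq> (\<lambda>z. prj E (snd z)) ` (Q z)" by blast
  qed
  then show ?thesis by (simp add: pushout_ext_def Let_def P_def[symmetric] N_def[symmetric] Q_def)
qed

lemma Q_Pair: "k \<in> carrier H' \<Longrightarrow> x \<in> carrier (mid E) \<Longrightarrow> Q (k, x) \<in> carrier Y"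
  using Q_simps(1)[of "(k, x)"] by simp

lemma pushout_is_ext: "is_ext H' G (pushout_ext H H' a E)"
proof (rule is_extI[OF H'.top_ab_group E.G.top_ab_group], unfold pushout_simps)
  let ?p = "prj (pushout_ext H H' a E)"
  show "top_ab_group Y" by (rule quot(1))
  have "Q \<circ> (\<lambda>k. (k, \<one>\<^bsub>mid E\<^esub>)) \<in> cont_hom H' Y"
    by (rule cont_hom_compose[OF _ quot(2)], unfold P_def)
      (rule cont_hom_Pair[OF cont_hom_ident cont_hom_one[OF H'.top_ab_group E.X.top_ab_group]])
  then show "(\<lambda>k. Q (k, \<one>\<^bsub>mid E\<^esub>)) \<in> cont_hom H' Y" by (simp add: o_def)
  have "prj E \<circ> snd \<in> cont_hom P G"
    unfolding P_def by (rule cont_hom_compose[OF cont_hom_snd E.prj_cont])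
  moreover have "(prj E \<circ> snd) n = \<one>\<^bsub>G\<^esub>" if "n \<in> N" for n using \<open>n \<in> N\<close> by (auto simp: N_def)
  ultimately obtain f where f: "f \<in> cont_hom Y G" "\<And>z. z \<in> carrier P \<Longrightarrow> f (Q z) = (prj E \<circ> snd) z"
    unfolding Q_def using quot_top_group_factor[OF P(1) N_subgroup N_closed E.G.top_ab_group] by metis
  show "?p \<in> cont_hom Y G"
    by (rule cont_hom_cong[OF quot(1) f(1)]) (use f(2) prj_Q carrier_Y in auto)
  show "\<exists>V. nb Y V \<and> (\<forall>h\<in>carrier H'. Q (h, \<one>\<^bsub>mid E\<^esub>) \<in> V \<longrightarrow> h \<in> U)" if U: "nb H' U" for U
  proof -
    obtain V where V: "nb H' V" "\<forall>x\<in>V. \<forall>y\<in>V. x \<otimes>\<^bsub>H'\<^esub> y \<in> U"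
      using H'.nb_sym[OF U] by blast
    obtain V' where V': "nb (mid E) V'" "\<forall>h\<in>carrier H. inc E h \<in> V' \<longrightarrow> h \<in> {h \<in> carrier H. a h \<in> V}"
      using E.inc_embedding[OF cont_homD(5)[OF E.H.top_ab_group H'.top_ab_group a V(1)]] by blast
    have "k \<in> U" if k: "k \<in> carrier H'" and mem: "Q (k, \<one>\<^bsub>mid E\<^esub>) \<in> Q ` (V \<times> V')" for k
    proof -
      obtain u v where uv: "u \<in> V" "v \<in> V'" "Q (k, \<one>\<^bsub>mid E\<^esub>) = Q (u, v)" using mem by auto
      have uc: "u \<in> carrier H'" "v \<in> carrier (mid E)"
        using uv H'.nb_carrier[OF V(1)] E.X.nb_carrier[OF V'(1)] by auto
      have "(k, \<one>\<^bsub>mid E\<^esub>) \<otimes>\<^bsub>P\<^esub> inv\<^bsub>P\<^esub> (u, v) \<in> N" using uv(3) k uc by (subst quot(4)[symmetric]) auto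
      then obtain h where h: "h \<in> carrier H" "k \<otimes>\<^bsub>H'\<^esub> inv\<^bsub>H'\<^esub> u = a h" "inv\<^bsub>mid E\<^esub> v = inv\<^bsub>mid E\<^esub> inc E h"
        using k uc by (auto simp: P(2) N_def)
      have "v = inc E h" using h uc by (metis E.X.inv_inv E.inc_simps(1))
      then have "a h \<in> V" using V'(2) uv(2) h(1) by auto
      then have "a h \<otimes>\<^bsub>H'\<^esub> u \<in> U" using V(2) uv(1) by blast
      moreover have "a h \<otimes>\<^bsub>H'\<^esub> u = k" using k uc by (simp add: h(2)[symmetric] H'.m_assoc)
      ultimately show ?thesis by simp
    qed
    moreover have "nb Y (Q ` (V \<times> V'))"
      by (rule quot(3)) (use nb_prodI[OF V(1) V'(1)] in \<open>simp add: P_def\<close>)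
    ultimately show ?thesis by blast
  qed
  show "\<exists>V. nb G V \<and> V \<subseteq> ?p ` W" if W: "nb Y W" for W
  proof -
    have "nb P {z \<in> carrier P. Q z \<in> W}" by (rule cont_homD(5)[OF P(1) quot(1,2) W])
    then obtain U V where UV: "nb H' U" "nb (mid E) V"
      "\<And>u v. u \<in> U \<Longrightarrow> v \<in> V \<Longrightarrow> (u, v) \<in> {z \<in> carrier P. Q z \<in> W}"
      using nb_prodD unfolding P_def by blast
    have "prj E ` V \<subseteq> ?p ` W"
    proof
      fix g assume "g \<in> prj E ` V"
      then obtain v where v: "v \<in> V" "g = prj E v" by blast
      have *: "(\<one>\<^bsub>H'\<^esub>, v) \<in> {z \<in> carrier P. Q z \<in> W}" using UV(3) v(1) H'.nb_one[OF UV(1)] by blast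
      then have "g = ?p (Q (\<one>\<^bsub>H'\<^esub>, v))" using v prj_Q by auto
      then show "g \<in> ?p ` W" using * by blast
    qed
    then show ?thesis using E.prj_open[OF UV(2)] by blast
  qed
  show "?p (Q (h, \<one>\<^bsub>mid E\<^esub>)) = \<one>\<^bsub>G\<^esub>" if "h \<in> carrier H'" for h
    using that by (subst prj_Q) auto
  show "y \<in> (\<lambda>k. Q (k, \<one>\<^bsub>mid E\<^esub>)) ` carrier H'" if y: "y \<in> carrier Y" "?p y = \<one>\<^bsub>G\<^esub>" for y
  proof -
    obtain k x where kx: "k \<in> carrier H'" "x \<in> carrier (mid E)" "y = Q (k, x)" using y(1) carrier_Y by auto
    then have "prj E x = \<one>\<^bsub>G\<^esub>" using y(2) prj_Q by simp
    then obtain h where h: "h \<in> carrier H" "x = inc E h" using E.kernel kx(2) by auto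
    then show ?thesis using Q_inc[OF h(1) kx(1)] kx by auto
  qed
  show "g \<in> ?p ` carrier Y" if g: "g \<in> carrier G" for g
  proof -
    obtain x where x: "x \<in> carrier (mid E)" "g = prj E x" using g E.prj_surj by blast
    then have "g = ?p (Q (\<one>\<^bsub>H'\<^esub>, x))" by (simp add: prj_Q)
    then show ?thesis using Q_Pair[OF H'.one_closed x(1)] by blast
  qed
qed

lemma pushout_morphism: "ext_morphism H a (\<lambda>g. g) E (pushout_ext H H' a E)"
  unfolding ext_morphism_def pushout_simps
proof (intro bexI conjI ballI)
  have "Q \<circ> (\<lambda>x. (\<one>\<^bsub>H'\<^esub>, x)) \<in> cont_hom (mid E) Y"
    by (rule cont_hom_compose[OF _ quot(2)], unfold P_def)
      (rule cont_hom_Pair[OF cont_hom_one[OF E.X.top_ab_group H'.top_ab_group] cont_hom_ident])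
  then show "(\<lambda>x. Q (\<one>\<^bsub>H'\<^esub>, x)) \<in> cont_hom (mid E) Y" by (simp add: o_def)
qed (auto simp: Q_inc prj_Q)

text \<open>The morphism out of the push-out is induced by \<open>(k, x) \<mapsto> \<iota>' (b k) T x\<close>, which is trivial on \<open>N\<close>.\<close>
lemma pushout_universal:
  assumes m: "ext_morphism H (\<lambda>h. b (a h)) t E E'" and E': "is_ext K G' E'"
    and K: "top_ab_group K" and G': "top_ab_group G'" and b: "b \<in> cont_hom H' K"
  shows "ext_morphism H' b t (pushout_ext H H' a E) E'"
proof -
  interpret E': extension K G' E' by unfold_locales (rule K G' E')+
  obtain T where T: "T \<in> cont_hom (mid E) (mid E')" "\<forall>h\<in>carrier H. T (inc E h) = inc E' (b (a h))"
    "\<forall>x\<in>carrier (mid E). prj E' (T x) = t (prj E x)"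
    using m by (auto simp: ext_morphism_def)
  note Th [simp] = cont_homD(1-4)[OF E.X.top_ab_group E'.X.top_ab_group T(1)]
  note bh [simp] = cont_homD(1-4)[OF H'.top_ab_group K b]
  define g where "g = (\<lambda>z. inc E' (b (fst z)) \<otimes>\<^bsub>mid E'\<^esub> T (snd z))"
  have "(\<lambda>z. (inc E' \<circ> (b \<circ> fst)) z \<otimes>\<^bsub>mid E'\<^esub> (T \<circ> snd) z) \<in> cont_hom P (mid E')"
    unfolding P_def
    by (intro cont_hom_mult E'.X.top_ab_group cont_hom_compose[OF cont_hom_compose[OF cont_hom_fst b] E'.inc_cont]
        cont_hom_compose[OF cont_hom_snd T(1)])
  then have "g \<in> cont_hom P (mid E')" by (simp add: g_def)
  moreover have "g n = \<one>\<^bsub>mid E'\<^esub>" if "n \<in> N" for n using \<open>n \<in> N\<close> T(2) by (auto simp: N_def g_def)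
  ultimately obtain f where f: "f \<in> cont_hom Y (mid E')" "\<And>z. z \<in> carrier P \<Longrightarrow> f (Q z) = g z"
    unfolding Q_def using quot_top_group_factor[OF P(1) N_subgroup N_closed E'.X.top_ab_group] by metis
  show ?thesis
    unfolding ext_morphism_def pushout_simps
  proof (intro bexI[OF _ f(1)] conjI ballI)
    show "f (Q (k, \<one>\<^bsub>mid E\<^esub>)) = inc E' (b k)" if "k \<in> carrier H'" for k
      using that by (simp add: f(2) g_def)
    show "prj E' (f y) = t (prj (pushout_ext H H' a E) y)" if y: "y \<in> carrier Y" for y
    proof -
      obtain k x where kx: "k \<in> carrier H'" "x \<in> carrier (mid E)" "y = Q (k, x)" using y carrier_Y by auto
      then show ?thesis using T(3)[rule_format, OF kx(2), symmetric] by (simp add: f(2) prj_Q g_def)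
    qed
  qed
qed

end

section \<open>Baer sums and the group of extensions\<close>

text \<open>The intermediate step of the Baer sum, an extension of \<open>G\<close> by \<open>H \<times> H\<close>: its middle group is the fibre
  product of the two middle groups over \<open>G\<close>.\<close>
definition fibre_product_ext ::
  "'g top_group \<Rightarrow> ('h, 'x, 'g) ext_seq \<Rightarrow> ('h, 'y, 'g) ext_seq \<Rightarrow> ('h \<times> 'h, ('x \<times> 'y) \<times> 'g, 'g) ext_seq"
  where "fibre_product_ext G E E' = pullback_ext G (\<lambda>g. (g, g)) (prod_ext E E')"

lemma diag_cont_hom: "(\<lambda>g. (g, g)) \<in> cont_hom G (prod_top_group G G)"
  using cont_hom_Pair[OF cont_hom_ident cont_hom_ident] .

lemma fibre_product_is_ext:
  assumes "top_ab_group H" "top_ab_group G" "is_ext H G E" "is_ext H G E'"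
  shows "is_ext (prod_top_group H H) G (fibre_product_ext G E E')"
  unfolding fibre_product_ext_def
  by (intro pullback_is_ext[where G = "prod_top_group G G"] prod_top_ab_group prod_is_ext assms diag_cont_hom)

lemma fibre_product_morphism:
  assumes H: "top_ab_group H" and G: "top_ab_group G" and E: "is_ext H G E" "is_ext H G E'"
    and t: "t \<in> cont_hom G G'" and G': "top_ab_group G'"
    and m: "ext_morphism H a t E F" "ext_morphism H a t E' F'"
  shows "ext_morphism (prod_top_group H H) (map_prod a a) t
    (fibre_product_ext G E E') (fibre_product_ext G' F F')"
proof -
  let ?D = "fibre_product_ext G E E'"
  have "ext_morphism (prod_top_group H H) (\<lambda>h. h) (\<lambda>g. (g, g)) ?D (prod_ext E E')"
    unfolding fibre_product_ext_def by (rule pullback_morphism)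
  from ext_morphism_compose[OF this prod_ext_morphism[OF m]]
  have "ext_morphism (prod_top_group H H) (map_prod a a) (\<lambda>g. (t g, t g)) ?D (prod_ext F F')"
    by (simp add: map_prod_def)
  then show ?thesis
    unfolding fibre_product_ext_def[of G']
    by (rule pullback_universal[OF _ fibre_product_is_ext[OF H G E] prod_top_ab_group(1)[OF H H] G t G'])
qed

lemma mult_cont_hom:
  assumes "top_ab_group H" shows "(\<lambda>(h, k). h \<otimes>\<^bsub>H\<^esub> k) \<in> cont_hom (prod_top_group H H) H"
  using cont_hom_mult[OF assms cont_hom_fst cont_hom_snd] by (simp add: case_prod_unfold)

lemma baer_sum_is_ext:
  assumes H: "top_ab_group H" and G: "top_ab_group G" and E: "is_ext H G E" "is_ext H G E'"
  shows "is_ext H G (baer_sum H G E E')"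
proof -
  interpret pushout "prod_top_group H H" G "fibre_product_ext G E E'" H "\<lambda>(h, k). h \<otimes>\<^bsub>H\<^esub> k"
    by unfold_locales (intro prod_top_ab_group fibre_product_is_ext mult_cont_hom assms)+
  show ?thesis using pushout_is_ext by (simp add: baer_sum_def fibre_product_ext_def)
qed

text \<open>By the universal property of the push-out, the Baer sum of two extensions is the one extension
  that receives a morphism from their fibre product lying over the multiplication of \<open>H\<close>. With this
  description, compatibility of the Baer sum with equivalences and with pull-backs is a matter of
  composing morphisms.\<close>
lemma baer_sum_equiv_iff:
  assumes H: "top_ab_group H" and G: "top_ab_group G" and E: "is_ext H G E" "is_ext H G E'"
    and F: "is_ext H G F"
  shows "ext_equiv H (baer_sum H G E E') F \<longleftrightarrow>
    ext_morphism (prod_top_group H H) (\<lambda>(h, k). h \<otimes>\<^bsub>H\<^esub> k) (\<lambda>g. g) (fibre_product_ext G E E') F"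
proof -
  let ?a = "\<lambda>(h, k). h \<otimes>\<^bsub>H\<^esub> k"
  interpret pushout "prod_top_group H H" G "fibre_product_ext G E E'" H ?a
    by unfold_locales (intro prod_top_ab_group fibre_product_is_ext mult_cont_hom assms)+
  have b: "baer_sum H G E E' = pushout_ext (prod_top_group H H) H ?a (fibre_product_ext G E E')"
    by (simp add: baer_sum_def fibre_product_ext_def)
  show ?thesis
  proof
    assume "ext_equiv H (baer_sum H G E E') F"
    then have "ext_morphism H (\<lambda>h. h) (\<lambda>g. g) (pushout_ext (prod_top_group H H) H ?a (fibre_product_ext G E E')) F"
      by (simp add: b ext_equiv_morphism)
    from ext_morphism_compose[OF pushout_morphism this a_simps(1)]
    show "ext_morphism (prod_top_group H H) ?a (\<lambda>g. g) (fibre_product_ext G E E') F" by simp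
  next
    assume "ext_morphism (prod_top_group H H) ?a (\<lambda>g. g) (fibre_product_ext G E E') F"
    then show "ext_equiv H (baer_sum H G E E') F"
      unfolding b ext_equiv_morphism
      by (intro pushout_universal[OF _ F H G cont_hom_ident])
  qed
qed

lemma baer_sum_equiv_cong:
  assumes H: "top_ab_group H" and G: "top_ab_group G"
    and E: "is_ext H G E" "is_ext H G E'" "is_ext H G E''" and F: "is_ext H G F" "is_ext H G F'" "is_ext H G F''"
    and eq: "ext_equiv H E F" "ext_equiv H E' F'" "ext_equiv H E'' F''"
    and s: "ext_equiv H (baer_sum H G E E') E''"
  shows "ext_equiv H (baer_sum H G F F') F''"
proof -
  have 1: "ext_equiv H F E" "ext_equiv H F' E'"
    using ext_equiv_sym[OF H G] E F eq by blast+
  have "ext_morphism (prod_top_group H H) (map_prod (\<lambda>h. h) (\<lambda>h. h)) (\<lambda>g. g)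
      (fibre_product_ext G F F') (fibre_product_ext G E E')"
    by (rule fibre_product_morphism[OF H G F(1,2) cont_hom_ident G]) (use 1 in \<open>auto simp: ext_equiv_morphism\<close>)
  from ext_morphism_compose[OF this s[unfolded baer_sum_equiv_iff[OF H G E]]]
  have "ext_morphism (prod_top_group H H) (\<lambda>(h, k). h \<otimes>\<^bsub>H\<^esub> k) (\<lambda>g. g) (fibre_product_ext G F F') E''"
    by (simp add: map_prod_def case_prod_unfold)
  from ext_morphism_compose[OF this eq(3)[unfolded ext_equiv_morphism]]
  have "ext_morphism (prod_top_group H H) (\<lambda>(h, k). h \<otimes>\<^bsub>H\<^esub> k) (\<lambda>g. g) (fibre_product_ext G F F') F''"
    using cont_homD(1)[OF prod_top_ab_group(1)[OF H H] H mult_cont_hom[OF H]] by simp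
  then show ?thesis by (simp add: baer_sum_equiv_iff[OF H G F])
qed

lemma pullback_equiv_cong:
  assumes H: "top_ab_group H" and G: "top_ab_group G" and G': "top_ab_group G'" and t: "t \<in> cont_hom G' G"
    and E: "is_ext H G E" and eq: "ext_equiv H E F"
  shows "ext_equiv H (pullback_ext G' t E) (pullback_ext G' t F)"
proof -
  have "ext_morphism H (\<lambda>h. h) t (pullback_ext G' t E) F"
    using ext_morphism_compose[OF pullback_morphism[of H t G' E] eq[unfolded ext_equiv_morphism]] by simp
  then show ?thesis
    unfolding ext_equiv_morphism
    by (rule pullback_universal[OF _ pullback_is_ext[OF H G E G' t] H G' cont_hom_ident G'])
qed

lemma baer_sum_pullback:
  assumes H: "top_ab_group H" and G: "top_ab_group G" and G': "top_ab_group G'" and t: "t \<in> cont_hom G' G"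
    and E: "is_ext H G E" "is_ext H G E'" "is_ext H G E''"
    and s: "ext_equiv H (baer_sum H G E E') E''"
  shows "ext_equiv H (baer_sum H G' (pullback_ext G' t E) (pullback_ext G' t E')) (pullback_ext G' t E'')"
proof -
  note P = pullback_is_ext[OF H G E(1) G' t] pullback_is_ext[OF H G E(2) G' t] pullback_is_ext[OF H G E(3) G' t]
  let ?D = "fibre_product_ext G' (pullback_ext G' t E) (pullback_ext G' t E')"
  have "ext_morphism (prod_top_group H H) (map_prod (\<lambda>h. h) (\<lambda>h. h)) t ?D (fibre_product_ext G E E')"
    by (rule fibre_product_morphism[OF H G' P(1,2) t G pullback_morphism pullback_morphism])
  from ext_morphism_compose[OF this s[unfolded baer_sum_equiv_iff[OF H G E]]]
  have "ext_morphism (prod_top_group H H) (\<lambda>(h, k). h \<otimes>\<^bsub>H\<^esub> k) t ?D E''"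
    by (simp add: map_prod_def case_prod_unfold)
  then have "ext_morphism (prod_top_group H H) (\<lambda>(h, k). h \<otimes>\<^bsub>H\<^esub> k) (\<lambda>g. g) ?D (pullback_ext G' t E'')"
    by (rule pullback_universal[OF _ fibre_product_is_ext[OF H G' P(1,2)] prod_top_ab_group(1)[OF H H] G'
          cont_hom_ident G'])
  then show ?thesis by (simp add: baer_sum_equiv_iff[OF H G' P])
qed

lemma ext_class_eq_iff:
  fixes E E' :: "('h, 'g) small_ext"
  assumes H: "top_ab_group H" and G: "top_ab_group G" and E: "is_ext H G E" "is_ext H G E'"
  shows "ext_class H G E = ext_class H G E' \<longleftrightarrow> ext_equiv H E E'"
  using E ext_equiv_refl[OF E(2)] ext_equiv_trans ext_equiv_sym[OF H G E(1,2)] ext_equiv_sym[OF H G E(2,1)]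
  unfolding ext_class_def by blast

lemma carrier_Ext:
  fixes H :: "'h top_group" and G :: "'g top_group"
  shows "carrier (Ext G H) = ext_class H G ` {E :: ('h, 'g) small_ext. is_ext H G E}"
proof -
  have "{(E, E'). is_ext H G E \<and> is_ext H G E' \<and> ext_equiv H E E'} `` {E} = ext_class H G E"
    if "is_ext H G E" for E :: "('h, 'g) small_ext"
    using that by (auto simp: ext_class_def)
  then have "{E :: ('h, 'g) small_ext. is_ext H G E} //
      {(E, E'). is_ext H G E \<and> is_ext H G E' \<and> ext_equiv H E E'} = ext_class H G ` {E :: ('h, 'g) small_ext. is_ext H G E}"
    unfolding quotient_def UNION_singleton_eq_range by (intro image_cong) blast+
  then show ?thesis by (simp add: Ext_def)
qed

text \<open>The product of classes is a union over all pairs of representatives. As equivalent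
  representatives have equivalent Baer sums, one pair suffices.\<close>
lemma Ext_mult_class:
  fixes E E' :: "('h, 'g) small_ext"
  assumes H: "top_ab_group H" and G: "top_ab_group G" and E: "is_ext H G E" "is_ext H G E'"
  shows "ext_class H G E \<otimes>\<^bsub>Ext G H\<^esub> ext_class H G E' =
    {F. is_ext H G F \<and> ext_equiv H (baer_sum H G E E') F}"
proof -
  have "ext_equiv H (baer_sum H G E E') F \<longleftrightarrow>
      (\<exists>D :: ('h, 'g) small_ext. is_ext H G D \<and> ext_equiv H E D \<and> (\<exists>D' :: ('h, 'g) small_ext. is_ext H G D' \<and> ext_equiv H E' D' \<and> ext_equiv H (baer_sum H G D D') F))"
    (is "?l \<longleftrightarrow> ?r") if F: "is_ext H G F" for F :: "('h, 'g) small_ext"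
  proof
    assume ?l then show ?r using E ext_equiv_refl by blast
  next
    assume ?r
    then obtain D D' :: "('h, 'g) small_ext" where D: "is_ext H G D" "ext_equiv H E D" "is_ext H G D'" "ext_equiv H E' D'"
      "ext_equiv H (baer_sum H G D D') F" by blast
    show ?l
      by (rule baer_sum_equiv_cong[OF H G D(1,3) F E F _ _ ext_equiv_refl[OF F] D(5)])
        (use ext_equiv_sym[OF H G] D E in blast)+
  qed
  then show ?thesis by (auto simp: Ext_def ext_class_def)
qed

lemma Ext_mult_class_eq:
  fixes E E' F :: "('h, 'g) small_ext"
  assumes H: "top_ab_group H" and G: "top_ab_group G" and E: "is_ext H G E" "is_ext H G E'"
    and F: "is_ext H G F" "ext_equiv H (baer_sum H G E E') F"
  shows "ext_class H G E \<otimes>\<^bsub>Ext G H\<^esub> ext_class H G E' = ext_class H G F"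
proof -
  have "ext_equiv H F (baer_sum H G E E')"
    by (rule ext_equiv_sym[OF H G baer_sum_is_ext[OF H G E] F])
  then have "ext_equiv H (baer_sum H G E E') D \<longleftrightarrow> ext_equiv H F D" for D :: "('h, 'g) small_ext"
    using ext_equiv_trans[OF F(2), of D] ext_equiv_trans[of H F "baer_sum H G E E'" D] by blast
  then show ?thesis unfolding Ext_mult_class[OF H G E] by (simp add: ext_class_def)
qed

text \<open>The isomorphism is the inverse of the pull-back along \<open>j\<close>. It is additive because the pull-back is
  additive and injective: the pull-back of a Baer sum over \<open>C\<close> is the Baer sum of the pull-backs, and
  only one class over \<open>C\<close> has this pull-back.\<close>
lemma Ext_iso_of_pullback:
  fixes H :: "'h top_group" and G :: "'g top_group" and C :: "'c top_group"
  assumes H: "top_ab_group H" and G: "top_ab_group G" and C: "top_ab_group C" and j: "j \<in> cont_hom G C"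
    and inj: "\<And>(E :: ('h, 'c) small_ext) (E' :: ('h, 'c) small_ext). is_ext H C E \<Longrightarrow> is_ext H C E' \<Longrightarrow>
      ext_equiv H (pullback_ext G j E) (pullback_ext G j E') \<Longrightarrow> ext_equiv H E E'"
    and sur: "\<And>E :: ('h, 'g) small_ext. is_ext H G E \<Longrightarrow>
      \<exists>E' :: ('h, 'c) small_ext. is_ext H C E' \<and> ext_equiv H (pullback_ext G j E') E"
  shows "Ext G H \<cong> Ext C H"
proof -
  define \<Phi> :: "('h, 'g) small_ext set \<Rightarrow> ('h, 'c) small_ext set" where
    "\<Phi> A = {E'. is_ext H C E' \<and> (\<exists>E\<in>A. ext_equiv H (pullback_ext G j E') E)}" for A
  note P = pullback_is_ext[OF H C _ G j]
  have cls: "\<Phi> (ext_class H G E) = ext_class H C E'"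
    if E: "is_ext H G E" and E': "is_ext H C E'" and eq: "ext_equiv H (pullback_ext G j E') E"
    for E :: "('h, 'g) small_ext" and E' :: "('h, 'c) small_ext"
  proof -
    have "(\<exists>D :: ('h, 'g) small_ext. is_ext H G D \<and> ext_equiv H E D \<and> ext_equiv H (pullback_ext G j F) D) \<longleftrightarrow> ext_equiv H E' F"
      if F: "is_ext H C F" for F :: "('h, 'c) small_ext"
    proof
      assume "\<exists>D :: ('h, 'g) small_ext. is_ext H G D \<and> ext_equiv H E D \<and> ext_equiv H (pullback_ext G j F) D"
      then obtain D :: "('h, 'g) small_ext" where D: "is_ext H G D" "ext_equiv H E D" "ext_equiv H (pullback_ext G j F) D" by blast
      have "ext_equiv H D (pullback_ext G j F)" by (rule ext_equiv_sym[OF H G P[OF F] D(1,3)])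
      then have "ext_equiv H (pullback_ext G j E') (pullback_ext G j F)"
        using ext_equiv_trans[OF eq ext_equiv_trans[OF D(2)]] by blast
      then show "ext_equiv H E' F" using inj[OF E' F] by blast
    next
      assume "ext_equiv H E' F"
      then have "ext_equiv H F E'" by (rule ext_equiv_sym[OF H C E' F])
      then have "ext_equiv H (pullback_ext G j F) E"
        using ext_equiv_trans[OF pullback_equiv_cong[OF H C G j F] eq] by blast
      then show "\<exists>D :: ('h, 'g) small_ext. is_ext H G D \<and> ext_equiv H E D \<and> ext_equiv H (pullback_ext G j F) D"
        using E ext_equiv_refl[OF E] by blast
    qed
    then show ?thesis by (auto simp: \<Phi>_def ext_class_def)
  qed
  have "\<Phi> \<in> hom (Ext G H) (Ext C H)"
  proof (rule homI)
    show "\<Phi> A \<in> carrier (Ext C H)" if "A \<in> carrier (Ext G H)" for A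
    proof -
      obtain E :: "('h, 'g) small_ext" where E: "is_ext H G E" "A = ext_class H G E" using \<open>A \<in> carrier (Ext G H)\<close> by (auto simp: carrier_Ext)
      then show ?thesis using sur[OF E(1)] cls[OF E(1)] by (auto simp: carrier_Ext)
    qed
    fix A B assume AB: "A \<in> carrier (Ext G H)" "B \<in> carrier (Ext G H)"
    obtain E1 :: "('h, 'g) small_ext" where E1: "is_ext H G E1" "A = ext_class H G E1" using AB(1) by (auto simp: carrier_Ext)
    obtain E2 :: "('h, 'g) small_ext" where E2: "is_ext H G E2" "B = ext_class H G E2" using AB(2) by (auto simp: carrier_Ext)
    obtain F1 :: "('h, 'c) small_ext" where F1: "is_ext H C F1" "ext_equiv H (pullback_ext G j F1) E1" using sur[OF E1(1)] by blast
    obtain F2 :: "('h, 'c) small_ext" where F2: "is_ext H C F2" "ext_equiv H (pullback_ext G j F2) E2" using sur[OF E2(1)] by blast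
    obtain F :: "('h, 'c) small_ext" where F: "is_ext H C F" "ext_equiv H (baer_sum H C F1 F2) F"
      using ext_has_small_representative[OF H C baer_sum_is_ext[OF H C F1(1) F2(1)]] by blast
    obtain E :: "('h, 'g) small_ext" where E: "is_ext H G E" "ext_equiv H (pullback_ext G j F) E"
      using ext_has_small_representative[OF H G P[OF F(1)]] by blast
    have s: "ext_equiv H (baer_sum H G E1 E2) E"
      by (rule baer_sum_equiv_cong[OF H G P[OF F1(1)] P[OF F2(1)] P[OF F(1)] E1(1) E2(1) E(1) F1(2) F2(2) E(2)
            baer_sum_pullback[OF H C G j F1(1) F2(1) F(1) F(2)]])
    have "A \<otimes>\<^bsub>Ext G H\<^esub> B = ext_class H G E"
      unfolding E1(2) E2(2) by (rule Ext_mult_class_eq[OF H G E1(1) E2(1) E(1) s])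
    moreover have "\<Phi> A \<otimes>\<^bsub>Ext C H\<^esub> \<Phi> B = ext_class H C F"
      unfolding E1(2) E2(2) cls[OF E1(1) F1] cls[OF E2(1) F2]
      by (rule Ext_mult_class_eq[OF H C F1(1) F2(1) F])
    ultimately show "\<Phi> (A \<otimes>\<^bsub>Ext G H\<^esub> B) = \<Phi> A \<otimes>\<^bsub>Ext C H\<^esub> \<Phi> B"
      using cls[OF E(1) F(1) E(2)] by simp
  qed
  moreover have "bij_betw \<Phi> (carrier (Ext G H)) (carrier (Ext C H))"
    unfolding bij_betw_def
  proof
    show "inj_on \<Phi> (carrier (Ext G H))"
    proof (rule inj_onI)
      fix A B assume AB: "A \<in> carrier (Ext G H)" "B \<in> carrier (Ext G H)" "\<Phi> A = \<Phi> B"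
      obtain E1 :: "('h, 'g) small_ext" where E1: "is_ext H G E1" "A = ext_class H G E1" using AB(1) by (auto simp: carrier_Ext)
      obtain E2 :: "('h, 'g) small_ext" where E2: "is_ext H G E2" "B = ext_class H G E2" using AB(2) by (auto simp: carrier_Ext)
      obtain F1 :: "('h, 'c) small_ext" where F1: "is_ext H C F1" "ext_equiv H (pullback_ext G j F1) E1" using sur[OF E1(1)] by blast
      obtain F2 :: "('h, 'c) small_ext" where F2: "is_ext H C F2" "ext_equiv H (pullback_ext G j F2) E2" using sur[OF E2(1)] by blast
      have "ext_class H C F1 = ext_class H C F2"
        using AB(3) unfolding E1(2) E2(2) cls[OF E1(1) F1] cls[OF E2(1) F2] .
      then have "ext_equiv H F1 F2" by (simp add: ext_class_eq_iff[OF H C F1(1) F2(1)])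
      then have "ext_equiv H (pullback_ext G j F1) (pullback_ext G j F2)"
        by (rule pullback_equiv_cong[OF H C G j F1(1)])
      then have "ext_equiv H (pullback_ext G j F1) E2" using ext_equiv_trans F2(2) by blast
      moreover have "ext_equiv H E1 (pullback_ext G j F1)"
        by (rule ext_equiv_sym[OF H G P[OF F1(1)] E1(1) F1(2)])
      ultimately have "ext_equiv H E1 E2" using ext_equiv_trans by blast
      then show "A = B" by (simp add: E1(2) E2(2) ext_class_eq_iff[OF H G E1(1) E2(1)])
    qed
    show "\<Phi> ` carrier (Ext G H) = carrier (Ext C H)"
    proof
      show "\<Phi> ` carrier (Ext G H) \<subseteq> carrier (Ext C H)"
        using \<open>\<Phi> \<in> hom (Ext G H) (Ext C H)\<close> by (auto simp: hom_def)
      show "carrier (Ext C H) \<subseteq> \<Phi> ` carrier (Ext G H)"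
      proof
        fix B assume "B \<in> carrier (Ext C H)"
        then obtain F :: "('h, 'c) small_ext" where F: "is_ext H C F" "B = ext_class H C F" by (auto simp: carrier_Ext)
        obtain E :: "('h, 'g) small_ext" where E: "is_ext H G E" "ext_equiv H (pullback_ext G j F) E"
          using ext_has_small_representative[OF H G P[OF F(1)]] by blast
        have "B = \<Phi> (ext_class H G E)" using cls[OF E(1) F(1) E(2)] F(2) by simp
        then show "B \<in> \<Phi> ` carrier (Ext G H)" using E(1) by (auto simp: carrier_Ext)
      qed
    qed
  qed
  ultimately show ?thesis by (auto simp: is_iso_def iso_def)
qed

section \<open>Cauchy filters, dense subgroups and complete groups\<close>

context topological_ab_group
begin

lemma cauchy_filter_on_iff:
  "cauchy_filter_on X F \<longleftrightarrow> F \<noteq> bot \<and> eventually (\<lambda>x. x \<in> carrier X) F \<and>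
    (\<forall>U. nb X U \<longrightarrow> (\<exists>A. A \<subseteq> carrier X \<and> eventually (\<lambda>x. x \<in> A) F \<and> (\<forall>x\<in>A. \<forall>y\<in>A. x \<otimes> inv y \<in> U)))"
    (is "?l \<longleftrightarrow> ?r")
proof
  assume l: ?l
  then have c: "eventually (\<lambda>x. x \<in> carrier X) F" by (simp add: cauchy_filter_on_def le_principal)
  have "\<exists>A. A \<subseteq> carrier X \<and> eventually (\<lambda>x. x \<in> A) F \<and> (\<forall>x\<in>A. \<forall>y\<in>A. x \<otimes> inv y \<in> U)" if U: "nb X U" for U
  proof -
    have "eventually (\<lambda>(x, y). x \<otimes> inv y \<in> U) (F \<times>\<^sub>F F)" using l U by (auto simp: cauchy_filter_on_def nb_def)
    then obtain Q where "eventually Q F" "\<forall>x y. Q x \<longrightarrow> Q y \<longrightarrow> x \<otimes> inv y \<in> U"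
      unfolding eventually_prod_same by auto
    then show ?thesis using c by (intro exI[of _ "{x \<in> carrier X. Q x}"]) (auto simp: eventually_conj_iff)
  qed
  then show ?r using l c by (auto simp: cauchy_filter_on_def)
next
  assume r: ?r
  have "eventually (\<lambda>(x, y). x \<otimes> inv y \<in> U) (F \<times>\<^sub>F F)" if U: "openin (topo X) U" "\<one> \<in> U" for U
  proof -
    obtain A where A: "eventually (\<lambda>x. x \<in> A) F" "\<forall>x\<in>A. \<forall>y\<in>A. x \<otimes> inv y \<in> U"
      using r U by (auto simp: nb_def)
    then show ?thesis unfolding eventually_prod_same by (intro exI[of _ "\<lambda>x. x \<in> A"]) auto
  qed
  then show ?l using r by (auto simp: cauchy_filter_on_def le_principal)
qed

lemma cauchy_small:
  assumes "cauchy_filter_on X F" "nb X U"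
  obtains A where "A \<subseteq> carrier X" "eventually (\<lambda>x. x \<in> A) F" "\<forall>x\<in>A. \<forall>y\<in>A. x \<otimes> inv y \<in> U"
  using assms unfolding cauchy_filter_on_iff by blast

lemma limitin_iff:
  "limitin (topo X) f l F \<longleftrightarrow> l \<in> carrier X \<and>
    (\<forall>U. nb X U \<longrightarrow> eventually (\<lambda>x. f x \<in> carrier X \<and> f x \<otimes> inv l \<in> U) F)"
    (is "?l \<longleftrightarrow> ?r")
proof
  assume l: ?l
  then have lc: "l \<in> carrier X" by (simp add: limitin_def)
  have "eventually (\<lambda>x. f x \<in> carrier X \<and> f x \<otimes> inv l \<in> U) F" if U: "nb X U" for U
    using limitinD[OF l nb_at[OF U lc]] by eventually_elim (auto simp: m_comm lc)
  then show ?r using lc by blast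
next
  assume r: ?r
  have "eventually (\<lambda>x. f x \<in> V) F" if V: "openin (topo X) V" "l \<in> V" for V
  proof -
    have "eventually (\<lambda>x. f x \<in> carrier X \<and> f x \<otimes> inv l \<in> {u \<in> carrier X. l \<otimes> u \<in> V}) F"
      using r nb_translate[OF V] by blast
    then show ?thesis
    proof eventually_elim
      case (elim x)
      then have "l \<otimes> (inv l \<otimes> f x) \<in> V" using r by (auto simp: m_comm)
      then show ?case using r elim by (simp add: mult_inv_cancel)
    qed
  qed
  then show ?l using r by (simp add: limitin_def)
qed

lemma limit_unique:
  "limitin (topo X) f l F \<Longrightarrow> limitin (topo X) f l' F \<Longrightarrow> F \<noteq> bot \<Longrightarrow> l = l'"
  using limitin_Hausdorff_unique[OF _ _ _ Hausdorff] by (auto simp: trivial_limit_def)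

definition filter_mult :: "'a filter \<Rightarrow> 'a filter \<Rightarrow> 'a filter" where
  "filter_mult F K = filtermap (\<lambda>(x, y). x \<otimes> y) (F \<times>\<^sub>F K)"

lemma eventually_filter_mult:
  "eventually P (filter_mult F K) \<longleftrightarrow>
    (\<exists>A B. eventually (\<lambda>x. x \<in> A) F \<and> eventually (\<lambda>x. x \<in> B) K \<and> (\<forall>a\<in>A. \<forall>b\<in>B. P (a \<otimes> b)))"
  (is "_ \<longleftrightarrow> ?r")
proof -
  have "eventually P (filter_mult F K) \<longleftrightarrow>
      (\<exists>Q R. eventually Q F \<and> eventually R K \<and> (\<forall>x y. Q x \<longrightarrow> R y \<longrightarrow> P (x \<otimes> y)))"
    unfolding filter_mult_def eventually_filtermap eventually_prod_filter by simp
  also have "\<dots> \<longleftrightarrow> ?r" (is "?l \<longleftrightarrow> _")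
  proof (intro iffI; elim exE conjE)
    fix Q R assume "eventually Q F" "eventually R K" "\<forall>x y. Q x \<longrightarrow> R y \<longrightarrow> P (x \<otimes> y)"
    then show ?r by (intro exI[of _ "Collect Q"] exI[of _ "Collect R"]) simp
  next
    fix A B assume "eventually (\<lambda>x. x \<in> A) F" "eventually (\<lambda>x. x \<in> B) K" "\<forall>a\<in>A. \<forall>b\<in>B. P (a \<otimes> b)"
    then show ?l by (intro exI[of _ "\<lambda>x. x \<in> A"] exI[of _ "\<lambda>x. x \<in> B"]) simp
  qed
  finally show ?thesis .
qed

lemma eventually_filter_multI:
  assumes "eventually (\<lambda>x. x \<in> A) F" "eventually (\<lambda>x. x \<in> B) K" "\<And>a b. a \<in> A \<Longrightarrow> b \<in> B \<Longrightarrow> P (a \<otimes> b)"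
  shows "eventually P (filter_mult F K)"
  unfolding eventually_filter_mult by (rule exI[of _ A], rule exI[of _ B]) (use assms in blast)

text \<open>The filter generated by the sets \<open>A U\<close>, for members \<open>A\<close> of \<open>F\<close> and neighbourhoods \<open>U\<close> of the
  identity. It has the same limits as \<open>F\<close>. Its use is twofold: its members meet any subgroup that \<open>F\<close>
  approaches, even if \<open>F\<close> itself avoids that subgroup, and if \<open>F\<close> is Cauchy, it is the
  coarsest Cauchy filter equivalent to \<open>F\<close>.\<close>
definition round_filter :: "'a filter \<Rightarrow> 'a filter" where
  "round_filter F = filter_mult F (nhdsin (topo X) \<one>)"

lemma eventually_round_filter:
  "eventually P (round_filter F) \<longleftrightarrow>
    (\<exists>A U. eventually (\<lambda>x. x \<in> A) F \<and> nb X U \<and> (\<forall>x\<in>A. \<forall>u\<in>U. P (x \<otimes> u)))"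
  (is "?l \<longleftrightarrow> ?r")
proof -
  have "?l \<longleftrightarrow> (\<exists>A B. eventually (\<lambda>x. x \<in> A) F \<and> (\<exists>U. nb X U \<and> U \<subseteq> B) \<and> (\<forall>a\<in>A. \<forall>b\<in>B. P (a \<otimes> b)))"
    unfolding round_filter_def eventually_filter_mult by (simp add: eventually_nhdsin nb_def subset_eq conj_assoc)
  also have "\<dots> \<longleftrightarrow> ?r" by (meson subset_refl subset_iff)
  finally show ?thesis .
qed

lemma cauchy_translate:
  assumes F: "cauchy_filter_on X F" and c: "c \<in> carrier X"
  shows "cauchy_filter_on X (filtermap (\<lambda>x. x \<otimes> c) F)"
proof -
  note F' = F[unfolded cauchy_filter_on_iff]
  have "\<exists>A. A \<subseteq> carrier X \<and> eventually (\<lambda>x. x \<in> A) (filtermap (\<lambda>x. x \<otimes> c) F) \<and> (\<forall>x\<in>A. \<forall>y\<in>A. x \<otimes> inv y \<in> U)"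
    if U: "nb X U" for U
  proof -
    obtain A where A: "A \<subseteq> carrier X" "eventually (\<lambda>x. x \<in> A) F" "\<forall>x\<in>A. \<forall>y\<in>A. x \<otimes> inv y \<in> U"
      using cauchy_small[OF F U] by blast
    have "(x \<otimes> c) \<otimes> inv (y \<otimes> c) \<in> U" if xy: "x \<in> A" "y \<in> A" for x y
    proof -
      have "(x \<otimes> c) \<otimes> inv (y \<otimes> c) = x \<otimes> inv y" using div_mult_div[of x c y c] xy A(1) c by auto
      then show ?thesis using A(3) xy by simp
    qed
    then show ?thesis
      using A c by (intro exI[of _ "(\<lambda>x. x \<otimes> c) ` A"])
        (auto simp: eventually_filtermap elim: eventually_mono)
  qed
  moreover have "eventually (\<lambda>x. x \<in> carrier X) (filtermap (\<lambda>x. x \<otimes> c) F)"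
    using F' c by (auto simp: eventually_filtermap elim: eventually_mono)
  ultimately show ?thesis using F' by (simp add: cauchy_filter_on_iff filtermap_bot_iff)
qed

end

lemma cauchy_filtermap:
  assumes X: "top_ab_group X" and Y: "top_ab_group Y" and f: "f \<in> cont_hom X Y" and F: "cauchy_filter_on X F"
  shows "cauchy_filter_on Y (filtermap f F)"
proof -
  interpret X: topological_ab_group X by unfold_locales (rule X)
  interpret Y: topological_ab_group Y by unfold_locales (rule Y)
  note F' = F[unfolded X.cauchy_filter_on_iff]
  note fh [simp] = cont_homD(1-4)[OF X Y f]
  have "\<exists>A. A \<subseteq> carrier Y \<and> eventually (\<lambda>x. x \<in> A) (filtermap f F) \<and> (\<forall>x\<in>A. \<forall>y\<in>A. x \<otimes>\<^bsub>Y\<^esub> inv\<^bsub>Y\<^esub> y \<in> U)"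
    if U: "nb Y U" for U
  proof -
    obtain A where A: "A \<subseteq> carrier X" "eventually (\<lambda>x. x \<in> A) F"
      "\<forall>x\<in>A. \<forall>y\<in>A. x \<otimes>\<^bsub>X\<^esub> inv\<^bsub>X\<^esub> y \<in> {x \<in> carrier X. f x \<in> U}"
      using X.cauchy_small[OF F cont_homD(5)[OF X Y f U]] by blast
    have "f x \<otimes>\<^bsub>Y\<^esub> inv\<^bsub>Y\<^esub> f y \<in> U" if xy: "x \<in> A" "y \<in> A" for x y
    proof -
      have "f (x \<otimes>\<^bsub>X\<^esub> inv\<^bsub>X\<^esub> y) \<in> U" using A(3) xy by blast
      moreover have "x \<in> carrier X" "y \<in> carrier X" using xy A(1) by auto
      ultimately show ?thesis by simp
    qed
    then show ?thesis
      using A(1,2) fh(1) by (intro exI[of _ "f ` A"]) (auto simp: eventually_filtermap elim: eventually_mono)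
  qed
  moreover have "eventually (\<lambda>x. x \<in> carrier Y) (filtermap f F)"
    using F' by (auto simp: eventually_filtermap elim: eventually_mono)
  ultimately show ?thesis using F' by (simp add: Y.cauchy_filter_on_iff filtermap_bot_iff)
qed

locale dense_embedding = D: topological_ab_group D + X: topological_ab_group X
  for D :: "'d top_group" and X :: "'x top_group" +
  fixes e :: "'d \<Rightarrow> 'x"
  assumes e_hom: "e \<in> hom D X" and emb: "embedding_map (topo D) (topo X) e"
    and dense: "topo X closure_of (e ` carrier D) = carrier X"
begin

lemma e_cont: "e \<in> cont_hom D X"
proof -
  have "continuous_map (topo D) (subtopology (topo X) (e ` carrier D)) e"
    using homeomorphic_imp_continuous_map emb by (auto simp: embedding_map_def)
  then show ?thesis using e_hom by (simp add: cont_hom_def continuous_map_in_subtopology)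
qed

lemmas e_simps [simp] = cont_homD(1-4)[OF D.top_ab_group X.top_ab_group e_cont]

lemma e_inj: "inj_on e (carrier D)"
  using homeomorphic_imp_injective_map[of "topo D" _ e] emb by (auto simp: embedding_map_def)

lemma nb_extend:
  assumes U: "nb D U"
  shows "\<exists>V. nb X V \<and> (\<forall>d\<in>carrier D. e d \<in> V \<longrightarrow> d \<in> U)"
proof -
  have "open_map (topo D) (subtopology (topo X) (e ` carrier D)) e"
    using homeomorphic_imp_open_map emb by (auto simp: embedding_map_def)
  then obtain V where V: "nb X V" "V \<inter> e ` carrier D \<subseteq> e ` U"
    using hom_open_onto_imageD[OF D.top_ab_group X.top_ab_group e_hom _ U] by blast
  have "d \<in> U" if d: "d \<in> carrier D" "e d \<in> V" for d
  proof -
    obtain u where "u \<in> U" "e d = e u" using V(2) d by blast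
    then show ?thesis using e_inj d D.nb_carrier[OF U] by (auto simp: inj_on_def)
  qed
  then show ?thesis using V(1) by blast
qed

lemma dense_meets:
  assumes "openin (topo X) V" "x \<in> V"
  shows "\<exists>d\<in>carrier D. e d \<in> V"
proof -
  have "x \<in> topo X closure_of (e ` carrier D)" using dense assms X.openin_carrier by blast
  then show ?thesis using assms unfolding in_closure_of by blast
qed

lemma cauchy_of_limit:
  assumes lim: "limitin (topo X) e x F" and F: "F \<noteq> bot" "eventually (\<lambda>d. d \<in> carrier D) F"
  shows "cauchy_filter_on D F"
  unfolding D.cauchy_filter_on_iff
proof (intro conjI allI impI F)
  fix U assume U: "nb D U"
  have xc: "x \<in> carrier X" using lim by (simp add: limitin_def)
  obtain V where V: "nb X V" "\<forall>d\<in>carrier D. e d \<in> V \<longrightarrow> d \<in> U" using nb_extend[OF U] by blast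
  obtain W where W: "nb X W" "\<forall>x\<in>W. inv\<^bsub>X\<^esub> x \<in> W" "\<forall>x\<in>W. \<forall>y\<in>W. x \<otimes>\<^bsub>X\<^esub> y \<in> V"
    using X.nb_sym[OF V(1)] by blast
  let ?A = "{d \<in> carrier D. e d \<otimes>\<^bsub>X\<^esub> inv\<^bsub>X\<^esub> x \<in> W}"
  have "eventually (\<lambda>d. d \<in> ?A) F"
    using lim[unfolded X.limitin_iff] W(1) F(2) by (auto elim: eventually_elim2)
  moreover have "c \<otimes>\<^bsub>D\<^esub> inv\<^bsub>D\<^esub> d \<in> U" if cd: "c \<in> ?A" "d \<in> ?A" for c d
  proof -
    have "(e c \<otimes>\<^bsub>X\<^esub> inv\<^bsub>X\<^esub> x) \<otimes>\<^bsub>X\<^esub> inv\<^bsub>X\<^esub> (e d \<otimes>\<^bsub>X\<^esub> inv\<^bsub>X\<^esub> x) \<in> V" using W cd by blast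
    moreover have "(e c \<otimes>\<^bsub>X\<^esub> inv\<^bsub>X\<^esub> x) \<otimes>\<^bsub>X\<^esub> inv\<^bsub>X\<^esub> (e d \<otimes>\<^bsub>X\<^esub> inv\<^bsub>X\<^esub> x) = e (c \<otimes>\<^bsub>D\<^esub> inv\<^bsub>D\<^esub> d)"
      using X.div_mult_div[of "e c" "inv\<^bsub>X\<^esub> x" "e d" "inv\<^bsub>X\<^esub> x"] cd xc by simp
    ultimately have "e (c \<otimes>\<^bsub>D\<^esub> inv\<^bsub>D\<^esub> d) \<in> V" by metis
    then show ?thesis using V(2) cd by auto
  qed
  ultimately show "\<exists>A. A \<subseteq> carrier D \<and> eventually (\<lambda>d. d \<in> A) F \<and> (\<forall>c\<in>A. \<forall>d\<in>A. c \<otimes>\<^bsub>D\<^esub> inv\<^bsub>D\<^esub> d \<in> U)"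
    by (intro exI[of _ ?A]) auto
qed

text \<open>The traces on \<open>D\<close> of the neighbourhoods of \<open>x\<close>: a Cauchy filter on \<open>D\<close> that converges to \<open>x\<close>.\<close>
definition trace_filter :: "'x \<Rightarrow> 'd filter" where
  "trace_filter x = inf (filtercomap e (nhdsin (topo X) x)) (principal (carrier D))"

lemma eventually_trace_filter:
  assumes "x \<in> carrier X"
  shows "eventually P (trace_filter x) \<longleftrightarrow>
    (\<exists>V. openin (topo X) V \<and> x \<in> V \<and> (\<forall>d\<in>carrier D. e d \<in> V \<longrightarrow> P d))"
proof -
  have "eventually P (trace_filter x) \<longleftrightarrow>
      (\<exists>Q. (\<exists>V. openin (topo X) V \<and> x \<in> V \<and> (\<forall>y\<in>V. Q y)) \<and> (\<forall>d. Q (e d) \<longrightarrow> d \<in> carrier D \<longrightarrow> P d))"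
    using assms by (simp add: trace_filter_def eventually_inf_principal eventually_filtercomap eventually_nhdsin)
  also have "\<dots> \<longleftrightarrow> (\<exists>V. openin (topo X) V \<and> x \<in> V \<and> (\<forall>d\<in>carrier D. e d \<in> V \<longrightarrow> P d))"
    (is "?l \<longleftrightarrow> ?r")
  proof
    assume ?l then show ?r by blast
  next
    assume ?r
    then obtain V where "openin (topo X) V" "x \<in> V" "\<forall>d\<in>carrier D. e d \<in> V \<longrightarrow> P d" by blast
    then show ?l by (intro exI[of _ "\<lambda>y. y \<in> V"]) auto
  qed
  finally show ?thesis .
qed

lemma trace_filter:
  assumes x: "x \<in> carrier X"
  shows "trace_filter x \<noteq> bot" "eventually (\<lambda>d. d \<in> carrier D) (trace_filter x)"
    "limitin (topo X) e x (trace_filter x)" "cauchy_filter_on D (trace_filter x)"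
proof -
  show 1: "trace_filter x \<noteq> bot"
  proof
    assume "trace_filter x = bot"
    then obtain V where "openin (topo X) V" "x \<in> V" "\<forall>d\<in>carrier D. e d \<notin> V"
      using eventually_trace_filter[OF x, of "\<lambda>_. False"] by auto
    then show False using dense_meets by blast
  qed
  show 2: "eventually (\<lambda>d. d \<in> carrier D) (trace_filter x)"
    unfolding eventually_trace_filter[OF x] using x openin_topspace[of "topo X"]
    by (intro exI[of _ "carrier X"]) simp
  show 3: "limitin (topo X) e x (trace_filter x)"
    unfolding limitin_def using x eventually_trace_filter[OF x] by auto
  show "cauchy_filter_on D (trace_filter x)" by (rule cauchy_of_limit[OF 3 1 2])
qed

text \<open>The extension sends \<open>x\<close> to the limit of \<open>f\<close> along the trace filter of \<open>x\<close>. Multiplicativity and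
  continuity are inherited by comparing \<open>g x\<close> with \<open>f d\<close> for points \<open>d\<close> of \<open>D\<close> close to \<open>x\<close>.\<close>
lemma extend_to_complete:
  assumes Y: "top_ab_group Y" and comp: "complete_top_group Y" and f: "f \<in> cont_hom D Y"
  shows "\<exists>g\<in>cont_hom X Y. \<forall>d\<in>carrier D. g (e d) = f d"
proof -
  interpret Y: topological_ab_group Y by unfold_locales (rule Y)
  note fh [simp] = cont_homD(1-4)[OF D.top_ab_group Y f]
  have "\<exists>y. limitin (topo Y) f y (trace_filter x)" if x: "x \<in> carrier X" for x
  proof -
    obtain y where "limitin (topo Y) (\<lambda>y. y) y (filtermap f (trace_filter x))"
      using comp cauchy_filtermap[OF D.top_ab_group Y f trace_filter(4)[OF x]]
      by (auto simp: complete_top_group_def)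
    then show ?thesis by (auto simp: limitin_def eventually_filtermap)
  qed
  then obtain g where g: "\<And>x. x \<in> carrier X \<Longrightarrow> limitin (topo Y) f (g x) (trace_filter x)" by metis
  have gc [simp]: "g x \<in> carrier Y" if "x \<in> carrier X" for x using g[OF that] by (simp add: limitin_def)
  have near: "\<exists>d\<in>carrier D. e d \<in> O' \<and> f d \<otimes>\<^bsub>Y\<^esub> inv\<^bsub>Y\<^esub> g x \<in> V"
    if V: "nb Y V" and O': "openin (topo X) O'" "x \<in> O'" for x V O'
  proof -
    have x: "x \<in> carrier X" using O' X.openin_carrier by blast
    have "eventually (\<lambda>d. f d \<in> carrier Y \<and> f d \<otimes>\<^bsub>Y\<^esub> inv\<^bsub>Y\<^esub> g x \<in> V) (trace_filter x)"
      using g[OF x] V unfolding Y.limitin_iff by blast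
    moreover have "eventually (\<lambda>d. e d \<in> O') (trace_filter x)"
      using trace_filter(3)[OF x] O' by (simp add: limitin_def)
    ultimately have "eventually (\<lambda>d. d \<in> carrier D \<and> e d \<in> O' \<and> f d \<otimes>\<^bsub>Y\<^esub> inv\<^bsub>Y\<^esub> g x \<in> V) (trace_filter x)"
      using trace_filter(2)[OF x] by eventually_elim auto
    from eventually_happens'[OF trace_filter(1)[OF x] this] show ?thesis by blast
  qed
  have hom: "g \<in> hom X Y"
  proof (rule homI)
    fix x y assume xy: "x \<in> carrier X" "y \<in> carrier X"
    have "g (x \<otimes>\<^bsub>X\<^esub> y) \<otimes>\<^bsub>Y\<^esub> inv\<^bsub>Y\<^esub> (g x \<otimes>\<^bsub>Y\<^esub> g y) = \<one>\<^bsub>Y\<^esub>"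
    proof (rule Y.eq_oneI)
      fix U assume U: "nb Y U"
      obtain V where V: "nb Y V" "\<forall>x\<in>V. inv\<^bsub>Y\<^esub> x \<in> V"
        "\<forall>x\<in>V. \<forall>y\<in>V. \<forall>z\<in>V. \<forall>w\<in>V. (x \<otimes>\<^bsub>Y\<^esub> y) \<otimes>\<^bsub>Y\<^esub> (z \<otimes>\<^bsub>Y\<^esub> w) \<in> U"
        using Y.nb_sym4[OF U] by blast
      have "eventually (\<lambda>d. f d \<in> carrier Y \<and> f d \<otimes>\<^bsub>Y\<^esub> inv\<^bsub>Y\<^esub> g (x \<otimes>\<^bsub>X\<^esub> y) \<in> V) (trace_filter (x \<otimes>\<^bsub>X\<^esub> y))"
        using g[of "x \<otimes>\<^bsub>X\<^esub> y"] V(1) xy unfolding Y.limitin_iff by simp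
      then obtain O' where O': "openin (topo X) O'" "x \<otimes>\<^bsub>X\<^esub> y \<in> O'"
        "\<forall>d\<in>carrier D. e d \<in> O' \<longrightarrow> f d \<otimes>\<^bsub>Y\<^esub> inv\<^bsub>Y\<^esub> g (x \<otimes>\<^bsub>X\<^esub> y) \<in> V"
        using eventually_trace_filter[of "x \<otimes>\<^bsub>X\<^esub> y"] xy by auto
      obtain W where W: "nb X W" "\<forall>u\<in>W. \<forall>v\<in>W. u \<otimes>\<^bsub>X\<^esub> v \<in> {w \<in> carrier X. (x \<otimes>\<^bsub>X\<^esub> y) \<otimes>\<^bsub>X\<^esub> w \<in> O'}"
        using X.nb_sym[OF X.nb_translate[OF O'(1,2)]] by blast
      obtain c where c: "c \<in> carrier D" "inv\<^bsub>X\<^esub> x \<otimes>\<^bsub>X\<^esub> e c \<in> W" "f c \<otimes>\<^bsub>Y\<^esub> inv\<^bsub>Y\<^esub> g x \<in> V"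
        using near[OF V(1) X.nb_at[OF W(1) xy(1)]] by blast
      obtain d where d: "d \<in> carrier D" "inv\<^bsub>X\<^esub> y \<otimes>\<^bsub>X\<^esub> e d \<in> W" "f d \<otimes>\<^bsub>Y\<^esub> inv\<^bsub>Y\<^esub> g y \<in> V"
        using near[OF V(1) X.nb_at[OF W(1) xy(2)]] by blast
      have "(x \<otimes>\<^bsub>X\<^esub> y) \<otimes>\<^bsub>X\<^esub> ((inv\<^bsub>X\<^esub> x \<otimes>\<^bsub>X\<^esub> e c) \<otimes>\<^bsub>X\<^esub> (inv\<^bsub>X\<^esub> y \<otimes>\<^bsub>X\<^esub> e d)) \<in> O'" using W(2) c(2) d(2) by blast
      moreover have "(x \<otimes>\<^bsub>X\<^esub> y) \<otimes>\<^bsub>X\<^esub> ((inv\<^bsub>X\<^esub> x \<otimes>\<^bsub>X\<^esub> e c) \<otimes>\<^bsub>X\<^esub> (inv\<^bsub>X\<^esub> y \<otimes>\<^bsub>X\<^esub> e d)) = e (c \<otimes>\<^bsub>D\<^esub> d)"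
        using X.mult_swap[of x y "inv\<^bsub>X\<^esub> x \<otimes>\<^bsub>X\<^esub> e c" "inv\<^bsub>X\<^esub> y \<otimes>\<^bsub>X\<^esub> e d"] xy c d by (simp add: X.mult_inv_cancel)
      ultimately have "e (c \<otimes>\<^bsub>D\<^esub> d) \<in> O'" by (simp only:)
      then have "f (c \<otimes>\<^bsub>D\<^esub> d) \<otimes>\<^bsub>Y\<^esub> inv\<^bsub>Y\<^esub> g (x \<otimes>\<^bsub>X\<^esub> y) \<in> V"
        using O'(3) D.m_closed[OF c(1) d(1)] by blast
      then have "inv\<^bsub>Y\<^esub> (f (c \<otimes>\<^bsub>D\<^esub> d) \<otimes>\<^bsub>Y\<^esub> inv\<^bsub>Y\<^esub> g (x \<otimes>\<^bsub>X\<^esub> y)) \<in> V" using V(2) by blast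
      then have "((f c \<otimes>\<^bsub>Y\<^esub> inv\<^bsub>Y\<^esub> g x) \<otimes>\<^bsub>Y\<^esub> (f d \<otimes>\<^bsub>Y\<^esub> inv\<^bsub>Y\<^esub> g y)) \<otimes>\<^bsub>Y\<^esub>
          (inv\<^bsub>Y\<^esub> (f (c \<otimes>\<^bsub>D\<^esub> d) \<otimes>\<^bsub>Y\<^esub> inv\<^bsub>Y\<^esub> g (x \<otimes>\<^bsub>X\<^esub> y)) \<otimes>\<^bsub>Y\<^esub> \<one>\<^bsub>Y\<^esub>) \<in> U"
        using V(3) c(3) d(3) Y.nb_one[OF V(1)] by blast
      moreover have "((f c \<otimes>\<^bsub>Y\<^esub> inv\<^bsub>Y\<^esub> g x) \<otimes>\<^bsub>Y\<^esub> (f d \<otimes>\<^bsub>Y\<^esub> inv\<^bsub>Y\<^esub> g y)) \<otimes>\<^bsub>Y\<^esub>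
          (inv\<^bsub>Y\<^esub> (f (c \<otimes>\<^bsub>D\<^esub> d) \<otimes>\<^bsub>Y\<^esub> inv\<^bsub>Y\<^esub> g (x \<otimes>\<^bsub>X\<^esub> y)) \<otimes>\<^bsub>Y\<^esub> \<one>\<^bsub>Y\<^esub>)
        = g (x \<otimes>\<^bsub>X\<^esub> y) \<otimes>\<^bsub>Y\<^esub> inv\<^bsub>Y\<^esub> (g x \<otimes>\<^bsub>Y\<^esub> g y)"
        using c(1) d(1) xy
          Y.div_mult_div[of "f c" "f d" "g x" "g y", symmetric]
          Y.mult_telescope[of "g (x \<otimes>\<^bsub>X\<^esub> y)" "f c \<otimes>\<^bsub>Y\<^esub> f d" "inv\<^bsub>Y\<^esub> (g x \<otimes>\<^bsub>Y\<^esub> g y)"]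
        by (simp add: Y.inv_mult_group Y.m_comm)
      ultimately show "g (x \<otimes>\<^bsub>X\<^esub> y) \<otimes>\<^bsub>Y\<^esub> inv\<^bsub>Y\<^esub> (g x \<otimes>\<^bsub>Y\<^esub> g y) \<in> U" by simp
    qed (use xy in simp)
    then show "g (x \<otimes>\<^bsub>X\<^esub> y) = g x \<otimes>\<^bsub>Y\<^esub> g y" using xy by (simp add: Y.div_eq_one)
  qed simp
  have "g \<in> cont_hom X Y"
  proof (rule hom_continuousI[OF X.top_ab_group Y hom])
    fix U assume U: "nb Y U"
    obtain V where V: "nb Y V" "\<forall>x\<in>V. inv\<^bsub>Y\<^esub> x \<in> V" "\<forall>x\<in>V. \<forall>y\<in>V. x \<otimes>\<^bsub>Y\<^esub> y \<in> U"
      using Y.nb_sym[OF U] by blast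
    obtain W where W: "nb X W" "\<forall>d\<in>carrier D. e d \<in> W \<longrightarrow> d \<in> {d \<in> carrier D. f d \<in> V}"
      using nb_extend[OF cont_homD(5)[OF D.top_ab_group Y f V(1)]] by blast
    have "g x \<in> U" if x: "x \<in> W" for x
    proof -
      have xc: "x \<in> carrier X" using X.nb_carrier[OF W(1)] x by blast
      obtain d where d: "d \<in> carrier D" "e d \<in> W" "f d \<otimes>\<^bsub>Y\<^esub> inv\<^bsub>Y\<^esub> g x \<in> V"
        using near[OF V(1) _ x] W(1) unfolding nb_def by blast
      then have "f d \<otimes>\<^bsub>Y\<^esub> inv\<^bsub>Y\<^esub> (f d \<otimes>\<^bsub>Y\<^esub> inv\<^bsub>Y\<^esub> g x) \<in> U" using V(2,3) W(2) by blast
      moreover have "f d \<otimes>\<^bsub>Y\<^esub> inv\<^bsub>Y\<^esub> (f d \<otimes>\<^bsub>Y\<^esub> inv\<^bsub>Y\<^esub> g x) = g x"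
        using d(1) xc by (simp add: Y.inv_mult Y.mult_inv_cancel)
      ultimately show ?thesis by simp
    qed
    then show "\<exists>V. nb X V \<and> (\<forall>x\<in>V. g x \<in> U)" using W(1) by blast
  qed
  moreover have "g (e d) = f d" if d: "d \<in> carrier D" for d
  proof (rule Y.limit_unique[OF g])
    show "limitin (topo Y) f (f d) (trace_filter (e d))"
      unfolding Y.limitin_iff
    proof (intro conjI allI impI)
      fix U assume U: "nb Y U"
      obtain W where W: "nb X W" "\<forall>c\<in>carrier D. e c \<in> W \<longrightarrow> c \<in> {d \<in> carrier D. f d \<in> U}"
        using nb_extend[OF cont_homD(5)[OF D.top_ab_group Y f U]] by blast
      have "f c \<otimes>\<^bsub>Y\<^esub> inv\<^bsub>Y\<^esub> f d \<in> U" if c: "c \<in> carrier D" "inv\<^bsub>X\<^esub> e d \<otimes>\<^bsub>X\<^esub> e c \<in> W" for c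
      proof -
        have "e (c \<otimes>\<^bsub>D\<^esub> inv\<^bsub>D\<^esub> d) \<in> W" using c d by (simp add: X.m_comm)
        then have "f (c \<otimes>\<^bsub>D\<^esub> inv\<^bsub>D\<^esub> d) \<in> U"
          using W(2) D.m_closed[OF c(1) D.inv_closed[OF d]] by blast
        then show ?thesis using c d by simp
      qed
      then show "eventually (\<lambda>c. f c \<in> carrier Y \<and> f c \<otimes>\<^bsub>Y\<^esub> inv\<^bsub>Y\<^esub> f d \<in> U) (trace_filter (e d))"
        using d X.nb_at[OF W(1), of "e d"] unfolding eventually_trace_filter[OF e_simps(1)[OF d]]
        by (intro exI[of _ "{y \<in> carrier X. inv\<^bsub>X\<^esub> e d \<otimes>\<^bsub>X\<^esub> y \<in> W}"]) auto
    qed (use d in simp)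
  qed (use d trace_filter in auto)
  ultimately show ?thesis by blast
qed

lemma eq_on_dense:
  assumes Y: "top_ab_group Y" and g: "g \<in> cont_hom X Y" "g' \<in> cont_hom X Y"
    and eq: "\<And>d. d \<in> carrier D \<Longrightarrow> g (e d) = g' (e d)" and x: "x \<in> carrier X"
  shows "g x = g' x"
proof -
  interpret Y: topological_ab_group Y by unfold_locales (rule Y)
  show ?thesis
    by (rule forall_in_closure_of_eq[of x "topo X" "e ` carrier D" "topo Y"])
      (use x dense g eq Y.Hausdorff in \<open>auto simp: cont_hom_def\<close>)
qed

end

lemma dense_embeddingI:
  assumes D: "top_ab_group D" and X: "top_ab_group X" and e: "e \<in> cont_hom D X"
    and emb: "\<And>U. nb D U \<Longrightarrow> \<exists>V. nb X V \<and> (\<forall>d\<in>carrier D. e d \<in> V \<longrightarrow> d \<in> U)"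
    and dense: "\<And>S x. openin (topo X) S \<Longrightarrow> x \<in> S \<Longrightarrow> \<exists>d\<in>carrier D. e d \<in> S"
  shows "dense_embedding D X e"
proof -
  interpret D: topological_ab_group D by unfold_locales (rule D)
  interpret X: topological_ab_group X by unfold_locales (rule X)
  note eh = cont_homD[OF D X e]
  have hom: "e \<in> hom D X" using e by (simp add: cont_hom_def)
  have inj: "inj_on e (carrier D)"
  proof (rule inj_onI)
    fix c d assume cd: "c \<in> carrier D" "d \<in> carrier D" "e c = e d"
    have "c \<otimes>\<^bsub>D\<^esub> inv\<^bsub>D\<^esub> d = \<one>\<^bsub>D\<^esub>"
    proof (rule D.eq_oneI)
      fix U assume U: "nb D U"
      obtain V where V: "nb X V" "\<forall>d\<in>carrier D. e d \<in> V \<longrightarrow> d \<in> U" using emb[OF U] by blast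
      have "e (c \<otimes>\<^bsub>D\<^esub> inv\<^bsub>D\<^esub> d) = \<one>\<^bsub>X\<^esub>" using cd eh(1,2,4) by simp
      then show "c \<otimes>\<^bsub>D\<^esub> inv\<^bsub>D\<^esub> d \<in> U" using V X.nb_one[OF V(1)] cd by simp
    qed (use cd in simp)
    then show "c = d" using cd by (simp add: D.div_eq_one)
  qed
  have "open_map (topo D) (subtopology (topo X) (e ` carrier D)) e"
  proof (rule hom_open_onto_imageI[OF D X hom])
    show "\<exists>V. nb X V \<and> V \<inter> e ` carrier D \<subseteq> e ` U" if "nb D U" for U
      using emb[OF \<open>nb D U\<close>] by blast
  qed
  moreover have "continuous_map (topo D) (subtopology (topo X) (e ` carrier D)) e"
    using e by (auto simp: cont_hom_def continuous_map_in_subtopology)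
  ultimately have "embedding_map (topo D) (topo X) e"
    unfolding embedding_map_def using inj eh(1)
    by (intro bijective_open_imp_homeomorphic_map) auto
  moreover have "topo X closure_of (e ` carrier D) = carrier X"
  proof (rule subset_antisym)
    show "topo X closure_of (e ` carrier D) \<subseteq> carrier X"
      using closure_of_subset_topspace[of "topo X"] X.topspace_eq by blast
    show "carrier X \<subseteq> topo X closure_of (e ` carrier D)"
      unfolding in_closure_of subset_iff X.topspace_eq using dense by blast
  qed
  ultimately show ?thesis using hom by unfold_locales auto
qed

context extension
begin

text \<open>A Cauchy filter whose image in \<open>G\<close> converges to the identity comes arbitrarily close to the kernel
  \<open>\<iota> H\<close>, because the projection is open. Hence its rounding induces a Cauchy filter \<open>\<Phi>\<close> on \<open>H\<close>, and the limit
  of \<open>\<Phi>\<close> in the complete group \<open>H\<close> is a limit of the original filter.\<close>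
lemma cauchy_over_one_converges:
  assumes comp: "complete_top_group H" and F: "cauchy_filter_on (mid E) F"
    and lim: "limitin (topo G) (prj E) \<one>\<^bsub>G\<^esub> F"
  shows "\<exists>h\<in>carrier H. limitin (topo (mid E)) (\<lambda>x. x) (inc E h) F"
proof -
  define \<Phi> where "\<Phi> = inf (filtercomap (inc E) (X.round_filter F)) (principal (carrier H))"
  have evI: "eventually P \<Phi>" if "eventually (\<lambda>x. x \<in> A) F" "nb (mid E) U"
    "\<And>h x u. h \<in> carrier H \<Longrightarrow> x \<in> A \<Longrightarrow> u \<in> U \<Longrightarrow> inc E h = x \<otimes>\<^bsub>mid E\<^esub> u \<Longrightarrow> P h" for P A U
    unfolding \<Phi>_def eventually_inf_principal eventually_filtercomap X.eventually_round_filter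
    by (rule exI[of _ "\<lambda>y. \<exists>x\<in>A. \<exists>u\<in>U. y = x \<otimes>\<^bsub>mid E\<^esub> u"]) (use that in blast)
  have evD: "\<exists>A U. eventually (\<lambda>x. x \<in> A) F \<and> nb (mid E) U \<and>
      (\<forall>h\<in>carrier H. \<forall>x\<in>A. \<forall>u\<in>U. inc E h = x \<otimes>\<^bsub>mid E\<^esub> u \<longrightarrow> P h)" if P: "eventually P \<Phi>" for P
  proof -
    obtain Q where Q: "eventually Q (X.round_filter F)" "\<forall>h. Q (inc E h) \<longrightarrow> h \<in> carrier H \<longrightarrow> P h"
      using P unfolding \<Phi>_def eventually_inf_principal eventually_filtercomap by blast
    obtain A U where AU: "eventually (\<lambda>x. x \<in> A) F" "nb (mid E) U" "\<forall>x\<in>A. \<forall>u\<in>U. Q (x \<otimes>\<^bsub>mid E\<^esub> u)"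
      using Q(1) unfolding X.eventually_round_filter by blast
    then show ?thesis using Q(2) by (intro exI[of _ A] exI[of _ U]) auto
  qed
  note F' = F[unfolded X.cauchy_filter_on_iff]
  have ne: "\<Phi> \<noteq> bot"
  proof
    assume "\<Phi> = bot"
    then have "eventually (\<lambda>_. False) \<Phi>" by simp
    from evD[OF this] obtain A U where AU: "eventually (\<lambda>x. x \<in> A) F" "nb (mid E) U"
      "\<forall>h\<in>carrier H. \<forall>x\<in>A. \<forall>u\<in>U. inc E h \<noteq> x \<otimes>\<^bsub>mid E\<^esub> u" by blast
    obtain V where V: "nb (mid E) V" "V \<subseteq> U" "\<forall>x\<in>V. inv\<^bsub>mid E\<^esub> x \<in> V" using X.nb_sym[OF AU(2)] by blast
    have "eventually (\<lambda>x. prj E x \<in> prj E ` V) F"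
      using lim prj_open[OF V(1)] by (auto simp: limitin_def nb_def)
    then have "eventually (\<lambda>x. x \<in> A \<and> x \<in> carrier (mid E) \<and> prj E x \<in> prj E ` V) F"
      using AU(1) F' by (auto simp: eventually_conj_iff)
    from eventually_happens'[OF F'[THEN conjunct1] this]
    obtain x where x: "x \<in> A" "x \<in> carrier (mid E)" "prj E x \<in> prj E ` V" by blast
    then obtain v where v: "v \<in> V" "prj E x = prj E v" by blast
    have vc: "v \<in> carrier (mid E)" using v X.nb_carrier[OF V(1)] by blast
    obtain h where h: "h \<in> carrier H" "x \<otimes>\<^bsub>mid E\<^esub> inv\<^bsub>mid E\<^esub> v = inc E h" using prj_eqD[OF x(2) vc v(2)] by blast
    then show False using AU(3) x(1) V(2,3) v(1) by (metis subsetD)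
  qed
  have "cauchy_filter_on H \<Phi>"
    unfolding H.cauchy_filter_on_iff
  proof (intro conjI allI impI ne)
    show "eventually (\<lambda>h. h \<in> carrier H) \<Phi>" unfolding \<Phi>_def eventually_inf_principal by simp
    fix U assume U: "nb H U"
    obtain V where V: "nb (mid E) V" "\<forall>h\<in>carrier H. inc E h \<in> V \<longrightarrow> h \<in> U" using inc_embedding[OF U] by blast
    obtain W where W: "nb (mid E) W" "\<forall>x\<in>W. inv\<^bsub>mid E\<^esub> x \<in> W"
      "\<forall>x\<in>W. \<forall>y\<in>W. \<forall>z\<in>W. \<forall>w\<in>W. (x \<otimes>\<^bsub>mid E\<^esub> y) \<otimes>\<^bsub>mid E\<^esub> (z \<otimes>\<^bsub>mid E\<^esub> w) \<in> V"
      using X.nb_sym4[OF V(1)] by blast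
    obtain A where A: "A \<subseteq> carrier (mid E)" "eventually (\<lambda>x. x \<in> A) F" "\<forall>x\<in>A. \<forall>y\<in>A. x \<otimes>\<^bsub>mid E\<^esub> inv\<^bsub>mid E\<^esub> y \<in> W"
      using X.cauchy_small[OF F W(1)] by blast
    let ?B = "{h \<in> carrier H. \<exists>x\<in>A. \<exists>u\<in>W. inc E h = x \<otimes>\<^bsub>mid E\<^esub> u}"
    have "eventually (\<lambda>h. h \<in> ?B) \<Phi>" by (rule evI[OF A(2) W(1)]) auto
    moreover have "h \<otimes>\<^bsub>H\<^esub> inv\<^bsub>H\<^esub> k \<in> U" if hk: "h \<in> ?B" "k \<in> ?B" for h k
    proof -
      obtain x u where x: "x \<in> A" "u \<in> W" "inc E h = x \<otimes>\<^bsub>mid E\<^esub> u" using hk by blast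
      obtain y v where y: "y \<in> A" "v \<in> W" "inc E k = y \<otimes>\<^bsub>mid E\<^esub> v" using hk by blast
      have c: "x \<in> carrier (mid E)" "y \<in> carrier (mid E)" "u \<in> carrier (mid E)" "v \<in> carrier (mid E)"
        using x y A(1) X.nb_carrier[OF W(1)] by auto
      have "((x \<otimes>\<^bsub>mid E\<^esub> inv\<^bsub>mid E\<^esub> y) \<otimes>\<^bsub>mid E\<^esub> \<one>\<^bsub>mid E\<^esub>) \<otimes>\<^bsub>mid E\<^esub> (u \<otimes>\<^bsub>mid E\<^esub> inv\<^bsub>mid E\<^esub> v) \<in> V"
        using A(3) W x y X.nb_one[OF W(1)] by blast
      moreover have "((x \<otimes>\<^bsub>mid E\<^esub> inv\<^bsub>mid E\<^esub> y) \<otimes>\<^bsub>mid E\<^esub> \<one>\<^bsub>mid E\<^esub>) \<otimes>\<^bsub>mid E\<^esub> (u \<otimes>\<^bsub>mid E\<^esub> inv\<^bsub>mid E\<^esub> v)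
          = inc E (h \<otimes>\<^bsub>H\<^esub> inv\<^bsub>H\<^esub> k)"
        using hk c X.div_mult_div[OF c(1,3,2,4)] by (simp add: x(3)[symmetric] y(3)[symmetric])
      ultimately have "inc E (h \<otimes>\<^bsub>H\<^esub> inv\<^bsub>H\<^esub> k) \<in> V" by metis
      then show ?thesis using V(2) hk by auto
    qed
    ultimately show "\<exists>A. A \<subseteq> carrier H \<and> eventually (\<lambda>h. h \<in> A) \<Phi> \<and> (\<forall>h\<in>A. \<forall>k\<in>A. h \<otimes>\<^bsub>H\<^esub> inv\<^bsub>H\<^esub> k \<in> U)"
      by (intro exI[of _ ?B]) auto
  qed
  then obtain h0 where h0: "limitin (topo H) (\<lambda>h. h) h0 \<Phi>" using comp by (auto simp: complete_top_group_def)
  then have h0c: "h0 \<in> carrier H" by (simp add: limitin_def)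
  have "limitin (topo (mid E)) (\<lambda>x. x) (inc E h0) F"
    unfolding X.limitin_iff
  proof (intro conjI allI impI)
    show "inc E h0 \<in> carrier (mid E)" using h0c by simp
    fix U assume U: "nb (mid E) U"
    obtain V where V: "nb (mid E) V" "\<forall>x\<in>V. inv\<^bsub>mid E\<^esub> x \<in> V"
      "\<forall>x\<in>V. \<forall>y\<in>V. \<forall>z\<in>V. \<forall>w\<in>V. (x \<otimes>\<^bsub>mid E\<^esub> y) \<otimes>\<^bsub>mid E\<^esub> (z \<otimes>\<^bsub>mid E\<^esub> w) \<in> U"
      using X.nb_sym4[OF U] by blast
    obtain A where A: "A \<subseteq> carrier (mid E)" "eventually (\<lambda>x. x \<in> A) F" "\<forall>x\<in>A. \<forall>y\<in>A. x \<otimes>\<^bsub>mid E\<^esub> inv\<^bsub>mid E\<^esub> y \<in> V"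
      using X.cauchy_small[OF F V(1)] by blast
    have "eventually (\<lambda>h. h \<in> carrier H \<and> (\<exists>x\<in>A. \<exists>u\<in>V. inc E h = x \<otimes>\<^bsub>mid E\<^esub> u)) \<Phi>"
      by (rule evI[OF A(2) V(1)]) auto
    moreover have "eventually (\<lambda>h. h \<in> carrier H \<and> h \<otimes>\<^bsub>H\<^esub> inv\<^bsub>H\<^esub> h0 \<in> {h \<in> carrier H. inc E h \<in> V}) \<Phi>"
      using h0 nb_inc[OF V(1)] unfolding H.limitin_iff by blast
    ultimately have "eventually (\<lambda>h. (h \<in> carrier H \<and> (\<exists>x\<in>A. \<exists>u\<in>V. inc E h = x \<otimes>\<^bsub>mid E\<^esub> u)) \<and>
        (h \<in> carrier H \<and> h \<otimes>\<^bsub>H\<^esub> inv\<^bsub>H\<^esub> h0 \<in> {h \<in> carrier H. inc E h \<in> V})) \<Phi>"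
      by (rule eventually_conj)
    from eventually_happens'[OF ne this]
    obtain h a v where h: "h \<in> carrier H" "inc E (h \<otimes>\<^bsub>H\<^esub> inv\<^bsub>H\<^esub> h0) \<in> V" "a \<in> A" "v \<in> V" "inc E h = a \<otimes>\<^bsub>mid E\<^esub> v"
      by blast
    have ac: "a \<in> carrier (mid E)" "v \<in> carrier (mid E)" using h A(1) X.nb_carrier[OF V(1)] by auto
    have "x \<otimes>\<^bsub>mid E\<^esub> inv\<^bsub>mid E\<^esub> inc E h0 \<in> U" if x: "x \<in> A" for x
    proof -
      have xc: "x \<in> carrier (mid E)" using x A(1) by auto
      have "((x \<otimes>\<^bsub>mid E\<^esub> inv\<^bsub>mid E\<^esub> a) \<otimes>\<^bsub>mid E\<^esub> inv\<^bsub>mid E\<^esub> v) \<otimes>\<^bsub>mid E\<^esub> (inc E (h \<otimes>\<^bsub>H\<^esub> inv\<^bsub>H\<^esub> h0) \<otimes>\<^bsub>mid E\<^esub> \<one>\<^bsub>mid E\<^esub>) \<in> U"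
        using V A(3) h x X.nb_one[OF V(1)] by blast
      moreover have "((x \<otimes>\<^bsub>mid E\<^esub> inv\<^bsub>mid E\<^esub> a) \<otimes>\<^bsub>mid E\<^esub> inv\<^bsub>mid E\<^esub> v) \<otimes>\<^bsub>mid E\<^esub> (inc E (h \<otimes>\<^bsub>H\<^esub> inv\<^bsub>H\<^esub> h0) \<otimes>\<^bsub>mid E\<^esub> \<one>\<^bsub>mid E\<^esub>)
        = (x \<otimes>\<^bsub>mid E\<^esub> inv\<^bsub>mid E\<^esub> (a \<otimes>\<^bsub>mid E\<^esub> v)) \<otimes>\<^bsub>mid E\<^esub> ((a \<otimes>\<^bsub>mid E\<^esub> v) \<otimes>\<^bsub>mid E\<^esub> inv\<^bsub>mid E\<^esub> inc E h0)"
        using h(1,5) h0c xc ac by (simp add: X.inv_mult X.m_assoc)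
      ultimately show ?thesis using X.mult_telescope[of x "a \<otimes>\<^bsub>mid E\<^esub> v" "inv\<^bsub>mid E\<^esub> inc E h0"] xc ac h0c by simp
    qed
    then show "eventually (\<lambda>x. x \<in> carrier (mid E) \<and> x \<otimes>\<^bsub>mid E\<^esub> inv\<^bsub>mid E\<^esub> inc E h0 \<in> U) F"
      using A(1,2) by (auto elim: eventually_mono)
  qed
  then show ?thesis using h0c by blast
qed

text \<open>Completeness is a three-space property: translating a Cauchy filter by a preimage of the limit of
  its projection reduces the claim to filters that lie over the identity.\<close>
lemma mid_complete:
  assumes compH: "complete_top_group H" and compG: "complete_top_group G"
  shows "complete_top_group (mid E)"
  unfolding complete_top_group_def
proof (intro allI impI)
  fix F assume F: "cauchy_filter_on (mid E) F"
  obtain g where g: "limitin (topo G) (\<lambda>x. x) g (filtermap (prj E) F)"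
    using compG cauchy_filtermap[OF X.top_ab_group G.top_ab_group prj_cont F] by (auto simp: complete_top_group_def)
  then have g': "limitin (topo G) (prj E) g F" by (simp add: limitin_def eventually_filtermap)
  have "g \<in> prj E ` carrier (mid E)" using g by (simp add: limitin_def prj_surj)
  then obtain c where c: "c \<in> carrier (mid E)" "g = prj E c" by blast
  note F' = F[unfolded X.cauchy_filter_on_iff]
  let ?F = "filtermap (\<lambda>x. x \<otimes>\<^bsub>mid E\<^esub> inv\<^bsub>mid E\<^esub> c) F"
  have "limitin (topo G) (prj E) \<one>\<^bsub>G\<^esub> ?F"
    unfolding G.limitin_iff
  proof (intro conjI allI impI)
    fix U assume U: "nb G U"
    have "eventually (\<lambda>x. prj E x \<in> carrier G \<and> prj E x \<otimes>\<^bsub>G\<^esub> inv\<^bsub>G\<^esub> g \<in> U) F"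
      using g' U unfolding G.limitin_iff by blast
    moreover have "eventually (\<lambda>x. x \<in> carrier (mid E)) F" using F' by blast
    ultimately show "eventually (\<lambda>x. prj E x \<in> carrier G \<and> prj E x \<otimes>\<^bsub>G\<^esub> inv\<^bsub>G\<^esub> \<one>\<^bsub>G\<^esub> \<in> U) ?F"
      unfolding eventually_filtermap by eventually_elim (use c in simp)
  qed simp
  from cauchy_over_one_converges[OF compH X.cauchy_translate[OF F X.inv_closed[OF c(1)]] this]
  obtain h where h: "h \<in> carrier H" "limitin (topo (mid E)) (\<lambda>x. x) (inc E h) ?F" by blast
  have "limitin (topo (mid E)) (\<lambda>x. x) (inc E h \<otimes>\<^bsub>mid E\<^esub> c) F"
    unfolding X.limitin_iff
  proof (intro conjI allI impI)
    fix U assume U: "nb (mid E) U"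
    have "eventually (\<lambda>x. x \<otimes>\<^bsub>mid E\<^esub> inv\<^bsub>mid E\<^esub> c \<in> carrier (mid E) \<and> (x \<otimes>\<^bsub>mid E\<^esub> inv\<^bsub>mid E\<^esub> c) \<otimes>\<^bsub>mid E\<^esub> inv\<^bsub>mid E\<^esub> inc E h \<in> U) F"
      using h(2) U unfolding X.limitin_iff eventually_filtermap by blast
    moreover have "eventually (\<lambda>x. x \<in> carrier (mid E)) F" using F' by blast
    ultimately show "eventually (\<lambda>x. x \<in> carrier (mid E) \<and> x \<otimes>\<^bsub>mid E\<^esub> inv\<^bsub>mid E\<^esub> (inc E h \<otimes>\<^bsub>mid E\<^esub> c) \<in> U) F"
      by eventually_elim (use c h in \<open>simp add: X.inv_mult X.m_ac\<close>)
  qed (use h c in simp)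
  then show "\<exists>x. limitin (topo (mid E)) (\<lambda>x. x) x F" by blast
qed

end

section \<open>The completion of a topological abelian group\<close>

context topological_ab_group
begin

lemma eventually_nhdsin_carrier:
  "x \<in> carrier X \<Longrightarrow> eventually P (nhdsin (topo X) x) \<longleftrightarrow> (\<exists>S. openin (topo X) S \<and> x \<in> S \<and> (\<forall>y\<in>S. P y))"
  by (simp add: eventually_nhdsin)

lemma eventually_nhdsin_open:
  "openin (topo X) S \<Longrightarrow> x \<in> S \<Longrightarrow> eventually (\<lambda>y. y \<in> S) (nhdsin (topo X) x)"
  by (auto simp: eventually_nhdsin)

lemma cauchy_bot: "cauchy_filter_on X F \<Longrightarrow> F \<noteq> bot"
  and cauchy_carrier: "cauchy_filter_on X F \<Longrightarrow> eventually (\<lambda>x. x \<in> carrier X) F"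
  by (simp_all add: cauchy_filter_on_iff)

lemma filter_mult_commute:
  assumes "eventually (\<lambda>x. x \<in> carrier X) F" "eventually (\<lambda>x. x \<in> carrier X) K"
  shows "filter_mult F K = filter_mult K F"
proof -
  have "eventually P (filter_mult K F)" if P: "eventually P (filter_mult F K)"
    and F: "eventually (\<lambda>x. x \<in> carrier X) F" and K: "eventually (\<lambda>x. x \<in> carrier X) K" for P F K
  proof -
    obtain A B where AB: "eventually (\<lambda>x. x \<in> A) F" "eventually (\<lambda>x. x \<in> B) K" "\<forall>a\<in>A. \<forall>b\<in>B. P (a \<otimes> b)"
      using P unfolding eventually_filter_mult by (elim exE conjE)
    have "eventually (\<lambda>x. x \<in> A \<inter> carrier X) F" "eventually (\<lambda>x. x \<in> B \<inter> carrier X) K"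
      using AB F K by (auto intro: eventually_conj)
    then show ?thesis
    proof (elim eventually_filter_multI[rotated])
      fix a b assume "a \<in> B \<inter> carrier X" "b \<in> A \<inter> carrier X"
      then show "P (a \<otimes> b)" using AB(3) m_comm[of a b] by simp
    qed
  qed
  then show ?thesis using assms unfolding filter_eq_iff by blast
qed

lemma filter_mult_assoc:
  assumes F: "eventually (\<lambda>x. x \<in> carrier X) F" and K: "eventually (\<lambda>x. x \<in> carrier X) K"
    and L: "eventually (\<lambda>x. x \<in> carrier X) L"
  shows "filter_mult (filter_mult F K) L = filter_mult F (filter_mult K L)"
  unfolding filter_eq_iff
proof (intro allI iffI)
  fix P assume "eventually P (filter_mult (filter_mult F K) L)"
  then obtain S C where SC: "eventually (\<lambda>x. x \<in> S) (filter_mult F K)" "eventually (\<lambda>x. x \<in> C) L" "\<forall>s\<in>S. \<forall>c\<in>C. P (s \<otimes> c)"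
    unfolding eventually_filter_mult[of P] by (elim exE conjE)
  obtain A B where AB: "eventually (\<lambda>x. x \<in> A) F" "eventually (\<lambda>x. x \<in> B) K" "\<forall>a\<in>A. \<forall>b\<in>B. a \<otimes> b \<in> S"
    using SC(1) unfolding eventually_filter_mult by (elim exE conjE)
  have ev: "eventually (\<lambda>x. x \<in> A \<inter> carrier X) F" "eventually (\<lambda>x. x \<in> B \<inter> carrier X) K" "eventually (\<lambda>x. x \<in> C \<inter> carrier X) L"
    using AB SC F K L by (auto intro: eventually_conj)
  define S' where "S' = {b \<otimes> c | b c. b \<in> B \<inter> carrier X \<and> c \<in> C \<inter> carrier X}"
  have "eventually (\<lambda>x. x \<in> S') (filter_mult K L)"
    by (rule eventually_filter_multI[OF ev(2,3)]) (auto simp: S'_def)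
  moreover have "\<forall>a\<in>A \<inter> carrier X. \<forall>s\<in>S'. P (a \<otimes> s)"
    using AB(3) SC(3) by (auto simp: S'_def m_assoc[symmetric])
  ultimately show "eventually P (filter_mult F (filter_mult K L))"
    by (intro eventually_filter_multI[OF ev(1), of S']) blast+
next
  fix P assume "eventually P (filter_mult F (filter_mult K L))"
  then obtain A S where SC: "eventually (\<lambda>x. x \<in> A) F" "eventually (\<lambda>x. x \<in> S) (filter_mult K L)" "\<forall>a\<in>A. \<forall>s\<in>S. P (a \<otimes> s)"
    unfolding eventually_filter_mult[of P] by (elim exE conjE)
  obtain B C where AB: "eventually (\<lambda>x. x \<in> B) K" "eventually (\<lambda>x. x \<in> C) L" "\<forall>b\<in>B. \<forall>c\<in>C. b \<otimes> c \<in> S"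
    using SC(2) unfolding eventually_filter_mult by (elim exE conjE)
  have ev: "eventually (\<lambda>x. x \<in> A \<inter> carrier X) F" "eventually (\<lambda>x. x \<in> B \<inter> carrier X) K" "eventually (\<lambda>x. x \<in> C \<inter> carrier X) L"
    using AB SC F K L by (auto intro: eventually_conj)
  define S' where "S' = {a \<otimes> b | a b. a \<in> A \<inter> carrier X \<and> b \<in> B \<inter> carrier X}"
  have "eventually (\<lambda>x. x \<in> S') (filter_mult F K)"
    by (rule eventually_filter_multI[OF ev(1,2)]) (auto simp: S'_def)
  moreover have "\<forall>s\<in>S'. \<forall>c\<in>C \<inter> carrier X. P (s \<otimes> c)"
    using AB(3) SC(3) by (auto simp: S'_def m_assoc)
  ultimately show "eventually P (filter_mult (filter_mult F K) L)"
    by (intro eventually_filter_multI[OF _ ev(3), of S']) blast+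
qed

lemma nhdsin_mult:
  assumes x: "x \<in> carrier X" and y: "y \<in> carrier X"
  shows "filter_mult (nhdsin (topo X) x) (nhdsin (topo X) y) = nhdsin (topo X) (x \<otimes> y)"
  unfolding filter_eq_iff
proof (intro allI iffI)
  have xy: "x \<otimes> y \<in> carrier X" using x y by simp
  fix P
  {
    assume "eventually P (filter_mult (nhdsin (topo X) x) (nhdsin (topo X) y))"
    then obtain A B where AB: "eventually (\<lambda>x. x \<in> A) (nhdsin (topo X) x)" "eventually (\<lambda>x. x \<in> B) (nhdsin (topo X) y)"
      "\<forall>a\<in>A. \<forall>b\<in>B. P (a \<otimes> b)"
      unfolding eventually_filter_mult by (elim exE conjE)
    obtain S where S: "openin (topo X) S" "x \<in> S" "\<forall>a\<in>S. a \<in> A"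
      using AB(1) unfolding eventually_nhdsin_carrier[OF x] by blast
    have yB: "y \<in> B" using AB(2) unfolding eventually_nhdsin_carrier[OF y] by blast
    have op: "openin (topo X) {z \<in> carrier X. inv y \<otimes> z \<in> S}" using S(1) y by (intro open_translate) auto
    have "x \<otimes> y \<in> {z \<in> carrier X. inv y \<otimes> z \<in> S}"
      using S(2) x y by (simp add: m_comm[of x y] mult_inv_cancel)
    moreover have "P z" if z: "z \<in> {z \<in> carrier X. inv y \<otimes> z \<in> S}" for z
    proof -
      have "P ((inv y \<otimes> z) \<otimes> y)" using AB(3) S(3) yB z by blast
      moreover have "(inv y \<otimes> z) \<otimes> y = z" using z y m_comm[of "inv y \<otimes> z" y] by (simp add: mult_inv_cancel)
      ultimately show ?thesis by simp
    qed
    ultimately show "eventually P (nhdsin (topo X) (x \<otimes> y))"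
      unfolding eventually_nhdsin_carrier[OF xy] using op by blast
  next
    assume "eventually P (nhdsin (topo X) (x \<otimes> y))"
    then obtain S where S: "openin (topo X) S" "x \<otimes> y \<in> S" "\<forall>z\<in>S. P z"
      unfolding eventually_nhdsin_carrier[OF xy] by blast
    obtain V where V: "nb X V" "\<forall>u\<in>V. \<forall>v\<in>V. u \<otimes> v \<in> {w \<in> carrier X. (x \<otimes> y) \<otimes> w \<in> S}"
      using nb_sym[OF nb_translate[OF S(1,2)]] by blast
    let ?A = "{z \<in> carrier X. inv x \<otimes> z \<in> V}" and ?B = "{z \<in> carrier X. inv y \<otimes> z \<in> V}"
    have "P (a \<otimes> b)" if ab: "a \<in> ?A" "b \<in> ?B" for a b
    proof -
      have "(x \<otimes> y) \<otimes> ((inv x \<otimes> a) \<otimes> (inv y \<otimes> b)) \<in> S" using V(2) ab by blast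
      moreover have "(x \<otimes> y) \<otimes> ((inv x \<otimes> a) \<otimes> (inv y \<otimes> b)) = a \<otimes> b"
        using ab x y mult_swap[of x y "inv x \<otimes> a" "inv y \<otimes> b"] by (simp add: mult_inv_cancel)
      ultimately show ?thesis using S(3) by simp
    qed
    then show "eventually P (filter_mult (nhdsin (topo X) x) (nhdsin (topo X) y))"
      by (intro eventually_filter_multI[of ?A _ ?B] eventually_nhdsin_open nb_at[OF V(1)] x y)
  }
qed

lemma cauchy_filter_mult:
  assumes F: "cauchy_filter_on X F" and K: "cauchy_filter_on X K"
  shows "cauchy_filter_on X (filter_mult F K)"
  unfolding cauchy_filter_on_iff
proof (intro conjI allI impI)
  show "filter_mult F K \<noteq> bot"
    using cauchy_bot[OF F] cauchy_bot[OF K] by (simp add: filter_mult_def filtermap_bot_iff prod_filter_eq_bot)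
  show "eventually (\<lambda>x. x \<in> carrier X) (filter_mult F K)"
    unfolding eventually_filter_mult
    by (intro exI[of _ "carrier X"]) (use cauchy_carrier[OF F] cauchy_carrier[OF K] in auto)
  fix U assume U: "nb X U"
  obtain V where V: "nb X V" "\<forall>x\<in>V. \<forall>y\<in>V. x \<otimes> y \<in> U" using nb_sym[OF U] by blast
  obtain A where A: "A \<subseteq> carrier X" "eventually (\<lambda>x. x \<in> A) F" "\<forall>x\<in>A. \<forall>y\<in>A. x \<otimes> inv y \<in> V"
    using cauchy_small[OF F V(1)] by blast
  obtain B where B: "B \<subseteq> carrier X" "eventually (\<lambda>x. x \<in> B) K" "\<forall>x\<in>B. \<forall>y\<in>B. x \<otimes> inv y \<in> V"
    using cauchy_small[OF K V(1)] by blast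
  define C where "C = {a \<otimes> b | a b. a \<in> A \<and> b \<in> B}"
  have "eventually (\<lambda>x. x \<in> C) (filter_mult F K)"
    by (rule eventually_filter_multI[OF A(2) B(2)]) (auto simp: C_def)
  moreover have "C \<subseteq> carrier X" using A(1) B(1) by (auto simp: C_def)
  moreover have "x \<otimes> inv y \<in> U" if xy: "x \<in> C" "y \<in> C" for x y
  proof -
    obtain a b where ab: "a \<in> A" "b \<in> B" "x = a \<otimes> b" using xy(1) by (auto simp: C_def)
    obtain c d where cd: "c \<in> A" "d \<in> B" "y = c \<otimes> d" using xy(2) by (auto simp: C_def)
    have "x \<otimes> inv y = (a \<otimes> inv c) \<otimes> (b \<otimes> inv d)"
      unfolding ab(3) cd(3) using ab(1,2) cd(1,2) A(1) B(1) by (intro div_mult_div) auto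
    then show ?thesis using A(3) B(3) V(2) ab cd by simp
  qed
  ultimately show "\<exists>A. A \<subseteq> carrier X \<and> eventually (\<lambda>x. x \<in> A) (filter_mult F K) \<and> (\<forall>x\<in>A. \<forall>y\<in>A. x \<otimes> inv y \<in> U)"
    by blast
qed

lemma dense_embedding_ident: "dense_embedding X X (\<lambda>x. x)"
proof unfold_locales
  show "(\<lambda>x. x) \<in> hom X X" by (auto simp: hom_def)
  show "embedding_map (topo X) (topo X) (\<lambda>x. x)" 
    using subtopology_topspace[of "topo X"] homeomorphic_map_id[of "topo X" "topo X"] by (simp add: embedding_map_def id_def)
  show "topo X closure_of (\<lambda>x. x) ` carrier X = carrier X" using closure_of_topspace[of "topo X"] by simp
qed

lemma cauchy_nhdsin:
  assumes x: "x \<in> carrier X"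
  shows "cauchy_filter_on X (nhdsin (topo X) x)"
proof (rule dense_embedding.cauchy_of_limit[OF dense_embedding_ident])
  show "limitin (topo X) (\<lambda>x. x) x (nhdsin (topo X) x)"
    using x by (simp add: limitin_def eventually_nhdsin_open)
  show "nhdsin (topo X) x \<noteq> bot"
    using eventually_nhdsin_carrier[OF x, of "\<lambda>_. False"] by auto
  show "eventually (\<lambda>y. y \<in> carrier X) (nhdsin (topo X) x)"
    using eventually_nhdsin_open[of "carrier X" x] openin_topspace[of "topo X"] x by simp
qed

text \<open>The points of the completion are the round Cauchy filters \<open>F\<close>, those with \<open>F = F N\<close> for the
  neighbourhood filter \<open>N\<close> of the identity. Every Cauchy filter \<open>F\<close> is equivalent to exactly one round
  one, namely \<open>F N\<close>, so no equivalence classes are needed: filters are multiplied elementwise, \<open>N\<close> is the identity,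
  and \<open>x\<close> is embedded as its neighbourhood filter.\<close>
definition points :: "'a filter set" where
  "points = {F. cauchy_filter_on X F \<and> round_filter F = F}"

lemma pointsD: "F \<in> points \<Longrightarrow> cauchy_filter_on X F" "F \<in> points \<Longrightarrow> round_filter F = F"
  "F \<in> points \<Longrightarrow> eventually (\<lambda>x. x \<in> carrier X) F" "F \<in> points \<Longrightarrow> F \<noteq> bot"
  using cauchy_carrier cauchy_bot by (auto simp: points_def)

lemma nhdsin_point: "x \<in> carrier X \<Longrightarrow> nhdsin (topo X) x \<in> points"
  using cauchy_nhdsin nhdsin_mult[of x \<one>] by (simp add: points_def round_filter_def)

lemma round_point:
  assumes F: "cauchy_filter_on X F" shows "round_filter F \<in> points"
proof -
  note N = cauchy_nhdsin[OF one_closed]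
  have "round_filter (round_filter F) = filter_mult F (filter_mult (nhdsin (topo X) \<one>) (nhdsin (topo X) \<one>))"
    unfolding round_filter_def by (intro filter_mult_assoc cauchy_carrier F N)
  then show ?thesis
    using cauchy_filter_mult[OF F N] nhdsin_mult[of \<one> \<one>] by (simp add: points_def round_filter_def)
qed

lemma mult_point:
  assumes F: "F \<in> points" and K: "K \<in> points" shows "filter_mult F K \<in> points"
proof -
  have "round_filter (filter_mult F K) = filter_mult F (round_filter K)"
    unfolding round_filter_def by (intro filter_mult_assoc pointsD F K cauchy_carrier cauchy_nhdsin one_closed)
  then show ?thesis using cauchy_filter_mult[OF pointsD(1)[OF F] pointsD(1)[OF K]] pointsD(2)[OF K]
    by (simp add: points_def)
qed

text \<open>The filter of the elementwise inverses is rounded here only to land among the points. In the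
  product with \<open>F\<close> the factors \<open>a\<^sup>-\<^sup>1 b\<close> with \<open>a\<close>, \<open>b\<close> in a small member of \<open>F\<close> contract to the identity.\<close>
lemma filter_mult_inv:
  assumes F: "F \<in> points"
  shows "filter_mult (round_filter (filtermap (m_inv X) F)) F = nhdsin (topo X) \<one>"
    and "cauchy_filter_on X (filtermap (m_inv X) F)"
proof -
  have inv: "m_inv X \<in> cont_hom X X"
    using top_ab_group by (auto simp: cont_hom_def hom_def top_ab_group_def inv_mult)
  show c: "cauchy_filter_on X (filtermap (m_inv X) F)"
    by (rule cauchy_filtermap[OF top_ab_group top_ab_group inv pointsD(1)[OF F]])
  have "eventually P (filter_mult (round_filter (filtermap (m_inv X) F)) F) \<longleftrightarrow> eventually P (nhdsin (topo X) \<one>)" for P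
  proof
    assume "eventually P (filter_mult (round_filter (filtermap (m_inv X) F)) F)"
    then obtain S B where SB: "eventually (\<lambda>x. x \<in> S) (round_filter (filtermap (m_inv X) F))"
      "eventually (\<lambda>x. x \<in> B) F" "\<forall>s\<in>S. \<forall>b\<in>B. P (s \<otimes> b)"
      unfolding eventually_filter_mult by (elim exE conjE)
    obtain A U where AU: "eventually (\<lambda>x. inv x \<in> A) F" "nb X U" "\<forall>x\<in>A. \<forall>u\<in>U. x \<otimes> u \<in> S"
      using SB(1) unfolding eventually_round_filter eventually_filtermap by (elim exE conjE)
    have "eventually (\<lambda>x. (inv x \<in> A \<and> x \<in> B) \<and> x \<in> carrier X) F"
      by (intro eventually_conj AU SB pointsD(3)[OF F])
    from eventually_happens'[OF pointsD(4)[OF F] this]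
    obtain x where x: "inv x \<in> A" "x \<in> B" "x \<in> carrier X" by blast
    have "P u" if u: "u \<in> U" for u
    proof -
      have "P ((inv x \<otimes> u) \<otimes> x)" using x u AU(3) SB(3) by blast
      moreover have "(inv x \<otimes> u) \<otimes> x = u"
        using x u nb_carrier[OF AU(2)] m_comm[of "inv x \<otimes> u" x] by (auto simp: mult_inv_cancel subset_iff)
      ultimately show ?thesis by simp
    qed
    then show "eventually P (nhdsin (topo X) \<one>)"
      unfolding eventually_nhdsin_carrier[OF one_closed] using AU(2) by (auto simp: nb_def)
  next
    assume "eventually P (nhdsin (topo X) \<one>)"
    then obtain U where U: "nb X U" "\<forall>u\<in>U. P u"
      unfolding eventually_nhdsin_carrier[OF one_closed] by (auto simp: nb_def)
    obtain V where V: "nb X V" "\<forall>u\<in>V. \<forall>v\<in>V. u \<otimes> v \<in> U" using nb_sym[OF U(1)] by blast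
    obtain A where A: "A \<subseteq> carrier X" "eventually (\<lambda>x. x \<in> A) F" "\<forall>x\<in>A. \<forall>y\<in>A. x \<otimes> inv y \<in> V"
      using cauchy_small[OF pointsD(1)[OF F] V(1)] by blast
    define S where "S = {inv a \<otimes> v | a v. a \<in> A \<and> v \<in> V}"
    have "eventually (\<lambda>x. x \<in> S) (round_filter (filtermap (m_inv X) F))"
      unfolding round_filter_def
    proof (rule eventually_filter_multI)
      show "eventually (\<lambda>x. x \<in> m_inv X ` A) (filtermap (m_inv X) F)"
        using A(2) by (auto simp: eventually_filtermap elim: eventually_mono)
      show "eventually (\<lambda>x. x \<in> V) (nhdsin (topo X) \<one>)"
        using V(1) eventually_nhdsin_open by (simp add: nb_def)
    qed (auto simp: S_def)
    moreover have "\<forall>s\<in>S. \<forall>b\<in>A. P (s \<otimes> b)"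
    proof (intro ballI)
      fix s b assume "s \<in> S" "b \<in> A"
      then obtain a v where av: "a \<in> A" "v \<in> V" "s = inv a \<otimes> v" by (auto simp: S_def)
      have "s \<otimes> b = (b \<otimes> inv a) \<otimes> v"
        using av A(1) nb_carrier[OF V(1)] \<open>b \<in> A\<close> m_comm[of s b] by (auto simp: m_assoc subset_iff)
      then show "P (s \<otimes> b)" using av A(3) V(2) U(2) \<open>b \<in> A\<close> by simp
    qed
    ultimately show "eventually P (filter_mult (round_filter (filtermap (m_inv X) F)) F)"
      unfolding eventually_filter_mult[of P] using A(2) by blast
  qed
  then show "filter_mult (round_filter (filtermap (m_inv X) F)) F = nhdsin (topo X) \<one>"
    by (simp add: filter_eq_iff)
qed

lemma point_open:
  assumes F: "F \<in> points" and B: "eventually (\<lambda>x. x \<in> B) F"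
  shows "\<exists>S. openin (topo X) S \<and> S \<subseteq> B \<and> eventually (\<lambda>x. x \<in> S) F"
proof -
  have "eventually (\<lambda>x. x \<in> B) (round_filter F)" using B pointsD(2)[OF F] by simp
  then obtain A U where AU: "eventually (\<lambda>x. x \<in> A) F" "nb X U" "\<forall>x\<in>A. \<forall>u\<in>U. x \<otimes> u \<in> B"
    unfolding eventually_round_filter by (elim exE conjE)
  have "eventually (\<lambda>x. x \<in> A \<and> x \<in> carrier X) F" by (intro eventually_conj AU pointsD(3)[OF F])
  then have "eventually (\<lambda>x. x \<in> topo X interior_of B) F"
  proof eventually_elim
    case (elim a)
    have "{y \<in> carrier X. inv a \<otimes> y \<in> U} \<subseteq> B"
    proof
      fix y assume y: "y \<in> {y \<in> carrier X. inv a \<otimes> y \<in> U}"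
      then have "a \<otimes> (inv a \<otimes> y) \<in> B" using AU(3) elim by blast
      then show "y \<in> B" using y elim by (simp add: mult_inv_cancel)
    qed
    then show ?case using nb_at[OF AU(2), of a] elim unfolding interior_of_def by blast
  qed
  then show ?thesis
    by (intro exI[of _ "topo X interior_of B"]) (simp add: interior_of_subset)
qed

text \<open>For open \<open>U\<close> this is the largest open subset of the completion that meets the embedded group in \<open>U\<close>.
  These sets form a base of the topology.\<close>
definition basic :: "'a set \<Rightarrow> 'a filter set" where
  "basic U = {F \<in> points. eventually (\<lambda>x. x \<in> U) F}"

lemma basic_mono: "U \<subseteq> V \<Longrightarrow> basic U \<subseteq> basic V"
  by (auto simp: basic_def elim: eventually_mono)

definition point_topology :: "'a filter topology" where
  "point_topology = topology (\<lambda>S. S \<subseteq> points \<and> (\<forall>F\<in>S. \<exists>U. openin (topo X) U \<and> F \<in> basic U \<and> basic U \<subseteq> S))"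

lemma openin_point_topology:
  "openin point_topology S \<longleftrightarrow> S \<subseteq> points \<and> (\<forall>F\<in>S. \<exists>U. openin (topo X) U \<and> F \<in> basic U \<and> basic U \<subseteq> S)"
proof -
  have "istopology (\<lambda>S. S \<subseteq> points \<and> (\<forall>F\<in>S. \<exists>U. openin (topo X) U \<and> F \<in> basic U \<and> basic U \<subseteq> S))"
    unfolding istopology_def
  proof (intro conjI allI impI ballI)
    fix S T F
    assume S: "S \<subseteq> points \<and> (\<forall>F\<in>S. \<exists>U. openin (topo X) U \<and> F \<in> basic U \<and> basic U \<subseteq> S)"
      and T: "T \<subseteq> points \<and> (\<forall>F\<in>T. \<exists>U. openin (topo X) U \<and> F \<in> basic U \<and> basic U \<subseteq> T)"
      and F: "F \<in> S \<inter> T"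
    obtain U where U: "openin (topo X) U" "F \<in> basic U" "basic U \<subseteq> S" using S F by blast
    obtain V where V: "openin (topo X) V" "F \<in> basic V" "basic V \<subseteq> T" using T F by blast
    have "F \<in> basic (U \<inter> V)" using U(2) V(2) by (auto simp: basic_def intro: eventually_conj)
    moreover have "basic (U \<inter> V) \<subseteq> S \<inter> T" using basic_mono[of "U \<inter> V"] U(3) V(3) by blast
    ultimately show "\<exists>U. openin (topo X) U \<and> F \<in> basic U \<and> basic U \<subseteq> S \<inter> T"
      using openin_Int[OF U(1) V(1)] by blast
  next
    fix \<K> F
    assume K: "\<forall>S\<in>\<K>. S \<subseteq> points \<and> (\<forall>F\<in>S. \<exists>U. openin (topo X) U \<and> F \<in> basic U \<and> basic U \<subseteq> S)"
      and F: "F \<in> \<Union>\<K>"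
    then obtain S where "S \<in> \<K>" "F \<in> S" by blast
    then obtain U where "openin (topo X) U" "F \<in> basic U" "basic U \<subseteq> S" using K by blast
    then show "\<exists>U. openin (topo X) U \<and> F \<in> basic U \<and> basic U \<subseteq> \<Union>\<K>" using \<open>S \<in> \<K>\<close> by blast
  qed blast+
  then show ?thesis by (simp add: point_topology_def topology_inverse')
qed

lemma openin_basic: "openin (topo X) U \<Longrightarrow> openin point_topology (basic U)"
  unfolding openin_point_topology by (auto simp: basic_def)

lemma basic_carrier: "basic (carrier X) = points"
  using pointsD(3) by (auto simp: basic_def)

definition completion :: "'a filter top_group" where
  "completion = \<lparr>carrier = points, mult = filter_mult, one = nhdsin (topo X) \<one>, topo = point_topology\<rparr>"

lemma completion_simps [simp]:
  "carrier completion = points" "mult completion = filter_mult"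
  "one completion = nhdsin (topo X) \<one>" "topo completion = point_topology"
  by (simp_all add: completion_def)

lemma completion_comm_group: "comm_group completion"
proof (rule comm_groupI)
  show "\<exists>K\<in>carrier completion. K \<otimes>\<^bsub>completion\<^esub> F = \<one>\<^bsub>completion\<^esub>" if F: "F \<in> carrier completion" for F
    using filter_mult_inv[of F] round_point F by auto
  show "\<one>\<^bsub>completion\<^esub> \<otimes>\<^bsub>completion\<^esub> F = F" if F: "F \<in> carrier completion" for F
    using F filter_mult_commute[of "nhdsin (topo X) \<one>" F] nhdsin_point[OF one_closed] pointsD(2,3)
    by (simp add: round_filter_def)
qed (auto simp: mult_point nhdsin_point pointsD intro: filter_mult_assoc filter_mult_commute)

lemma nb_completionD:
  assumes "nb completion S"
  shows "\<exists>U. nb X U \<and> basic U \<subseteq> S"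
proof -
  obtain W where W: "openin (topo X) W" "nhdsin (topo X) \<one> \<in> basic W" "basic W \<subseteq> S"
    using assms by (auto simp: nb_def openin_point_topology)
  have "eventually (\<lambda>x. x \<in> W) (nhdsin (topo X) \<one>)" using W(2) by (simp add: basic_def)
  then have "\<one> \<in> W" unfolding eventually_nhdsin_carrier[OF one_closed] by blast
  then show ?thesis using W by (auto simp: nb_def)
qed

lemma nb_completionI: "nb X U \<Longrightarrow> nb completion (basic U)"
  using openin_basic nhdsin_point eventually_nhdsin_open by (simp add: nb_def basic_def)

lemma completion_top_ab_group: "top_ab_group completion"
proof (rule top_ab_groupI[OF completion_comm_group])
  interpret Y: comm_group completion by (rule completion_comm_group)
  have "openin point_topology points"
    using openin_basic[of "carrier X"] openin_topspace[of "topo X"] by (simp add: basic_carrier)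
  moreover have "topspace point_topology \<subseteq> points"
    using openin_topspace[of point_topology] unfolding openin_point_topology by blast
  ultimately show "topspace (topo completion) = carrier completion"
    using openin_subset[of point_topology points] by auto
  show "openin (topo completion) {F \<in> carrier completion. F0 \<otimes>\<^bsub>completion\<^esub> F \<in> S}"
    if S: "openin (topo completion) S" and F0: "F0 \<in> carrier completion" for S F0
    unfolding completion_simps openin_point_topology
  proof (intro conjI ballI)
    fix F assume F: "F \<in> {F \<in> points. filter_mult F0 F \<in> S}"
    then obtain W where W: "openin (topo X) W" "filter_mult F0 F \<in> basic W" "basic W \<subseteq> S"
      using S by (auto simp: openin_point_topology)
    have "eventually (\<lambda>x. x \<in> W) (filter_mult F0 F)" using W(2) by (simp add: basic_def)
    then obtain A B where AB: "eventually (\<lambda>x. x \<in> A) F0" "eventually (\<lambda>x. x \<in> B) F" "\<forall>a\<in>A. \<forall>b\<in>B. a \<otimes> b \<in> W"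
      unfolding eventually_filter_mult by (elim exE conjE)
    obtain T where T: "openin (topo X) T" "T \<subseteq> B" "eventually (\<lambda>x. x \<in> T) F"
      using point_open[of F B] F AB(2) by blast
    have "filter_mult F0 K \<in> S" if K: "K \<in> basic T" for K
    proof -
      have "eventually (\<lambda>x. x \<in> W) (filter_mult F0 K)"
        by (rule eventually_filter_multI[OF AB(1), of T]) (use AB(3) T(2) K in \<open>auto simp: basic_def\<close>)
      then show ?thesis using W(3) mult_point[of F0 K] F0 K by (auto simp: basic_def)
    qed
    then show "\<exists>U. openin (topo X) U \<and> F \<in> basic U \<and> basic U \<subseteq> {F \<in> points. filter_mult F0 F \<in> S}"
      using T(1,3) F by (intro exI[of _ T]) (auto simp: basic_def)
  qed auto
  show "\<exists>V. nb completion V \<and> (\<forall>F\<in>V. \<forall>K\<in>V. F \<otimes>\<^bsub>completion\<^esub> inv\<^bsub>completion\<^esub> K \<in> S)" if S: "nb completion S" for S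
  proof -
    obtain U where U: "nb X U" "basic U \<subseteq> S" using nb_completionD[OF S] by blast
    obtain V where V: "nb X V" "\<forall>x\<in>V. inv x \<in> V" "\<forall>x\<in>V. \<forall>y\<in>V. \<forall>z\<in>V. \<forall>w\<in>V. (x \<otimes> y) \<otimes> (z \<otimes> w) \<in> U"
      using nb_sym4[OF U(1)] by blast
    have "filter_mult F (inv\<^bsub>completion\<^esub> K) \<in> S" if FK: "F \<in> basic V" "K \<in> basic V" for F K
    proof -
      have p: "F \<in> points" "K \<in> points" using FK by (auto simp: basic_def)
      let ?K = "round_filter (filtermap (m_inv X) K)"
      have "inv\<^bsub>completion\<^esub> K = ?K"
        using filter_mult_inv[OF p(2)] round_point p by (intro Y.inv_equality) auto
      moreover have "eventually (\<lambda>x. x \<in> {v \<otimes> w |v w. v \<in> V \<and> w \<in> V}) ?K"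
        unfolding round_filter_def
      proof (rule eventually_filter_multI)
        show "eventually (\<lambda>x. x \<in> V) (filtermap (m_inv X) K)"
          using FK(2) V(2) by (auto simp: basic_def eventually_filtermap elim: eventually_mono)
        show "eventually (\<lambda>x. x \<in> V) (nhdsin (topo X) \<one>)"
          using V(1) eventually_nhdsin_open by (simp add: nb_def)
      qed auto
      moreover have "x \<otimes> s \<in> U" if x: "x \<in> V" and s: "s \<in> {v \<otimes> w |v w. v \<in> V \<and> w \<in> V}" for x s
      proof -
        obtain v w where vw: "v \<in> V" "w \<in> V" "s = v \<otimes> w" using s by blast
        have "(x \<otimes> \<one>) \<otimes> (v \<otimes> w) \<in> U" using V(3) x vw nb_one[OF V(1)] by blast
        then show ?thesis using x vw nb_carrier[OF V(1)] by (auto simp: subset_iff)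
      qed
      ultimately have "eventually (\<lambda>x. x \<in> U) (filter_mult F (inv\<^bsub>completion\<^esub> K))"
        using FK(1)
        by (intro eventually_filter_multI[of V _ "{v \<otimes> w |v w. v \<in> V \<and> w \<in> V}"]) (auto simp: basic_def)
      moreover have "filter_mult F (inv\<^bsub>completion\<^esub> K) \<in> points"
        using mult_point[OF p(1)] Y.inv_closed[of K] p by simp
      ultimately show ?thesis using U(2) by (auto simp: basic_def)
    qed
    then show ?thesis using nb_completionI[OF V(1)] by auto
  qed
  show "F = \<one>\<^bsub>completion\<^esub>" if F: "F \<in> carrier completion" and all: "\<And>S. nb completion S \<Longrightarrow> F \<in> S" for F
  proof -
    have Fp: "F \<in> points" using F by simp
    have ev: "eventually (\<lambda>x. x \<in> U) F" if "nb X U" for U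
      using all[OF nb_completionI[OF that]] by (simp add: basic_def)
    have "eventually P F \<longleftrightarrow> eventually P (nhdsin (topo X) \<one>)" for P
    proof
      assume "eventually P F"
      then have "eventually P (round_filter F)" using pointsD(2)[OF Fp] by simp
      then obtain A U where AU: "eventually (\<lambda>x. x \<in> A) F" "nb X U" "\<forall>x\<in>A. \<forall>u\<in>U. P (x \<otimes> u)"
        unfolding eventually_round_filter by (elim exE conjE)
      obtain V where V: "nb X V" "\<forall>x\<in>V. inv x \<in> V" "\<forall>x\<in>V. \<forall>y\<in>V. x \<otimes> y \<in> U" using nb_sym[OF AU(2)] by blast
      from eventually_happens'[OF pointsD(4)[OF Fp] eventually_conj[OF AU(1) ev[OF V(1)]]]
      obtain a where a: "a \<in> A" "a \<in> V" by blast
      have "P v" if v: "v \<in> V" for v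
      proof -
        have "P (a \<otimes> (inv a \<otimes> v))" using AU(3) V a v by blast
        moreover have "a \<in> carrier X" "v \<in> carrier X" using a v nb_carrier[OF V(1)] by auto
        ultimately show ?thesis by (simp add: mult_inv_cancel)
      qed
      then show "eventually P (nhdsin (topo X) \<one>)"
        unfolding eventually_nhdsin_carrier[OF one_closed] using V(1) by (auto simp: nb_def)
    next
      assume "eventually P (nhdsin (topo X) \<one>)"
      then obtain U where U: "nb X U" "\<forall>u\<in>U. P u"
        unfolding eventually_nhdsin_carrier[OF one_closed] by (auto simp: nb_def)
      show "eventually P F" using ev[OF U(1)] by eventually_elim (use U(2) in blast)
    qed
    then show ?thesis by (simp add: filter_eq_iff)
  qed
qed

lemma completion_dense_embedding: "dense_embedding X completion (nhdsin (topo X))"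
proof (rule dense_embeddingI[OF top_ab_group completion_top_ab_group])
  let ?e = "nhdsin (topo X)"
  have hom: "?e \<in> hom X completion" by (rule homI) (auto simp: nhdsin_point nhdsin_mult)
  have basic_iff: "?e x \<in> basic U \<longleftrightarrow> x \<in> U" if "openin (topo X) U" "x \<in> carrier X" for x U
    using that eventually_nhdsin_carrier[of x] nhdsin_point eventually_nhdsin_open[of U x] by (auto simp: basic_def)
  show "?e \<in> cont_hom X completion"
  proof (rule hom_continuousI[OF top_ab_group completion_top_ab_group hom])
    fix S assume "nb completion S"
    then obtain U where U: "nb X U" "basic U \<subseteq> S" using nb_completionD by blast
    have "?e x \<in> S" if x: "x \<in> U" for x
      using basic_iff[of U x] U x nb_carrier[OF U(1)] by (auto simp: nb_def)
    then show "\<exists>V. nb X V \<and> (\<forall>x\<in>V. ?e x \<in> S)" using U(1) by blast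
  qed
  show "\<exists>S. nb completion S \<and> (\<forall>x\<in>carrier X. ?e x \<in> S \<longrightarrow> x \<in> U)" if U: "nb X U" for U
    using nb_completionI[OF U] basic_iff[of U] U by (auto simp: nb_def)
  show "\<exists>x\<in>carrier X. ?e x \<in> S" if S: "openin (topo completion) S" "F \<in> S" for S F
  proof -
    obtain U where U: "openin (topo X) U" "F \<in> basic U" "basic U \<subseteq> S"
      using S by (auto simp: openin_point_topology)
    have "eventually (\<lambda>x. x \<in> U) F" "F \<noteq> bot" using U(2) pointsD(4) by (simp_all add: basic_def)
    from eventually_happens'[OF this(2,1)] obtain x where x: "x \<in> U" by blast
    then show ?thesis using basic_iff[OF U(1), of x] U(3) openin_carrier[OF U(1)] by blast
  qed
qed

lemma cauchy_limit_completion: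
  assumes F: "cauchy_filter_on X F"
  shows "limitin (topo completion) (nhdsin (topo X)) (round_filter F) F"
  unfolding limitin_def
proof (intro conjI allI impI)
  interpret Y: topological_ab_group completion by unfold_locales (rule completion_top_ab_group)
  show "round_filter F \<in> topspace (topo completion)" unfolding Y.topspace_eq using round_point[OF F] by simp
  fix S assume S: "openin (topo completion) S \<and> round_filter F \<in> S"
  then obtain W where W: "openin (topo X) W" "round_filter F \<in> basic W" "basic W \<subseteq> S"
    by (auto simp: openin_point_topology)
  have "eventually (\<lambda>x. x \<in> W) (round_filter F)" using W(2) by (simp add: basic_def)
  then obtain A U where AU: "eventually (\<lambda>x. x \<in> A) F" "nb X U" "\<forall>x\<in>A. \<forall>u\<in>U. x \<otimes> u \<in> W"
    unfolding eventually_round_filter by (elim exE conjE)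
  show "eventually (\<lambda>x. nhdsin (topo X) x \<in> S) F"
    using eventually_conj[OF AU(1) cauchy_carrier[OF F]]
  proof eventually_elim
    case (elim a)
    then have "a \<otimes> \<one> \<in> W" using AU(3) nb_one[OF AU(2)] by blast
    then have "nhdsin (topo X) a \<in> basic W"
      using nhdsin_point eventually_nhdsin_open[OF W(1), of a] elim by (simp add: basic_def)
    then show ?case using W(3) by blast
  qed
qed

end

section \<open>Lifting Cauchy filters along a quotient by an almost metrizable subgroup\<close>

lemma ultrafilter_below:
  fixes F :: "'a filter"
  assumes F: "F \<noteq> bot"
  shows "\<exists>K. K \<le> F \<and> K \<noteq> bot \<and> (\<forall>S. eventually (\<lambda>x. x \<in> S) K \<or> eventually (\<lambda>x. x \<notin> S) K)"
proof -
  let ?A = "{K. K \<le> F \<and> K \<noteq> bot}"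
  have po: "partial_order_on ?A (relation_of (\<lambda>K L. L \<le> K) ?A)"
    by (rule partial_order_on_relation_ofI) auto
  have "\<exists>u\<in>?A. \<forall>a\<in>C. u \<le> a" if C: "C \<in> Chains (relation_of (\<lambda>K L. L \<le> K) ?A)" for C
  proof (cases "C = {}")
    case True
    then show ?thesis using F by auto
  next
    case False
    have CA: "C \<subseteq> ?A" and ch: "\<And>K L. K \<in> C \<Longrightarrow> L \<in> C \<Longrightarrow> K \<le> L \<or> L \<le> K"
      using C by (auto simp: Chains_def relation_of_def)
    have "(INF K\<in>C. K) = bot \<longleftrightarrow> (\<exists>K\<in>C. K = bot)"
    proof (rule INF_filter_bot_base)
      fix K L assume "K \<in> C" "L \<in> C"
      then show "\<exists>M\<in>C. M \<le> inf K L" using ch[of K L] by (auto intro: bexI[of _ K] bexI[of _ L])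
    qed
    then have "Inf C \<noteq> bot" using CA by auto
    moreover have "Inf C \<le> F" using False CA Inf_lower2 by blast
    ultimately show ?thesis by (intro bexI[of _ "Inf C"]) (auto intro: Inf_lower)
  qed
  from predicate_Zorn[OF po this]
  have "\<exists>K\<in>?A. \<forall>L\<in>?A. L \<le> K \<longrightarrow> L = K" .
  then obtain K where K: "K \<le> F" "K \<noteq> bot" "\<And>L. L \<le> F \<Longrightarrow> L \<noteq> bot \<Longrightarrow> L \<le> K \<Longrightarrow> L = K" by blast
  have "eventually (\<lambda>x. x \<in> S) K \<or> eventually (\<lambda>x. x \<notin> S) K" for S
  proof (rule disjCI)
    assume "\<not> eventually (\<lambda>x. x \<notin> S) K"
    then have "inf K (principal S) \<noteq> bot"
      using eventually_inf_principal[of "\<lambda>_. False" K S] by auto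
    then have "inf K (principal S) = K" using K(1) by (intro K(3)) (auto intro: le_infI1)
    then show "eventually (\<lambda>x. x \<in> S) K"
      using eventually_inf_principal[of "\<lambda>x. x \<in> S" K S] by simp
  qed
  then show ?thesis using K(1,2) by blast
qed

lemma ultrafilter_finite_union:
  assumes K: "K \<noteq> bot" "\<forall>S. eventually (\<lambda>x. x \<in> S) K \<or> eventually (\<lambda>x. x \<notin> S) K"
    and I: "finite I" and ev: "eventually (\<lambda>x. \<exists>i\<in>I. x \<in> B i) K"
  shows "\<exists>i\<in>I. eventually (\<lambda>x. x \<in> B i) K"
proof (rule ccontr)
  assume "\<not> ?thesis"
  then have "\<forall>i\<in>I. eventually (\<lambda>x. x \<notin> B i) K" using K(2) by blast
  then have "eventually (\<lambda>x. \<forall>i\<in>I. x \<notin> B i) K" by (rule eventually_ball_finite[OF I])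
  from eventually_conj[OF ev this] have "eventually (\<lambda>_. False) K" by (rule eventually_mono) blast
  then show False using K(1) by simp
qed

text \<open>The form in which almost metrizability is used: there is a sequence of neighbourhoods \<open>B n\<close> of the
  identity that becomes precompact in the limit, in the sense that for every \<open>W\<close> some \<open>B n\<close> is covered by
  finitely many translates of \<open>W\<close>. If \<open>K\<close> is the compact set with a countable neighbourhood base and
  \<open>k \<in> K\<close>, one takes the translates by \<open>k\<^sup>-\<^sup>1\<close> of the base: the set \<open>K W\<close> is a neighbourhood of \<open>K\<close> and is
  covered by finitely many translates of \<open>W W\<close>.\<close>
lemma (in topological_ab_group) almost_metrizable_precompact_nbs:
  assumes "almost_metrizable X"
  obtains B :: "nat \<Rightarrow> 'a set" where "\<And>n. nb X (B n)"
    "\<And>W. nb X W \<Longrightarrow> \<exists>n C. finite C \<and> C \<subseteq> carrier X \<and> (\<forall>h\<in>B n. \<exists>c\<in>C. \<exists>w\<in>W. h = c \<otimes> w)"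
proof -
  obtain K \<B> where K: "K \<noteq> {}" "compactin (topo X) K" and \<B>: "countable \<B>"
    "\<forall>B\<in>\<B>. B \<subseteq> carrier X \<and> K \<subseteq> topo X interior_of B"
    "\<forall>U. openin (topo X) U \<and> K \<subseteq> U \<longrightarrow> (\<exists>B\<in>\<B>. B \<subseteq> U)"
    using assms unfolding almost_metrizable_def by (elim exE conjE)
  obtain k where k: "k \<in> K" using K(1) by blast
  have Kc: "K \<subseteq> carrier X" using compactin_subset_topspace[OF K(2)] by simp
  have kc: "k \<in> carrier X" using k Kc by blast
  have "\<exists>B\<in>\<B>. B \<subseteq> carrier X" using \<B>(3) Kc openin_topspace[of "topo X"] by auto
  then have ne: "\<B> \<noteq> {}" by blast
  define B where "B n = {h \<in> carrier X. k \<otimes> h \<in> topo X interior_of (from_nat_into \<B> n)}" for n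
  have 1: "nb X (B n)" for n
  proof -
    have "K \<subseteq> topo X interior_of (from_nat_into \<B> n)" using \<B>(2) from_nat_into[OF ne] by blast
    then show ?thesis unfolding B_def using k by (intro nb_translate openin_interior_of) blast
  qed
  have 2: "\<exists>n C. finite C \<and> C \<subseteq> carrier X \<and> (\<forall>h\<in>B n. \<exists>c\<in>C. \<exists>w\<in>W. h = c \<otimes> w)" if W: "nb X W" for W
  proof -
    obtain V where V: "nb X V" "\<forall>x\<in>V. \<forall>y\<in>V. x \<otimes> y \<in> W" using nb_sym[OF W] by blast
    note Vc = nb_carrier[OF V(1)]
    define T where "T c = {y \<in> carrier X. inv c \<otimes> y \<in> V}" for c
    have T: "openin (topo X) (T c)" "c \<in> T c" if "c \<in> carrier X" for c
      using nb_at[OF V(1) that] by (auto simp: T_def)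
    have "openin (topo X) S" if "S \<in> T ` K" for S using that T(1) Kc by auto
    moreover have "K \<subseteq> \<Union> (T ` K)" using T(2) Kc by auto
    ultimately obtain \<T> where \<T>: "finite \<T>" "\<T> \<subseteq> T ` K" "K \<subseteq> \<Union>\<T>"
      using compactinD[OF K(2), of "T ` K"] by auto
    obtain C where C: "C \<subseteq> K" "finite C" "\<T> = T ` C" using finite_subset_image[OF \<T>(1,2)] by blast
    have op: "openin (topo X) {y \<in> carrier X. \<exists>c\<in>K. inv c \<otimes> y \<in> V}"
    proof -
      have "{y \<in> carrier X. \<exists>c\<in>K. inv c \<otimes> y \<in> V} = \<Union> (T ` K)" by (auto simp: T_def)
      then show ?thesis using T(1) Kc by (auto intro!: openin_Union)
    qed
    have "\<exists>c\<in>K. inv c \<otimes> y \<in> V" if "y \<in> K" for y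
      using that Kc nb_one[OF V(1)] by (intro bexI[of _ y]) auto
    then have "K \<subseteq> {y \<in> carrier X. \<exists>c\<in>K. inv c \<otimes> y \<in> V}" using Kc by auto
    then obtain B' where B': "B' \<in> \<B>" "B' \<subseteq> {y \<in> carrier X. \<exists>c\<in>K. inv c \<otimes> y \<in> V}" using \<B>(3) op by blast
    obtain n where n: "from_nat_into \<B> n = B'" using B'(1) from_nat_into_surj[OF \<B>(1)] by blast
    have "\<exists>c\<in>(\<lambda>c. inv k \<otimes> c) ` C. \<exists>w\<in>W. h = c \<otimes> w" if h: "h \<in> B n" for h
    proof -
      have hc: "h \<in> carrier X" and "k \<otimes> h \<in> B'"
        using h n interior_of_subset[of "topo X" B'] by (auto simp: B_def)
      then obtain d where d: "d \<in> K" "inv d \<otimes> (k \<otimes> h) \<in> V" using B'(2) by blast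
      then obtain c where c: "c \<in> C" "inv c \<otimes> d \<in> V" using \<T>(3) C(3) by (auto simp: T_def)
      have dc: "d \<in> carrier X" "c \<in> carrier X" using c d C(1) Kc by auto
      have "(inv c \<otimes> d) \<otimes> (inv d \<otimes> (k \<otimes> h)) \<in> W" using V(2) c d by blast
      moreover have "(inv k \<otimes> c) \<otimes> ((inv c \<otimes> d) \<otimes> (inv d \<otimes> (k \<otimes> h))) = h"
        using dc hc kc by (simp add: m_assoc mult_inv_cancel)
      ultimately show ?thesis using c(1) by (metis imageI)
    qed
    moreover have "finite ((\<lambda>c. inv k \<otimes> c) ` C)" "(\<lambda>c. inv k \<otimes> c) ` C \<subseteq> carrier X"
      using C(1,2) Kc kc by auto
    ultimately show ?thesis by blast
  qed
  show ?thesis using that[of B] 1 2 by blast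
qed

context extension
begin

lemma shrinking_nbs:
  assumes U: "nb (mid E) U" and B: "\<And>n :: nat. nb H (B n)"
  shows "\<exists>V. V (0 :: nat) = U \<and> (\<forall>n. nb (mid E) (V n) \<and> V (Suc n) \<subseteq> V n \<and>
    (\<forall>x\<in>V (Suc n). inv\<^bsub>mid E\<^esub> x \<in> V (Suc n)) \<and> (\<forall>x\<in>V (Suc n). \<forall>y\<in>V (Suc n). x \<otimes>\<^bsub>mid E\<^esub> y \<in> V n) \<and>
    (\<forall>h\<in>carrier H. inc E h \<in> V (Suc n) \<longrightarrow> h \<in> B n))"
proof -
  have "\<exists>V. \<forall>n. (nb (mid E) (V n) \<and> (n = 0 \<longrightarrow> V n = U)) \<and>
      (V (Suc n) \<subseteq> V n \<and> (\<forall>x\<in>V (Suc n). inv\<^bsub>mid E\<^esub> x \<in> V (Suc n)) \<and>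
        (\<forall>x\<in>V (Suc n). \<forall>y\<in>V (Suc n). x \<otimes>\<^bsub>mid E\<^esub> y \<in> V n) \<and>
        (\<forall>h\<in>carrier H. inc E h \<in> V (Suc n) \<longrightarrow> h \<in> B n))"
  proof (rule dependent_nat_choice)
    show "\<exists>V. nb (mid E) V \<and> (0 = (0::nat) \<longrightarrow> V = U)" using U by blast
    fix V and n :: nat assume V: "nb (mid E) V \<and> (n = 0 \<longrightarrow> V = U)"
    obtain W where W: "nb (mid E) W" "\<forall>h\<in>carrier H. inc E h \<in> W \<longrightarrow> h \<in> B n" using inc_embedding[OF B] by blast
    have "nb (mid E) (V \<inter> W)" using V W(1) by (intro X.nb_Int) auto
    from X.nb_sym[OF this] obtain V' where V': "nb (mid E) V'" "V' \<subseteq> V \<inter> W" "\<forall>x\<in>V'. inv\<^bsub>mid E\<^esub> x \<in> V'"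
      "\<forall>x\<in>V'. \<forall>y\<in>V'. x \<otimes>\<^bsub>mid E\<^esub> y \<in> V \<inter> W" by blast
    show "\<exists>V'. (nb (mid E) V' \<and> (Suc n = 0 \<longrightarrow> V' = U)) \<and>
        (V' \<subseteq> V \<and> (\<forall>x\<in>V'. inv\<^bsub>mid E\<^esub> x \<in> V') \<and> (\<forall>x\<in>V'. \<forall>y\<in>V'. x \<otimes>\<^bsub>mid E\<^esub> y \<in> V) \<and>
          (\<forall>h\<in>carrier H. inc E h \<in> V' \<longrightarrow> h \<in> B n))"
      using V' W(2) by (intro exI[of _ V']) auto
  qed
  then obtain V where V: "\<forall>n. (nb (mid E) (V n) \<and> (n = 0 \<longrightarrow> V n = U)) \<and>
      (V (Suc n) \<subseteq> V n \<and> (\<forall>x\<in>V (Suc n). inv\<^bsub>mid E\<^esub> x \<in> V (Suc n)) \<and>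
        (\<forall>x\<in>V (Suc n). \<forall>y\<in>V (Suc n). x \<otimes>\<^bsub>mid E\<^esub> y \<in> V n) \<and>
        (\<forall>h\<in>carrier H. inc E h \<in> V (Suc n) \<longrightarrow> h \<in> B n))" by (elim exE)
  then show ?thesis by (intro exI[of _ V]) blast
qed

text \<open>A Cauchy filter \<open>\<xi>\<close> on the quotient \<open>G\<close> is lifted in two steps. Choose neighbourhoods \<open>V n\<close> in the
  middle group that shrink in the sense of \<open>shrinking_nbs\<close> and whose traces on \<open>H\<close> lie in the
  asymptotically precompact sequence \<open>B n\<close>. As \<open>\<xi>\<close> is Cauchy, there are points \<open>x n\<close>, each in \<open>x (n-1) V (n-1)\<close>,
  such that the image of \<open>x n V n\<close> belongs to \<open>\<xi>\<close>. The decreasing sets \<open>D n = x n V n V n\<close> together with the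
  preimages of the members of \<open>\<xi>\<close> generate a filter.

  If \<open>H\<close> is metrizable this filter is Cauchy: two elements of \<open>D n\<close> with close projections differ by a
  small element times an element of \<open>H\<close> that lies in a small \<open>V m\<close>. In general that element of \<open>H\<close> is only
  known to lie in \<open>B m\<close>, so for every \<open>W\<close> some member of the filter is covered by finitely many
  \<open>W\<close>-small sets. An ultrafilter that refines it contains one of them and is therefore Cauchy.\<close>
lemma lift_cauchy_filter:
  assumes am: "almost_metrizable H" and U: "nb (mid E) U"
    and \<xi>: "cauchy_filter_on G \<xi>" and evU: "eventually (\<lambda>g. g \<in> prj E ` U) \<xi>"
  shows "\<exists>F. cauchy_filter_on (mid E) F \<and> filtermap (prj E) F \<le> \<xi> \<and>
    eventually (\<lambda>x. \<exists>u\<in>U. \<exists>v\<in>U. x = u \<otimes>\<^bsub>mid E\<^esub> v) F"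
proof -
  obtain B where B: "\<And>n :: nat. nb H (B n)"
    "\<And>W. nb H W \<Longrightarrow> \<exists>n C. finite C \<and> C \<subseteq> carrier H \<and> (\<forall>h\<in>B n. \<exists>c\<in>C. \<exists>w\<in>W. h = c \<otimes>\<^bsub>H\<^esub> w)"
    using H.almost_metrizable_precompact_nbs[OF am] by blast
  obtain V where V0: "V (0 :: nat) = U" and V: "\<forall>n. nb (mid E) (V n) \<and> V (Suc n) \<subseteq> V n \<and>
    (\<forall>x\<in>V (Suc n). inv\<^bsub>mid E\<^esub> x \<in> V (Suc n)) \<and> (\<forall>x\<in>V (Suc n). \<forall>y\<in>V (Suc n). x \<otimes>\<^bsub>mid E\<^esub> y \<in> V n) \<and>
    (\<forall>h\<in>carrier H. inc E h \<in> V (Suc n) \<longrightarrow> h \<in> B n)"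
    using shrinking_nbs[OF U, where B = B, OF B(1)] by (elim exE conjE)
  have Vnb: "nb (mid E) (V n)" and Vinv: "x \<in> V (Suc n) \<Longrightarrow> inv\<^bsub>mid E\<^esub> x \<in> V (Suc n)"
    and Vmult: "x \<in> V (Suc n) \<Longrightarrow> y \<in> V (Suc n) \<Longrightarrow> x \<otimes>\<^bsub>mid E\<^esub> y \<in> V n"
    and VB: "h \<in> carrier H \<Longrightarrow> inc E h \<in> V (Suc n) \<Longrightarrow> h \<in> B n" for n x y h
    using V by blast+
  have Vc: "x \<in> V n \<Longrightarrow> x \<in> carrier (mid E)" for x n using X.nb_carrier[OF Vnb] by blast
  have V1: "\<one>\<^bsub>mid E\<^esub> \<in> V n" for n by (rule X.nb_one[OF Vnb])
  \<comment> \<open>The next point is a lift of an element of a member \<open>A\<close> of \<open>\<xi>\<close> that is small of order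
    \<open>prj E ` V (Suc n)\<close>; such a lift exists inside \<open>x n V n\<close>, as \<open>A\<close> meets the image of \<open>x n V n\<close>.\<close>
  have "\<exists>x. \<forall>n. (x n \<in> carrier (mid E) \<and> eventually (\<lambda>g. \<exists>u\<in>V n. g = prj E (x n \<otimes>\<^bsub>mid E\<^esub> u)) \<xi> \<and> (n = 0 \<longrightarrow> x n = \<one>\<^bsub>mid E\<^esub>)) \<and>
      (\<exists>u\<in>V n. x (Suc n) = x n \<otimes>\<^bsub>mid E\<^esub> u)"
  proof (rule dependent_nat_choice)
    have "eventually (\<lambda>g. \<exists>u\<in>V 0. g = prj E (\<one>\<^bsub>mid E\<^esub> \<otimes>\<^bsub>mid E\<^esub> u)) \<xi>"
      using evU by eventually_elim (use Vc V0 in force)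
    then show "\<exists>x. x \<in> carrier (mid E) \<and> eventually (\<lambda>g. \<exists>u\<in>V 0. g = prj E (x \<otimes>\<^bsub>mid E\<^esub> u)) \<xi> \<and> (0 = (0::nat) \<longrightarrow> x = \<one>\<^bsub>mid E\<^esub>)"
      by blast
    fix x n assume x: "x \<in> carrier (mid E) \<and> eventually (\<lambda>g. \<exists>u\<in>V n. g = prj E (x \<otimes>\<^bsub>mid E\<^esub> u)) \<xi> \<and> (n = 0 \<longrightarrow> x = \<one>\<^bsub>mid E\<^esub>)"
    obtain A where A: "A \<subseteq> carrier G" "eventually (\<lambda>g. g \<in> A) \<xi>" "\<forall>g\<in>A. \<forall>h\<in>A. g \<otimes>\<^bsub>G\<^esub> inv\<^bsub>G\<^esub> h \<in> prj E ` V (Suc n)"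
      using G.cauchy_small[OF \<xi> prj_open[OF Vnb]] by blast
    have "eventually (\<lambda>g. g \<in> A \<and> (\<exists>u\<in>V n. g = prj E (x \<otimes>\<^bsub>mid E\<^esub> u))) \<xi>" using A(2) x by (auto intro: eventually_conj)
    from eventually_happens'[OF G.cauchy_bot[OF \<xi>] this]
    obtain u where u: "u \<in> V n" "prj E (x \<otimes>\<^bsub>mid E\<^esub> u) \<in> A" by blast
    have uc: "x \<otimes>\<^bsub>mid E\<^esub> u \<in> carrier (mid E)" using x Vc[OF u(1)] by simp
    have "\<exists>v\<in>V (Suc n). g = prj E ((x \<otimes>\<^bsub>mid E\<^esub> u) \<otimes>\<^bsub>mid E\<^esub> v)" if g: "g \<in> A" for g
    proof -
      have gc: "g \<in> carrier G" using g A(1) by blast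
      obtain v where v: "v \<in> V (Suc n)" "g \<otimes>\<^bsub>G\<^esub> inv\<^bsub>G\<^esub> prj E (x \<otimes>\<^bsub>mid E\<^esub> u) = prj E v" using A(3) g u(2) by blast
      have "prj E ((x \<otimes>\<^bsub>mid E\<^esub> u) \<otimes>\<^bsub>mid E\<^esub> v) = prj E (x \<otimes>\<^bsub>mid E\<^esub> u) \<otimes>\<^bsub>G\<^esub> prj E v"
        by (rule prj_simps(2)[OF uc Vc[OF v(1)]])
      also have "\<dots> = g"
        unfolding v(2)[symmetric] using G.mult_inv_cancel(1)[OF prj_simps(1)[OF uc] gc] gc prj_simps(1)[OF uc]
        by (simp add: G.m_comm del: prj_simps)
      finally show ?thesis using v(1) by blast
    qed
    then have "eventually (\<lambda>g. \<exists>v\<in>V (Suc n). g = prj E ((x \<otimes>\<^bsub>mid E\<^esub> u) \<otimes>\<^bsub>mid E\<^esub> v)) \<xi>"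
      using A(2) by (auto elim: eventually_mono)
    then show "\<exists>y. (y \<in> carrier (mid E) \<and> eventually (\<lambda>g. \<exists>v\<in>V (Suc n). g = prj E (y \<otimes>\<^bsub>mid E\<^esub> v)) \<xi> \<and> (Suc n = 0 \<longrightarrow> y = \<one>\<^bsub>mid E\<^esub>)) \<and>
        (\<exists>u\<in>V n. y = x \<otimes>\<^bsub>mid E\<^esub> u)"
      using u(1) uc by (intro exI[of _ "x \<otimes>\<^bsub>mid E\<^esub> u"]) auto
  qed
  then obtain x where xx: "\<forall>n. (x n \<in> carrier (mid E) \<and> eventually (\<lambda>g. \<exists>u\<in>V n. g = prj E (x n \<otimes>\<^bsub>mid E\<^esub> u)) \<xi> \<and> (n = 0 \<longrightarrow> x n = \<one>\<^bsub>mid E\<^esub>)) \<and>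
      (\<exists>u\<in>V n. x (Suc n) = x n \<otimes>\<^bsub>mid E\<^esub> u)" by (elim exE)
  have xc: "x n \<in> carrier (mid E)" and xev: "eventually (\<lambda>g. \<exists>u\<in>V n. g = prj E (x n \<otimes>\<^bsub>mid E\<^esub> u)) \<xi>"
    and x0: "x 0 = \<one>\<^bsub>mid E\<^esub>" and xSuc: "\<exists>u\<in>V n. x (Suc n) = x n \<otimes>\<^bsub>mid E\<^esub> u" for n
    using xx by blast+
  define D where "D n = {(x n \<otimes>\<^bsub>mid E\<^esub> u) \<otimes>\<^bsub>mid E\<^esub> v | u v. u \<in> V n \<and> v \<in> V n}" for n
  have Dc: "D n \<subseteq> carrier (mid E)" for n using xc Vc by (auto simp: D_def)
  have DSuc: "D (Suc n) \<subseteq> D n" for n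
  proof
    fix y assume "y \<in> D (Suc n)"
    then obtain u v where uv: "u \<in> V (Suc n)" "v \<in> V (Suc n)" "y = (x (Suc n) \<otimes>\<^bsub>mid E\<^esub> u) \<otimes>\<^bsub>mid E\<^esub> v"
      by (auto simp: D_def)
    obtain w where w: "w \<in> V n" "x (Suc n) = x n \<otimes>\<^bsub>mid E\<^esub> w" using xSuc by blast
    have "y = (x n \<otimes>\<^bsub>mid E\<^esub> w) \<otimes>\<^bsub>mid E\<^esub> (u \<otimes>\<^bsub>mid E\<^esub> v)"
      unfolding uv(3) w(2) using xc Vc[OF w(1)] Vc[OF uv(1)] Vc[OF uv(2)] by (simp add: X.m_assoc)
    then show "y \<in> D n" using w(1) Vmult[OF uv(1,2)] unfolding D_def by blast
  qed
  have Dmono: "D n \<subseteq> D m" if "m \<le> n" for m n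
    using lift_Suc_antimono_le[of D, OF DSuc that] .
  have Dev: "eventually (\<lambda>g. \<exists>y\<in>D n. g = prj E y) \<xi>" for n
    using xev[of n]
  proof eventually_elim
    case (elim g)
    then obtain u where u: "u \<in> V n" "g = prj E (x n \<otimes>\<^bsub>mid E\<^esub> u)" by blast
    have "(x n \<otimes>\<^bsub>mid E\<^esub> u) \<otimes>\<^bsub>mid E\<^esub> \<one>\<^bsub>mid E\<^esub> \<in> D n" using u(1) V1 unfolding D_def by blast
    then have "x n \<otimes>\<^bsub>mid E\<^esub> u \<in> D n" using xc[of n] Vc[OF u(1)] by simp
    then show ?case using u(2) by blast
  qed
  define \<Phi> where "\<Phi> n = inf (filtercomap (prj E) \<xi>) (principal (D n))" for n
  have "(INF n. \<Phi> n) = bot \<longleftrightarrow> (\<exists>n\<in>UNIV. \<Phi> n = bot)"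
  proof (rule INF_filter_bot_base)
    fix m n :: nat
    show "\<exists>k\<in>UNIV. \<Phi> k \<le> inf (\<Phi> m) (\<Phi> n)"
      by (rule bexI[of _ "max m n"]) (auto simp: \<Phi>_def intro!: le_infI2 Dmono)
  qed
  moreover have "\<Phi> n \<noteq> bot" for n
  proof
    assume "\<Phi> n = bot"
    then have "eventually (\<lambda>_. False) (\<Phi> n)" by simp
    then obtain Q where Q: "eventually Q \<xi>" "\<forall>y. Q (prj E y) \<longrightarrow> y \<notin> D n"
      unfolding \<Phi>_def eventually_inf_principal eventually_filtercomap by blast
    from eventually_happens'[OF G.cauchy_bot[OF \<xi>] eventually_conj[OF Q(1) Dev[of n]]]
    show False using Q(2) by blast
  qed
  ultimately have "(INF n. \<Phi> n) \<noteq> bot" by blast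
  then obtain F where F: "F \<le> (INF n. \<Phi> n)" "F \<noteq> bot"
    "\<forall>S. eventually (\<lambda>x. x \<in> S) F \<or> eventually (\<lambda>x. x \<notin> S) F" using ultrafilter_below by blast
  have F\<Phi>: "F \<le> \<Phi> n" for n using F(1) by (meson INF_lower UNIV_I order_trans)
  have FD: "eventually (\<lambda>y. y \<in> D n) F" for n
    using F\<Phi>[of n] by (simp add: \<Phi>_def le_principal)
  have F\<xi>: "filtermap (prj E) F \<le> \<xi>"
    using F\<Phi>[of 0] by (simp add: \<Phi>_def filtermap_le_iff_le_filtercomap)
  have "cauchy_filter_on (mid E) F"
    unfolding X.cauchy_filter_on_iff
  proof (intro conjI allI impI F(2))
    show "eventually (\<lambda>y. y \<in> carrier (mid E)) F"
      using FD[of 0] by eventually_elim (use Dc in blast)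
    fix W assume W: "nb (mid E) W"
    obtain P where P: "nb (mid E) P" "\<forall>x\<in>P. inv\<^bsub>mid E\<^esub> x \<in> P"
      "\<forall>x\<in>P. \<forall>y\<in>P. \<forall>z\<in>P. \<forall>w\<in>P. (x \<otimes>\<^bsub>mid E\<^esub> y) \<otimes>\<^bsub>mid E\<^esub> (z \<otimes>\<^bsub>mid E\<^esub> w) \<in> W"
      using X.nb_sym4[OF W] by blast
    have Pc: "x \<in> carrier (mid E)" if "x \<in> P" for x using X.nb_carrier[OF P(1)] that by blast
    obtain n C where nC: "finite C" "C \<subseteq> carrier H" "\<forall>h\<in>B n. \<exists>c\<in>C. \<exists>w\<in>{h \<in> carrier H. inc E h \<in> P}. h = c \<otimes>\<^bsub>H\<^esub> w"
      using B(2)[OF nb_inc[OF P(1)]] by blast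
    \<comment> \<open>Quotients of two elements of \<open>D m\<close> are products of four elements of \<open>V m\<close>, which costs two
      indices; one more is spent on dividing by a small lift \<open>q\<close>, and \<open>V (Suc n)\<close> is the neighbourhood
      whose trace on \<open>H\<close> lies in \<open>B n\<close>. Hence \<open>m = n + 4\<close>.\<close>
    let ?m = "Suc (Suc (Suc (Suc n)))"
    have nbVP: "nb (mid E) (V (Suc (Suc n)) \<inter> P)" by (intro X.nb_Int Vnb P(1))
    obtain A where A: "A \<subseteq> carrier G" "eventually (\<lambda>g. g \<in> A) \<xi>"
      "\<forall>g\<in>A. \<forall>h\<in>A. g \<otimes>\<^bsub>G\<^esub> inv\<^bsub>G\<^esub> h \<in> prj E ` (V (Suc (Suc n)) \<inter> P)"
      using G.cauchy_small[OF \<xi> prj_open[OF nbVP]] by blast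
    have "eventually (\<lambda>y. prj E y \<in> A) F"
      using filter_leD[OF F\<xi> A(2)] by (simp add: eventually_filtermap)
    then have evS: "eventually (\<lambda>y. y \<in> D ?m \<and> prj E y \<in> A) F" by (intro eventually_conj FD)
    from eventually_happens'[OF F(2) evS] obtain y where y: "y \<in> D ?m" "prj E y \<in> A" by blast
    have yc: "y \<in> carrier (mid E)" using y(1) Dc by blast
    define T where "T c = {(y \<otimes>\<^bsub>mid E\<^esub> inc E c) \<otimes>\<^bsub>mid E\<^esub> (p \<otimes>\<^bsub>mid E\<^esub> q) | p q. p \<in> P \<and> q \<in> P}" for c
    have "\<exists>c\<in>C. z \<in> T c" if z: "z \<in> D ?m" "prj E z \<in> A" for z
    proof -
      have zc: "z \<in> carrier (mid E)" using z(1) Dc by blast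
      let ?d = "z \<otimes>\<^bsub>mid E\<^esub> inv\<^bsub>mid E\<^esub> y"
      have dc: "?d \<in> carrier (mid E)" using zc yc by simp
      obtain u v where uv: "u \<in> V ?m" "v \<in> V ?m" "z = (x ?m \<otimes>\<^bsub>mid E\<^esub> u) \<otimes>\<^bsub>mid E\<^esub> v" using z(1) by (auto simp: D_def)
      obtain u' v' where uv': "u' \<in> V ?m" "v' \<in> V ?m" "y = (x ?m \<otimes>\<^bsub>mid E\<^esub> u') \<otimes>\<^bsub>mid E\<^esub> v'" using y(1) by (auto simp: D_def)
      have c: "u \<in> carrier (mid E)" "v \<in> carrier (mid E)" "u' \<in> carrier (mid E)" "v' \<in> carrier (mid E)"
        using Vc uv(1,2) uv'(1,2) by blast+
      have "?d = (u \<otimes>\<^bsub>mid E\<^esub> inv\<^bsub>mid E\<^esub> u') \<otimes>\<^bsub>mid E\<^esub> (v \<otimes>\<^bsub>mid E\<^esub> inv\<^bsub>mid E\<^esub> v')"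
        unfolding uv(3) uv'(3) using c xc[of ?m] by (simp only: X.div_mult_div X.m_closed X.inv_closed X.r_inv X.l_one)
      moreover have "u \<otimes>\<^bsub>mid E\<^esub> inv\<^bsub>mid E\<^esub> u' \<in> V (Suc (Suc (Suc n)))" "v \<otimes>\<^bsub>mid E\<^esub> inv\<^bsub>mid E\<^esub> v' \<in> V (Suc (Suc (Suc n)))"
        by (intro Vmult Vinv uv(1,2) uv'(1,2))+
      ultimately have dV: "?d \<in> V (Suc (Suc n))" using Vmult by simp
      obtain q where q: "q \<in> V (Suc (Suc n))" "q \<in> P" "prj E z \<otimes>\<^bsub>G\<^esub> inv\<^bsub>G\<^esub> prj E y = prj E q"
        using A(3) z(2) y(2) by blast
      have qc: "q \<in> carrier (mid E)" using Pc[OF q(2)] .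
      have "prj E ?d = prj E q" using q(3) zc yc by simp
      then obtain h where h: "h \<in> carrier H" "?d \<otimes>\<^bsub>mid E\<^esub> inv\<^bsub>mid E\<^esub> q = inc E h" using prj_eqD[OF dc qc] by blast
      have "inc E h \<in> V (Suc n)" unfolding h(2)[symmetric] by (intro Vmult Vinv dV q(1))
      then have "h \<in> B n" using VB h(1) by blast
      then obtain c w where cw: "c \<in> C" "w \<in> carrier H" "inc E w \<in> P" "h = c \<otimes>\<^bsub>H\<^esub> w" using nC(3) by blast
      have cc: "c \<in> carrier H" using cw(1) nC(2) by blast
      have "?d = (?d \<otimes>\<^bsub>mid E\<^esub> inv\<^bsub>mid E\<^esub> q) \<otimes>\<^bsub>mid E\<^esub> q" using dc qc by (simp only: X.m_assoc X.inv_closed X.l_inv X.r_one)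
      then have "?d = (inc E c \<otimes>\<^bsub>mid E\<^esub> inc E w) \<otimes>\<^bsub>mid E\<^esub> q" unfolding h(2) cw(4) using cc cw(2) by simp
      moreover have "z = y \<otimes>\<^bsub>mid E\<^esub> ?d" using zc yc by (simp add: X.m_comm[of z] X.mult_inv_cancel)
      ultimately have "z = (y \<otimes>\<^bsub>mid E\<^esub> inc E c) \<otimes>\<^bsub>mid E\<^esub> (inc E w \<otimes>\<^bsub>mid E\<^esub> q)"
        using yc cc cw(2) qc by (metis X.m_assoc X.m_closed inc_simps(1))
      then show ?thesis using cw(1,3) q(2) unfolding T_def by blast
    qed
    then have "eventually (\<lambda>z. \<exists>c\<in>C. z \<in> T c) F" using evS by (auto elim: eventually_mono)
    from ultrafilter_finite_union[OF F(2,3) nC(1) this]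
    obtain c where c: "c \<in> C" "eventually (\<lambda>z. z \<in> T c) F" by blast
    have cc: "y \<otimes>\<^bsub>mid E\<^esub> inc E c \<in> carrier (mid E)" using yc c(1) nC(2) by auto
    have "T c \<subseteq> carrier (mid E)" using cc Pc by (auto simp: T_def)
    moreover have "a \<otimes>\<^bsub>mid E\<^esub> inv\<^bsub>mid E\<^esub> b \<in> W" if ab: "a \<in> T c" "b \<in> T c" for a b
    proof -
      obtain p q where pq: "p \<in> P" "q \<in> P" "a = (y \<otimes>\<^bsub>mid E\<^esub> inc E c) \<otimes>\<^bsub>mid E\<^esub> (p \<otimes>\<^bsub>mid E\<^esub> q)" using ab(1) by (auto simp: T_def)
      obtain p' q' where pq': "p' \<in> P" "q' \<in> P" "b = (y \<otimes>\<^bsub>mid E\<^esub> inc E c) \<otimes>\<^bsub>mid E\<^esub> (p' \<otimes>\<^bsub>mid E\<^esub> q')" using ab(2) by (auto simp: T_def)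
      have "a \<otimes>\<^bsub>mid E\<^esub> inv\<^bsub>mid E\<^esub> b = (p \<otimes>\<^bsub>mid E\<^esub> inv\<^bsub>mid E\<^esub> p') \<otimes>\<^bsub>mid E\<^esub> (q \<otimes>\<^bsub>mid E\<^esub> inv\<^bsub>mid E\<^esub> q')"
        unfolding pq(3) pq'(3) using cc Pc[OF pq(1)] Pc[OF pq(2)] Pc[OF pq'(1)] Pc[OF pq'(2)]
        by (simp only: X.div_mult_div X.m_closed X.inv_closed X.r_inv X.l_one)
      then show ?thesis using P(2,3) pq pq' by simp
    qed
    ultimately show "\<exists>A. A \<subseteq> carrier (mid E) \<and> eventually (\<lambda>x. x \<in> A) F \<and> (\<forall>x\<in>A. \<forall>y\<in>A. x \<otimes>\<^bsub>mid E\<^esub> inv\<^bsub>mid E\<^esub> y \<in> W)"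
      using c(2) by blast
  qed
  moreover have "eventually (\<lambda>y. \<exists>u\<in>U. \<exists>v\<in>U. y = u \<otimes>\<^bsub>mid E\<^esub> v) F"
    using FD[of 0] by eventually_elim (use Vc V0 x0 in \<open>auto simp: D_def\<close>)
  ultimately show ?thesis using F\<xi> by blast
qed

end

section \<open>Extensions over the completion\<close>

lemma limitin_filtermap: "limitin T f l (filtermap g F) \<longleftrightarrow> limitin T (\<lambda>x. f (g x)) l F"
  by (simp add: limitin_def eventually_filtermap)

lemma (in dense_embedding) limitin_reflect:
  assumes "limitin (topo X) (\<lambda>x. e (f x)) \<one>\<^bsub>X\<^esub> F" and "eventually (\<lambda>x. f x \<in> carrier D) F"
  shows "limitin (topo D) f \<one>\<^bsub>D\<^esub> F"
  unfolding D.limitin_iff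
proof (intro conjI allI impI)
  fix U assume U: "nb D U"
  obtain V where V: "nb X V" "\<forall>d\<in>carrier D. e d \<in> V \<longrightarrow> d \<in> U" using nb_extend[OF U] by blast
  have "eventually (\<lambda>x. e (f x) \<in> carrier X \<and> e (f x) \<otimes>\<^bsub>X\<^esub> inv\<^bsub>X\<^esub> \<one>\<^bsub>X\<^esub> \<in> V) F"
    using assms(1) V(1) unfolding X.limitin_iff by blast
  then show "eventually (\<lambda>x. f x \<in> carrier D \<and> f x \<otimes>\<^bsub>D\<^esub> inv\<^bsub>D\<^esub> \<one>\<^bsub>D\<^esub> \<in> U) F"
    using assms(2) by eventually_elim (use V(2) in simp)
qed simp

text \<open>Surjectivity of the pull-back. The new extension has as middle group the completion \<open>Y\<close> of the
  middle group \<open>X\<close> of \<open>E\<close>, and as projection the continuous extension \<open>p\<close> of the composite of the projection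
  of \<open>E\<close> with \<open>j\<close>. A point of the kernel of \<open>p\<close> is the limit of a Cauchy filter on \<open>X\<close> lying over the
  identity, so it belongs to the complete group \<open>H\<close>. That \<open>p\<close> is open is shown by lifting: a point \<open>c\<close> near
  the identity is the limit of a Cauchy filter on \<open>G\<close> near the identity, which lifts to a Cauchy filter
  on \<open>X\<close> near the identity, and this one converges in \<open>Y\<close> to a preimage of \<open>c\<close>. Surjectivity then follows
  from the density of \<open>G\<close>.\<close>
lemma extension_over_completion:
  fixes E :: "('h, 'x, 'g) ext_seq"
  assumes H: "top_ab_group H" and G: "top_ab_group G" and E: "is_ext H G E"
    and am: "almost_metrizable H" and compH: "complete_top_group H"
    and j: "dense_embedding G C j" and compC: "complete_top_group C"
  shows "\<exists>E' :: ('h, 'x filter, 'c) ext_seq. is_ext H C E' \<and> ext_equiv H (pullback_ext G j E') E"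
proof -
  interpret E: extension H G E by unfold_locales (rule H G E)+
  interpret j: dense_embedding G C j by (rule j)
  define Y where "Y = E.X.completion"
  define e where "e = nhdsin (topo (mid E))"
  interpret e: dense_embedding "mid E" Y e
    unfolding Y_def e_def by (rule E.X.completion_dense_embedding)
  have conv: "\<exists>y. limitin (topo Y) e y F" if "cauchy_filter_on (mid E) F" for F
    using E.X.cauchy_limit_completion[OF that] unfolding Y_def e_def by blast
  have "j \<circ> prj E \<in> cont_hom (mid E) C" by (rule cont_hom_compose[OF E.prj_cont j.e_cont])
  from e.extend_to_complete[OF j.X.top_ab_group compC this]
  obtain p where p: "p \<in> cont_hom Y C" and pe: "\<And>x. x \<in> carrier (mid E) \<Longrightarrow> p (e x) = j (prj E x)" by auto
  note ph [simp] = cont_homD(1-4)[OF e.X.top_ab_group j.X.top_ab_group p]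
  have plim: "limitin (topo C) (\<lambda>x. j (prj E x)) (p y) F"
    if y: "limitin (topo Y) e y F" and F: "eventually (\<lambda>x. x \<in> carrier (mid E)) F" for y F
  proof -
    have "limitin (topo C) (p \<circ> e) (p y) F"
      using continuous_map_limit[OF _ y] p by (auto simp: cont_hom_def)
    moreover have "eventually (\<lambda>x. (p \<circ> e) x = j (prj E x)) F" using F by eventually_elim (simp add: pe)
    ultimately show ?thesis by (rule limitin_transform_eventually[rotated])
  qed
  have open_at_one: "\<exists>V. nb C V \<and> V \<subseteq> p ` S" if S: "nb Y S" for S
  proof -
    obtain S1 where S1: "nb Y S1" "\<forall>x\<in>S1. inv\<^bsub>Y\<^esub> x \<in> S1" "\<forall>x\<in>S1. \<forall>y\<in>S1. x \<otimes>\<^bsub>Y\<^esub> y \<in> S"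
      using e.X.nb_sym[OF S] by blast
    have "nb (mid E) {x \<in> carrier (mid E). e x \<in> S1}"
      by (rule cont_homD(5)[OF E.X.top_ab_group e.X.top_ab_group e.e_cont S1(1)])
    from E.X.nb_sym[OF this] obtain U where U: "nb (mid E) U"
      "\<forall>x\<in>U. \<forall>y\<in>U. x \<otimes>\<^bsub>mid E\<^esub> y \<in> {x \<in> carrier (mid E). e x \<in> S1}" by blast
    obtain V where V: "nb C V" "\<forall>g\<in>carrier G. j g \<in> V \<longrightarrow> g \<in> prj E ` U"
      using j.nb_extend[OF E.prj_open[OF U(1)]] by blast
    \<comment> \<open>The lift lives on \<open>U U\<close>, which \<open>e\<close> maps into \<open>S1\<close>; its limit is in the closure of \<open>S1\<close>, hence in
      \<open>S\<close>.\<close>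
    have "c \<in> p ` S" if c: "c \<in> V" for c
    proof -
      have cc: "c \<in> carrier C" using c j.X.nb_carrier[OF V(1)] by blast
      note tr = j.trace_filter[OF cc]
      have "eventually (\<lambda>g. g \<in> prj E ` U) (j.trace_filter c)"
        unfolding j.eventually_trace_filter[OF cc] using V c by (auto simp: nb_def)
      from E.lift_cauchy_filter[OF am U(1) tr(4) this]
      obtain F where F: "cauchy_filter_on (mid E) F" "filtermap (prj E) F \<le> j.trace_filter c"
        "eventually (\<lambda>x. \<exists>u\<in>U. \<exists>v\<in>U. x = u \<otimes>\<^bsub>mid E\<^esub> v) F" by blast
      obtain y where y: "limitin (topo Y) e y F" using conv[OF F(1)] by blast
      have yc: "y \<in> carrier Y" using y by (simp add: limitin_def)
      have "limitin (topo C) j c (filtermap (prj E) F)"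
        using tr(3) F(2) by (auto simp: limitin_def dest: filter_leD)
      then have "limitin (topo C) (\<lambda>x. j (prj E x)) c F" by (simp add: limitin_filtermap)
      then have "c = p y"
        by (rule j.X.limit_unique[OF _ plim[OF y E.X.cauchy_carrier[OF F(1)]] E.X.cauchy_bot[OF F(1)]])
      moreover have "y \<in> S"
      proof -
        have "eventually (\<lambda>x. e x \<in> carrier Y \<and> e x \<otimes>\<^bsub>Y\<^esub> inv\<^bsub>Y\<^esub> y \<in> S1) F"
          using y S1(1) unfolding e.X.limitin_iff by blast
        from eventually_happens'[OF E.X.cauchy_bot[OF F(1)] eventually_conj[OF this F(3)]]
        obtain x where x: "e x \<in> carrier Y" "e x \<otimes>\<^bsub>Y\<^esub> inv\<^bsub>Y\<^esub> y \<in> S1" "\<exists>u\<in>U. \<exists>v\<in>U. x = u \<otimes>\<^bsub>mid E\<^esub> v" by blast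
        then have "e x \<in> S1" using U(2) by blast
        then have "e x \<otimes>\<^bsub>Y\<^esub> inv\<^bsub>Y\<^esub> (e x \<otimes>\<^bsub>Y\<^esub> inv\<^bsub>Y\<^esub> y) \<in> S" using S1 x(2) by blast
        moreover have "e x \<otimes>\<^bsub>Y\<^esub> inv\<^bsub>Y\<^esub> (e x \<otimes>\<^bsub>Y\<^esub> inv\<^bsub>Y\<^esub> y) = y"
          using x(1) yc by (simp add: e.X.inv_mult e.X.mult_inv_cancel)
        ultimately show ?thesis by simp
      qed
      ultimately show ?thesis by blast
    qed
    then show ?thesis using V(1) by blast
  qed
  define E' :: "('h, 'x filter, 'c) ext_seq" where "E' = \<lparr>mid = Y, inc = e \<circ> inc E, prj = p\<rparr>"
  have m: "mid E' = Y" "inc E' = e \<circ> inc E" "prj E' = p" by (simp_all add: E'_def)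
  have E': "is_ext H C E'"
  proof (rule is_extI[OF H j.X.top_ab_group], unfold m)
    show "top_ab_group Y" by (rule e.X.top_ab_group)
    show "e \<circ> inc E \<in> cont_hom H Y" by (rule cont_hom_compose[OF E.inc_cont e.e_cont])
    show "p \<in> cont_hom Y C" by (rule p)
    show "\<exists>V. nb Y V \<and> (\<forall>h\<in>carrier H. (e \<circ> inc E) h \<in> V \<longrightarrow> h \<in> U)" if U: "nb H U" for U
    proof -
      obtain V where V: "nb (mid E) V" "\<forall>h\<in>carrier H. inc E h \<in> V \<longrightarrow> h \<in> U" using E.inc_embedding[OF U] by blast
      obtain V' where "nb Y V'" "\<forall>x\<in>carrier (mid E). e x \<in> V' \<longrightarrow> x \<in> V" using e.nb_extend[OF V(1)] by blast
      then show ?thesis using V(2) by (intro exI[of _ V']) auto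
    qed
    show "\<exists>V. nb C V \<and> V \<subseteq> p ` U" if "nb Y U" for U by (rule open_at_one[OF that])
    show "p ((e \<circ> inc E) h) = \<one>\<^bsub>C\<^esub>" if "h \<in> carrier H" for h using that by (simp add: pe)
    show "y \<in> (e \<circ> inc E) ` carrier H" if y: "y \<in> carrier Y" "p y = \<one>\<^bsub>C\<^esub>" for y
    proof -
      note tr = e.trace_filter[OF y(1)]
      have "limitin (topo C) (\<lambda>x. j (prj E x)) \<one>\<^bsub>C\<^esub> (e.trace_filter y)"
        using plim[OF tr(3,2)] y(2) by simp
      moreover have "eventually (\<lambda>x. prj E x \<in> carrier G) (e.trace_filter y)"
        using tr(2) by eventually_elim simp
      ultimately have "limitin (topo G) (prj E) \<one>\<^bsub>G\<^esub> (e.trace_filter y)" by (rule j.limitin_reflect)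
      from E.cauchy_over_one_converges[OF compH tr(4) this]
      obtain h where h: "h \<in> carrier H" "limitin (topo (mid E)) (\<lambda>x. x) (inc E h) (e.trace_filter y)" by blast
      have "limitin (topo Y) (e \<circ> (\<lambda>x. x)) (e (inc E h)) (e.trace_filter y)"
        using continuous_map_limit[OF _ h(2)] e.e_cont by (auto simp: cont_hom_def)
      then have "limitin (topo Y) e (e (inc E h)) (e.trace_filter y)" by (simp add: o_def)
      then have "y = e (inc E h)" using e.X.limit_unique[OF tr(3) _ tr(1)] by blast
      then show ?thesis using h(1) by auto
    qed
    show "c \<in> p ` carrier Y" if c: "c \<in> carrier C" for c
    proof -
      obtain V where V: "nb C V" "V \<subseteq> p ` carrier Y" using open_at_one[OF e.X.nb_UNIV] by blast
      obtain g where g: "g \<in> carrier G" "inv\<^bsub>C\<^esub> c \<otimes>\<^bsub>C\<^esub> j g \<in> V"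
        using j.dense_meets[OF j.X.nb_at[OF V(1) c]] by blast
      obtain y where y: "y \<in> carrier Y" "inv\<^bsub>C\<^esub> c \<otimes>\<^bsub>C\<^esub> j g = p y" using V(2) g(2) by blast
      obtain x where x: "x \<in> carrier (mid E)" "g = prj E x" using g(1) E.prj_surj by blast
      have "p (e x \<otimes>\<^bsub>Y\<^esub> inv\<^bsub>Y\<^esub> y) = j g \<otimes>\<^bsub>C\<^esub> inv\<^bsub>C\<^esub> (inv\<^bsub>C\<^esub> c \<otimes>\<^bsub>C\<^esub> j g)"
        using x y by (simp add: pe)
      also have "\<dots> = c"
        using c g(1) by (simp add: j.X.m_comm[of "inv\<^bsub>C\<^esub> c"] j.X.inv_mult j.X.mult_inv_cancel)
      finally show ?thesis using x(1) y(1) by (metis e.X.inv_closed e.X.m_closed e.e_simps(1) imageI)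
    qed
  qed
  have "ext_morphism H (\<lambda>h. h) j E E'"
    unfolding ext_morphism_def m by (intro bexI[OF _ e.e_cont]) (simp add: pe)
  then have "ext_equiv H E (pullback_ext G j E')"
    unfolding ext_equiv_morphism by (rule pullback_universal[OF _ E H G cont_hom_ident G])
  then have "ext_equiv H (pullback_ext G j E') E"
    by (rule ext_equiv_sym[OF H G E pullback_is_ext[OF H j.X.top_ab_group E' G j.e_cont]])
  then show ?thesis using E' by blast
qed

text \<open>Preimages of dense sets under open maps are dense: the pull-back along \<open>j\<close> is the preimage of \<open>j G\<close>
  in the middle group.\<close>
lemma pullback_dense:
  fixes E :: "('h, 'x, 'c) ext_seq"
  assumes H: "top_ab_group H" and j: "dense_embedding G C j" and E: "is_ext H C E"
  shows "dense_embedding (mid (pullback_ext G j E)) (mid E) fst"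
proof -
  interpret j: dense_embedding G C j by (rule j)
  interpret E: extension H C E by unfold_locales (rule H E)+
  let ?P = "mid (pullback_ext G j E)"
  interpret P: extension H G "pullback_ext G j E"
    by unfold_locales (rule pullback_is_ext[OF H j.X.top_ab_group E j.D.top_ab_group j.e_cont])
  define A where "A = {(x, g) \<in> carrier (mid E) \<times> carrier G. prj E x = j g}"
  have P: "?P = sub_top_group (prod_top_group (mid E) G) A" by (simp add: pullback_ext_def A_def)
  show ?thesis
  proof (rule dense_embeddingI[OF P.X.top_ab_group E.X.top_ab_group])
    show "fst \<in> cont_hom ?P (mid E)"
      unfolding P by (rule cont_hom_from_sub[OF cont_hom_fst]) (auto simp: A_def)
    show "\<exists>V. nb (mid E) V \<and> (\<forall>d\<in>carrier ?P. fst d \<in> V \<longrightarrow> d \<in> W)" if W: "nb ?P W" for W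
    proof -
      obtain W' where W': "nb (prod_top_group (mid E) G) W'" "W = W' \<inter> A"
        using W unfolding P by (subst (asm) nb_sub_iff) (auto simp: A_def)
      obtain U V where UV: "nb (mid E) U" "nb G V" "\<And>u v. u \<in> U \<Longrightarrow> v \<in> V \<Longrightarrow> (u, v) \<in> W'"
        using nb_prodD[OF W'(1)] by blast
      obtain V' where V': "nb C V'" "\<forall>g\<in>carrier G. j g \<in> V' \<longrightarrow> g \<in> V" using j.nb_extend[OF UV(2)] by blast
      have "nb (mid E) (U \<inter> {x \<in> carrier (mid E). prj E x \<in> V'})"
        by (intro E.X.nb_Int UV(1) E.nb_prj V'(1))
      moreover have "d \<in> W" if d: "d \<in> carrier ?P" "fst d \<in> U \<inter> {x \<in> carrier (mid E). prj E x \<in> V'}" for d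
      proof -
        obtain x g where xg: "d = (x, g)" "x \<in> carrier (mid E)" "g \<in> carrier G" "prj E x = j g"
          using d(1) unfolding P by (auto simp: A_def)
        then show ?thesis using d(2) V'(2) UV(3) by (auto simp: W'(2) A_def)
      qed
      ultimately show ?thesis by blast
    qed
    show "\<exists>d\<in>carrier ?P. fst d \<in> S" if S: "openin (topo (mid E)) S" "x \<in> S" for S x
    proof -
      have xc: "x \<in> carrier (mid E)" using S E.X.openin_carrier by blast
      have "nb C (prj E ` {u \<in> carrier (mid E). x \<otimes>\<^bsub>mid E\<^esub> u \<in> S})"
        by (rule E.prj_open[OF E.X.nb_translate[OF S]])
      from j.dense_meets[OF j.X.nb_at[OF this E.prj_simps(1)[OF xc]]]
      obtain g u where gu: "g \<in> carrier G" "u \<in> carrier (mid E)" "x \<otimes>\<^bsub>mid E\<^esub> u \<in> S"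
        "inv\<^bsub>C\<^esub> prj E x \<otimes>\<^bsub>C\<^esub> j g = prj E u" by blast
      have "prj E (x \<otimes>\<^bsub>mid E\<^esub> u) = prj E x \<otimes>\<^bsub>C\<^esub> (inv\<^bsub>C\<^esub> prj E x \<otimes>\<^bsub>C\<^esub> j g)"
        using gu(2,4) xc by simp
      also have "\<dots> = j g" using gu(1) xc by (simp add: j.X.mult_inv_cancel)
      finally have "(x \<otimes>\<^bsub>mid E\<^esub> u, g) \<in> A" using gu xc by (simp add: A_def)
      then show ?thesis using gu(3) by (intro bexI[of _ "(x \<otimes>\<^bsub>mid E\<^esub> u, g)"]) (simp_all add: P)
    qed
  qed
qed

text \<open>Injectivity of the pull-back. An equivalence of the pull-backs is a homomorphism on a dense
  subgroup of \<open>mid E\<close> with values in \<open>mid F\<close>, which is complete by \<open>mid_complete\<close>; its continuous extension is an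
  equivalence, since the projections agree on a dense subgroup.\<close>
lemma ext_equiv_of_pullback_equiv:
  assumes H: "top_ab_group H" and compH: "complete_top_group H"
    and j: "dense_embedding G C j" and compC: "complete_top_group C"
    and E: "is_ext H C E" and F: "is_ext H C F"
    and eq: "ext_equiv H (pullback_ext G j E) (pullback_ext G j F)"
  shows "ext_equiv H E F"
proof -
  interpret j: dense_embedding G C j by (rule j)
  interpret E: extension H C E by unfold_locales (rule H E)+
  interpret F: extension H C F by unfold_locales (rule F)
  interpret d: dense_embedding "mid (pullback_ext G j E)" "mid E" fst by (rule pullback_dense[OF H j E])
  have "ext_morphism H (\<lambda>h. h) j (pullback_ext G j E) F"
    using ext_morphism_compose[OF eq[unfolded ext_equiv_morphism] pullback_morphism] by simp
  then obtain T where T: "T \<in> cont_hom (mid (pullback_ext G j E)) (mid F)"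
    "\<And>h. h \<in> carrier H \<Longrightarrow> T (inc (pullback_ext G j E) h) = inc F h"
    "\<And>x. x \<in> carrier (mid (pullback_ext G j E)) \<Longrightarrow> prj F (T x) = j (prj (pullback_ext G j E) x)"
    unfolding ext_morphism_def by blast
  obtain S where S: "S \<in> cont_hom (mid E) (mid F)"
    "\<And>d. d \<in> carrier (mid (pullback_ext G j E)) \<Longrightarrow> S (fst d) = T d"
    using d.extend_to_complete[OF F.X.top_ab_group F.mid_complete[OF compH compC] T(1)] by blast
  have "S (inc E h) = inc F h" if h: "h \<in> carrier H" for h
  proof -
    have "(inc E h, \<one>\<^bsub>G\<^esub>) \<in> carrier (mid (pullback_ext G j E))" using h by (simp add: pullback_ext_def)
    from S(2)[OF this] show ?thesis using T(2)[OF h] by (simp add: pullback_ext_def)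
  qed
  moreover have "prj F (S x) = prj E x" if x: "x \<in> carrier (mid E)" for x
  proof -
    have "(prj F \<circ> S) x = prj E x"
    proof (rule d.eq_on_dense[OF j.X.top_ab_group cont_hom_compose[OF S(1) F.prj_cont] E.prj_cont _ x])
      fix d assume d: "d \<in> carrier (mid (pullback_ext G j E))"
      then have "(prj F \<circ> S) (fst d) = j (snd d)" using S(2)[OF d] T(3)[OF d] by (simp add: pullback_ext_def)
      then show "(prj F \<circ> S) (fst d) = prj E (fst d)" using d by (auto simp: pullback_ext_def)
    qed
    then show ?thesis by simp
  qed
  ultimately show ?thesis unfolding ext_equiv_def using S(1) by blast
qed

theorem theorem6:
  fixes G :: "'g top_group" and H :: "'h top_group"
    and \<rho>G :: "'c top_group" and j :: "'g \<Rightarrow> 'c"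
  assumes "top_ab_group G" and "top_ab_group H"
    and "Cech_complete H"
    and "is_completion G \<rho>G j"
  shows "Ext G H \<cong> Ext \<rho>G H"
proof -
  have am: "almost_metrizable H" and compH: "complete_top_group H"
    using assms(3) by (auto simp: Cech_complete_def)
  have C: "top_ab_group \<rho>G" and compC: "complete_top_group \<rho>G"
    using assms(4) by (auto simp: is_completion_def)
  interpret j: dense_embedding G \<rho>G j
    using assms(1,4) by unfold_locales (auto simp: is_completion_def)
  show ?thesis
  proof (rule Ext_iso_of_pullback[OF assms(2,1) C j.e_cont])
    fix E E' :: "('h, 'h \<times> 'c, 'c) ext_seq"
    assume "is_ext H \<rho>G E" "is_ext H \<rho>G E'" "ext_equiv H (pullback_ext G j E) (pullback_ext G j E')"
    then show "ext_equiv H E E'"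
      by (rule ext_equiv_of_pullback_equiv[OF assms(2) compH j.dense_embedding_axioms compC])
  next
    fix E :: "('h, 'h \<times> 'g, 'g) ext_seq"
    assume E: "is_ext H G E"
    obtain E' :: "('h, ('h \<times> 'g) filter, 'c) ext_seq"
      where E': "is_ext H \<rho>G E'" "ext_equiv H (pullback_ext G j E') E"
      using extension_over_completion[OF assms(2,1) E am compH j.dense_embedding_axioms compC] by blast
    obtain F :: "('h, 'h \<times> 'c, 'c) ext_seq" where F: "is_ext H \<rho>G F" "ext_equiv H F E'"
      using ext_has_small_representative[OF assms(2) C E'(1)] by blast
    have "ext_equiv H (pullback_ext G j F) E"
      by (rule ext_equiv_trans[OF pullback_equiv_cong[OF assms(2) C assms(1) j.e_cont F] E'(2)])
    then show "\<exists>F :: ('h, 'h \<times> 'c, 'c) ext_seq. is_ext H \<rho>G F \<and> ext_equiv H (pullback_ext G j F) E"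
      using F(1) by blast
  qed
qed

end
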